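(* Let $V\in S(1)$ be a real-valued potential on $\mathbb{R}^d$, $(b-a)$-periodic in each coordinate, and let $A$ and $B$ be the finite difference discretizations of $-\frac12\Delta$ and of $V(x)$ with periodic boundary conditions, with $N$ grid points per dimension. Let $H_I(t)=e^{iAt}Be^{-iAt}$ be the interaction picture Hamiltonian, and let $\alpha$ satisfy $\|H_I(t)\|\le\alpha$ for all $t\in[0,T]$. Let $\Delta t=T/L$ with $1/N\le\Delta t\le1$. Then $$\left\|U_{\mathrm{exact}}(T,0)-\tilde U_2(T,0)\right\|\le\Delta t^4\,T\,C_V\left(\frac{13}{24}+\frac{5}{12}\Delta t\,\alpha\right)+C\,\frac{T\Delta t}{M}(1+3\Delta t\,\alpha)N ,$$ where $C_V$ is a constant depending only on $V$ and the dimension $d$, independent of $N$ and $\Delta t$, and $C$ is an absolute constant. Here $U_{\mathrm{exact}}(T,0)=\mathcal{T}e^{-i\int_0^TH_I(s)\,ds}$, and $\tilde U_2(T,0)$ is the $L$-step second-order Magnus approximation for $H=H_I$ with Riemann sum quadrature with $M$ quadrature points on each step.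
   Context: $V\in S(1)$ means $V$ is smooth and bounded together with all its derivatives. $\|\cdot\|$ is the matrix operator (spectral) norm, $[X,Y]=XY-YX$. Discretization: the grid points in one dimension are $x_j=a+(b-a)j/N$, $0\le j\le N-1$. In dimension one, $A=\tilde A_{\mathrm{dis}}$ acts on $f=(f_0,\dots,f_{N-1})$ (indices modulo $N$) by $(\tilde A_{\mathrm{dis}}f)_j=\frac{N^2}{2(b-a)^2}(2f_j-f_{j+1}-f_{j-1})$, and $B=\mathrm{diag}(V(x_0),\dots,V(x_{N-1}))$. In dimension $d$, $A=\tilde A_{\mathrm{dis}}\otimes I_N^{\otimes(d-1)}+I_N\otimes\tilde A_{\mathrm{dis}}\otimes I_N^{\otimes(d-2)}+\dots+I_N^{\otimes(d-1)}\otimes\tilde A_{\mathrm{dis}}$, with $I_N$ the $N\times N$ identity, and $B$ is the diagonal matrix of the values of $V$ at the grid points. The time-ordered exponential $\mathcal{T}e^{-i\int_0^tH(s)ds}$ is the solution of $\partial_tU(t)=-iH(t)U(t)$, $U(0)=I$. With $t_j=j\Delta t$, $0\le j\le L$, the Magnus approximation is $\tilde U_2(T,0)=\tilde U_2(t_L,t_{L-1})\cdots\tilde U_2(t_1,t_0)$, $\tilde U_2(t_{j+1},t_j)=e^{\tilde\Omega_2(t_{j+1},t_j)}$, where $\tilde\Omega_2(t_{j+1},t_j)$ is the Riemann sum quadrature, with $M$ quadrature points, of $$\Omega_2(t_{j+1},t_j)=-i\int_{t_j}^{t_{j+1}}H(s)\,ds+\frac12\int_{t_j}^{t_{j+1}}\left[\int_{t_j}^sH(\sigma)\,d\sigma,H(s)\right]ds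 .$$
   Formalization: C is not absolute: it may depend on a, b, d and on a bound for the first partial derivatives of V (with an absolute C the claim fails, e.g. for V = λcos(2πx), L = M = 1, Δt = 1/N, λ large); a and b are fixed, so C_V may depend on them too. *)

theory Defs
  imports "HOL-Analysis.Analysis" "Jordan_Normal_Form.Matrix"
begin

text \<open>Smooth functions on \<open>\<real>\<^sup>d\<close>, with \<open>d = CARD('d)\<close>\<close>

definition partial_deriv :: "'d::finite \<Rightarrow> (real^'d \<Rightarrow> real) \<Rightarrow> real^'d \<Rightarrow> real" where
  "partial_deriv i f x = frechet_derivative f (at x) (axis i 1)"

text \<open>\<open>S(1)\<close>: every iterated partial derivative (the list \<open>[]\<close> gives \<open>V\<close> itself) is
  differentiable everywhere, hence exists to the next order, and is bounded.\<close>

definition symbol_class_S1 :: "(real^'d::finite \<Rightarrow> real) \<Rightarrow> bool" where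
  "symbol_class_S1 V \<longleftrightarrow>
     (\<forall>js. foldr partial_deriv js V differentiable_on UNIV \<and>
           bounded (range (foldr partial_deriv js V)))"

definition coordinatewise_periodic :: "real \<Rightarrow> (real^'d::finite \<Rightarrow> real) \<Rightarrow> bool" where
  "coordinatewise_periodic p V \<longleftrightarrow> (\<forall>i x. V (x + axis i p) = V x)"

text \<open>Complex matrices: sums, Kronecker product, spectral norm, exponential\<close>

definition msum :: "nat \<Rightarrow> (nat \<Rightarrow> complex mat) \<Rightarrow> nat set \<Rightarrow> complex mat" where
  "msum m F K = Matrix.mat m m (\<lambda>(p, q). \<Sum>k\<in>K. F k $$ (p, q))"

definition kronecker :: "complex mat \<Rightarrow> complex mat \<Rightarrow> complex mat" (infixr "\<otimes>\<^sub>m" 70) where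
  "X \<otimes>\<^sub>m Y = Matrix.mat (dim_row X * dim_row Y) (dim_col X * dim_col Y)
     (\<lambda>(p, q). X $$ (p div dim_row Y, q div dim_col Y) * Y $$ (p mod dim_row Y, q mod dim_col Y))"

definition euclid_norm :: "complex Matrix.vec \<Rightarrow> real" where
  "euclid_norm v = L2_set (\<lambda>k. cmod (vec_index v k)) {..<dim_vec v}"

definition spectral_norm :: "complex mat \<Rightarrow> real" where
  "spectral_norm X =
     (SUP v\<in>{v \<in> carrier_vec (dim_col X). euclid_norm v = 1}. euclid_norm (X *\<^sub>v v))"

definition mat_exp :: "complex mat \<Rightarrow> complex mat" where
  "mat_exp X = Matrix.mat (dim_row X) (dim_row X) (\<lambda>(p, q). \<Sum>k. (X ^\<^sub>m k) $$ (p, q) / fact k)"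

definition commutator :: "complex mat \<Rightarrow> complex mat \<Rightarrow> complex mat" where
  "commutator X Y = X * Y - Y * X"

text \<open>Finite difference discretization on \<open>[a,b]\<^sup>d\<close> with \<open>N\<close> points per dimension\<close>

text \<open>The three terms are added, not split by cases, so that for \<open>N \<le> 2\<close>, where the neighbours
  modulo \<open>N\<close> coincide with each other or with \<open>j\<close>, the entries are still those of the operator.\<close>

definition A_dis1 :: "real \<Rightarrow> real \<Rightarrow> nat \<Rightarrow> complex mat" where
  "A_dis1 a b N = Matrix.mat N N (\<lambda>(j, k).
     complex_of_real ((real N)\<^sup>2 / (2 * (b - a)\<^sup>2) *
       (2 * of_bool (k = j) - of_bool (k = (j + 1) mod N) - of_bool (k = (j + N - 1) mod N))))"

definition A_dis :: "nat \<Rightarrow> real \<Rightarrow> real \<Rightarrow> nat \<Rightarrow> complex mat" where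
  "A_dis d a b N =
     msum (N ^ d) (\<lambda>l. 1\<^sub>m (N ^ l) \<otimes>\<^sub>m A_dis1 a b N \<otimes>\<^sub>m 1\<^sub>m (N ^ (d - 1 - l))) {..<d}"

text \<open>The tensor factors are matched with the coordinates of \<open>\<real>\<^sup>d\<close> by the fixed bijection
  \<open>to_nat_on UNIV\<close> from \<open>'d\<close> onto \<open>{..<d}\<close>. Row \<open>p < N\<^sup>d\<close> is read as a \<open>d\<close>-digit number in base
  \<open>N\<close>, most significant digit first, as dictated by the Kronecker product.\<close>

definition grid_point :: "real \<Rightarrow> real \<Rightarrow> nat \<Rightarrow> nat \<Rightarrow> real^'d::finite" where
  "grid_point a b N p = (\<chi> i. a + (b - a) *
     real ((p div N ^ (CARD('d) - 1 - to_nat_on (UNIV :: 'd set) i)) mod N) / real N)"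

definition B_dis :: "real \<Rightarrow> real \<Rightarrow> nat \<Rightarrow> (real^'d::finite \<Rightarrow> real) \<Rightarrow> complex mat" where
  "B_dis a b N V = mat_diag (N ^ CARD('d)) (\<lambda>p. complex_of_real (V (grid_point a b N p)))"

definition H_int :: "complex mat \<Rightarrow> complex mat \<Rightarrow> real \<Rightarrow> complex mat" where
  "H_int A B t =
     mat_exp ((\<i> * complex_of_real t) \<cdot>\<^sub>m A) * B * mat_exp ((- \<i> * complex_of_real t) \<cdot>\<^sub>m A)"

text \<open>\<open>U\<close> solves \<open>\<partial>\<^sub>t U = -i H U\<close>, \<open>U(0) = I\<close> on \<open>[0,T]\<close> (entrywise derivative), i.e.
  \<open>U(t)\<close> is the time-ordered exponential of \<open>H\<close>.\<close>

definition time_ordered_exp ::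
    "nat \<Rightarrow> (real \<Rightarrow> complex mat) \<Rightarrow> real \<Rightarrow> (real \<Rightarrow> complex mat) \<Rightarrow> bool" where
  "time_ordered_exp m H T U \<longleftrightarrow>
     U 0 = 1\<^sub>m m \<and>
     (\<forall>t\<in>{0..T}. U t \<in> carrier_mat m m \<and>
        (\<forall>p<m. \<forall>q<m. ((\<lambda>s. U s $$ (p, q)) has_vector_derivative
            ((- \<i>) \<cdot>\<^sub>m (H t * U t)) $$ (p, q)) (at t within {0..T})))"

text \<open>Second-order Magnus approximation with left Riemann sums: on the step \<open>[t, t + h]\<close> the nodes
  are \<open>s\<^sub>k = t + k h / M\<close>, \<open>0 \<le> k < M\<close>, and the inner integral over \<open>[t, s\<^sub>k]\<close> uses the nodes
  \<open>s\<^sub>l\<close> with \<open>l < k\<close>.\<close>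

definition magnus_Omega2 ::
    "nat \<Rightarrow> nat \<Rightarrow> (real \<Rightarrow> complex mat) \<Rightarrow> real \<Rightarrow> real \<Rightarrow> complex mat" where
  "magnus_Omega2 m M H t h =
     (let w = h / real M; s = (\<lambda>k. t + real k * w) in
      (- \<i> * complex_of_real w) \<cdot>\<^sub>m msum m (\<lambda>k. H (s k)) {..<M} +
      complex_of_real (w\<^sup>2 / 2) \<cdot>\<^sub>m
        msum m (\<lambda>k. commutator (msum m (\<lambda>l. H (s l)) {..<k}) (H (s k))) {..<M})"

fun magnus_U2 :: "nat \<Rightarrow> nat \<Rightarrow> (real \<Rightarrow> complex mat) \<Rightarrow> real \<Rightarrow> nat \<Rightarrow> complex mat" where
  "magnus_U2 m M H h 0 = 1\<^sub>m m"
| "magnus_U2 m M H h (Suc j) =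
     mat_exp (magnus_Omega2 m M H (real j * h) h) * magnus_U2 m M H h j"

end

theory Submission
  imports Defs
begin

text \<open>
  With left Riemann sums, \<open>\<Omega>\<^sub>2\<close> is exactly the second order Magnus exponent of the piecewise constant
  Hamiltonian that takes the nodal values of \<open>H\<^sub>I\<close>. Replacing \<open>H\<^sub>I\<close> by it costs the Lipschitz constant
  \<open>\<parallel>[A, B]\<parallel> = O(N)\<close> and gives the second error term. For the piecewise constant problem the exact flow is
  an ordered product of exponentials, and adjoining one more factor of step \<open>w = \<Delta>t / M\<close> perturbs the
  exponent by double commutators only; the local error is \<open>O(\<Delta>t\<^sup>5)\<close> as soon as
  \<open>\<parallel>[H\<^sub>I(t), H\<^sub>I(s)]\<parallel> = O(\<Delta>t)\<close> and \<open>\<parallel>[H\<^sub>I(r), [H\<^sub>I(t), H\<^sub>I(s)]]\<parallel> = O(\<Delta>t\<^sup>2)\<close> within one step, uniformly in \<open>N\<close>.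

  These commutator bounds come from the discrete Fourier expansion of \<open>B\<close>. Conjugating a plane wave \<open>E\<close> by
  \<open>exp(itA)\<close> gives \<open>E exp(t X)\<close>, where \<open>X\<close> is \<open>\<i>\<close> times the difference of \<open>A\<close> in the direction of the
  frequency of \<open>E\<close>; all these exponents commute with each other. Single commutators therefore involve second
  differences of the symbol of \<open>A\<close>, which are \<open>O(1)\<close>, and double commutators in addition third differences,
  which are \<open>O(1/N)\<close>, hence \<open>O(\<Delta>t)\<close>. The Fourier coefficients of \<open>B\<close> decay fast enough uniformly in \<open>N\<close>
  because they can be estimated by divided differences of \<open>V\<close>.

  All matrices are regarded as operators on one fixed space \<open>\<ell>\<^sup>2\<close>, since their size is not a type.
\<close>

section \<open>The Hilbert space and its operator algebra\<close>

text \<open>The obstacle is uniformity in \<open>N\<close>: the discrete Laplacian has norm of order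
  N^2, so no final estimate may contain the norm of \<open>A\<close>. What keeps it out is
  skew-adjointness. Exponentials of skew-adjoint operators are contractions, so differentiating
  along a path between two products of exponentials leaves a commutator, or a difference of
  exponents, between contractions. For the same reason local errors add up over the steps without
  amplification.

  For plane waves the dangerous factor N^2 is then distributed over differences: N (z - 1) stays
  bounded as \<open>N\<close> grows with the frequency fixed, and a single commutator contains
  exactly two such differences.

  The fixed space also supplies the norm, the series and the derivatives of a Banach algebra. Its
  type classes are real, so complex scalars enter as central elements \<open>cs c\<close>. A matrix
  of size \<open>m\<close> occupies a corner of the algebra in which the unit is the projection
  \<open>proj m\<close> and not 1; this is the origin of the factors \<open>proj m\<close> and of
  initial values that are only contractions.\<close>

typedef l2 = "{f :: nat \<Rightarrow> complex. summable (\<lambda>n. (cmod (f n))\<^sup>2)}"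
  morphisms coord mk_l2
  by (rule exI[of _ "\<lambda>_. 0"]) simp

lemma summable_coord: "summable (\<lambda>n. (cmod (coord f n))\<^sup>2)"
  using coord[of f] by simp

lemma coord_mk_l2: "summable (\<lambda>n. (cmod (f n))\<^sup>2) \<Longrightarrow> coord (mk_l2 f) = f"
  by (simp add: mk_l2_inverse)

lemma l2_eqI: "(\<And>n. coord f n = coord g n) \<Longrightarrow> f = g"
  by (simp add: coord_inject[symmetric] ext)

lemma cmod_add_square_le: "(cmod (x + y))\<^sup>2 \<le> 2 * (cmod x)\<^sup>2 + 2 * (cmod y)\<^sup>2"
proof -
  have "(cmod (x + y))\<^sup>2 \<le> (cmod x + cmod y)\<^sup>2"
    by (intro power_mono norm_triangle_ineq) simp
  also have "\<dots> \<le> 2 * (cmod x)\<^sup>2 + 2 * (cmod y)\<^sup>2"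
    using zero_le_power2[of "cmod x - cmod y"] by (simp add: power2_eq_square algebra_simps)
  finally show ?thesis .
qed

lemma summable_square_add:
  assumes "summable (\<lambda>n. (cmod (f n))\<^sup>2)" "summable (\<lambda>n. (cmod (g n))\<^sup>2)"
  shows "summable (\<lambda>n. (cmod (f n + g n))\<^sup>2)"
  by (rule summable_comparison_test'[where N = 0,
        OF summable_add[OF summable_mult[OF assms(1), of 2] summable_mult[OF assms(2), of 2]]])
    (simp add: cmod_add_square_le)

lemma summable_square_mult:
  assumes "summable (\<lambda>n. (cmod (f n))\<^sup>2)"
  shows "summable (\<lambda>n. (cmod (c * f n))\<^sup>2)"
  using summable_mult[OF assms, of "(cmod c)\<^sup>2"] by (simp add: norm_mult power_mult_distrib)

instantiation l2 :: real_vector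
begin
definition "0 = mk_l2 (\<lambda>_. 0)"
definition "f + g = mk_l2 (\<lambda>n. coord f n + coord g n)"
definition "- f = mk_l2 (\<lambda>n. - coord f n)"
definition "f - g = mk_l2 (\<lambda>n. coord f n - coord g n)"
definition "scaleR r f = mk_l2 (\<lambda>n. complex_of_real r * coord f n)"

lemma coord_zero [simp]: "coord 0 n = 0"
  by (simp add: zero_l2_def coord_mk_l2)
lemma coord_add [simp]: "coord (f + g) n = coord f n + coord g n"
  by (simp add: plus_l2_def coord_mk_l2 summable_square_add summable_coord)
lemma coord_uminus [simp]: "coord (- f) n = - coord f n"
  by (simp add: uminus_l2_def coord_mk_l2 summable_coord)
lemma coord_diff [simp]: "coord (f - g) n = coord f n - coord g n"
  using summable_square_add[OF summable_coord[of f] summable_coord[of "- g"]]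
  by (simp add: minus_l2_def coord_mk_l2)
lemma coord_scaleR [simp]: "coord (scaleR r f) n = complex_of_real r * coord f n"
  by (simp add: scaleR_l2_def coord_mk_l2 summable_square_mult summable_coord)

instance
  by standard (auto intro!: l2_eqI simp: algebra_simps)
end

lemma summable_inner_coord: "summable (\<lambda>n. inner (coord f n) (coord g n))"
proof (rule summable_comparison_test'[where N = 0,
      OF summable_add[OF summable_coord[of f] summable_coord[of g]]])
  fix n
  have "\<bar>inner (coord f n) (coord g n)\<bar> \<le> cmod (coord f n) * cmod (coord g n)"
    by (rule Cauchy_Schwarz_ineq2)
  also have "\<dots> \<le> (cmod (coord f n))\<^sup>2 + (cmod (coord g n))\<^sup>2"
    using zero_le_power2[of "cmod (coord f n) - cmod (coord g n)"]
      zero_le_power2[of "cmod (coord f n)"] zero_le_power2[of "cmod (coord g n)"]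
    unfolding power2_diff by linarith
  finally show "norm (inner (coord f n) (coord g n)) \<le> (cmod (coord f n))\<^sup>2 + (cmod (coord g n))\<^sup>2"
    by simp
qed

instantiation l2 :: real_inner
begin
definition "inner f g = (\<Sum>n. inner (coord f n) (coord g n))"
definition "norm (f::l2) = sqrt (inner f f)"
definition "sgn (f::l2) = scaleR (inverse (norm f)) f"
definition "dist (f::l2) g = norm (f - g)"
definition "(uniformity :: (l2 \<times> l2) filter) = (INF e\<in>{0 <..}. principal {(x, y). dist x y < e})"
definition "open (S :: l2 set) = (\<forall>x\<in>S. \<forall>\<^sub>F (x', y) in uniformity. x' = x \<longrightarrow> y \<in> S)"

instance
proof
  fix x y z :: l2 and r :: real and U :: "l2 set"
  show "inner x y = inner y x"
    by (simp add: inner_l2_def inner_commute)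
  show "inner (x + y) z = inner x z + inner y z"
    by (simp add: inner_l2_def inner_add_left suminf_add summable_inner_coord)
  show "inner (scaleR r x) y = r * inner x y"
    by (simp add: inner_l2_def scaleR_conv_of_real[symmetric] suminf_mult summable_inner_coord)
  show "0 \<le> inner x x"
    unfolding inner_l2_def by (intro suminf_nonneg summable_inner_coord) simp
  show "inner x x = 0 \<longleftrightarrow> x = 0"
  proof
    assume "inner x x = 0"
    then have "\<And>n. inner (coord x n) (coord x n) = 0"
      unfolding inner_l2_def
      by (subst (asm) suminf_eq_zero_iff) (auto intro: summable_inner_coord)
    then show "x = 0"
      by (intro l2_eqI) simp
  qed (simp add: inner_l2_def)
qed (simp_all add: norm_l2_def sgn_l2_def dist_l2_def uniformity_l2_def open_l2_def)
end

lemma norm_square_l2: "(norm f)\<^sup>2 = (\<Sum>n. (cmod (coord f n))\<^sup>2)"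
  unfolding power2_norm_eq_inner[of f] by (simp add: inner_l2_def power2_norm_eq_inner[symmetric])

lemma sum_coord_le: "finite A \<Longrightarrow> (\<Sum>n\<in>A. (cmod (coord f n))\<^sup>2) \<le> (norm f)\<^sup>2"
  unfolding norm_square_l2 by (rule sum_le_suminf) (auto intro: summable_coord)

lemma cmod_coord_le: "cmod (coord f n) \<le> norm f"
  by (rule power2_le_imp_le) (use sum_coord_le[of "{n}" f] in simp_all)

text \<open>Completeness goes through coordinatewise limits, where only finite partial sums pass to
  the limit directly; a bound on all of them yields membership and the norm bound at once.\<close>

lemma l2_memI_and_bound:
  assumes "\<And>K. (\<Sum>n<K. (cmod (f n))\<^sup>2) \<le> e\<^sup>2" "0 \<le> e"
  shows "summable (\<lambda>n. (cmod (f n))\<^sup>2)" and "norm (mk_l2 f) \<le> e"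
proof -
  show s: "summable (\<lambda>n. (cmod (f n))\<^sup>2)"
    by (rule bounded_imp_summable[where B = "e\<^sup>2"]) (use assms(1) in \<open>simp_all only: lessThan_Suc_atMost[symmetric] zero_le_power2\<close>)
  have "(norm (mk_l2 f))\<^sup>2 \<le> e\<^sup>2"
    unfolding norm_square_l2 coord_mk_l2[OF s] by (rule suminf_le_const[OF s]) (rule assms(1))
  then show "norm (mk_l2 f) \<le> e"
    using assms(2) by (rule power2_le_imp_le)
qed

instance l2 :: complete_space
proof
  fix X :: "nat \<Rightarrow> l2"
  assume X: "Cauchy X"
  have "Cauchy (\<lambda>n. coord (X n) k)" for k
  proof (rule metric_CauchyI)
    fix e :: real assume "0 < e"
    then obtain M where M: "\<And>m n. m \<ge> M \<Longrightarrow> n \<ge> M \<Longrightarrow> norm (X m - X n) < e"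
      using X unfolding Cauchy_def dist_norm by meson
    then have "\<forall>m\<ge>M. \<forall>n\<ge>M. dist (coord (X m) k) (coord (X n) k) < e"
      unfolding dist_norm coord_diff[symmetric] by (blast intro: le_less_trans[OF cmod_coord_le])
    then show "\<exists>M. \<forall>m\<ge>M. \<forall>n\<ge>M. dist (coord (X m) k) (coord (X n) k) < e" ..
  qed
  then have "\<exists>y. (\<lambda>n. coord (X n) k) \<longlonglongrightarrow> y" for k
    using Cauchy_convergent convergent_def by blast
  then obtain y where y: "\<And>k. (\<lambda>n. coord (X n) k) \<longlonglongrightarrow> y k" by metis
  have bound: "\<exists>M. \<forall>n\<ge>M. \<forall>K. (\<Sum>k<K. (cmod (coord (X n) k - y k))\<^sup>2) \<le> e\<^sup>2" if "0 < e" for e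
  proof -
    from that obtain M where M: "\<And>m n. m \<ge> M \<Longrightarrow> n \<ge> M \<Longrightarrow> norm (X n - X m) < e"
      using X unfolding Cauchy_def dist_norm by meson
    have "(\<Sum>k<K. (cmod (coord (X n) k - y k))\<^sup>2) \<le> e\<^sup>2" if "n \<ge> M" for n K
    proof (rule LIMSEQ_le_const2)
      show "(\<lambda>m. \<Sum>k<K. (cmod (coord (X n) k - coord (X m) k))\<^sup>2)
          \<longlonglongrightarrow> (\<Sum>k<K. (cmod (coord (X n) k - y k))\<^sup>2)"
        by (intro tendsto_intros y)
      have "(\<Sum>k<K. (cmod (coord (X n) k - coord (X m) k))\<^sup>2) \<le> e\<^sup>2" if "m \<ge> M" for m
      proof -
        have "(\<Sum>k<K. (cmod (coord (X n) k - coord (X m) k))\<^sup>2) \<le> (norm (X n - X m))\<^sup>2"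
          using sum_coord_le[of "{..<K}" "X n - X m"] by simp
        also have "\<dots> \<le> e\<^sup>2"
          using M[OF that \<open>n \<ge> M\<close>] by (intro power_mono) auto
        finally show ?thesis .
      qed
      then show "\<exists>N. \<forall>m\<ge>N. (\<Sum>k<K. (cmod (coord (X n) k - coord (X m) k))\<^sup>2) \<le> e\<^sup>2" by blast
    qed
    then show ?thesis by blast
  qed
  \<comment> \<open>\<open>y\<close> is square-summable because both \<open>X M1\<close> and the
    difference of \<open>X M1\<close> and \<open>y\<close> are.\<close>
  obtain M1 where "\<And>K. (\<Sum>k<K. (cmod (coord (X M1) k - y k))\<^sup>2) \<le> 1\<^sup>2"
    using bound[of 1] by auto
  note d = l2_memI_and_bound(1)[OF this, simplified]
  have sy: "summable (\<lambda>k. (cmod (y k))\<^sup>2)"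
    using summable_square_add[OF summable_coord[of "X M1"] summable_square_mult[OF d, of "-1"]] by simp
  have "X \<longlonglongrightarrow> mk_l2 y"
  proof (rule metric_LIMSEQ_I)
    fix e :: real assume "0 < e"
    then obtain M where M: "\<And>n K. n \<ge> M \<Longrightarrow> (\<Sum>k<K. (cmod (coord (X n) k - y k))\<^sup>2) \<le> (e/2)\<^sup>2"
      using bound[of "e/2"] by auto
    have "dist (X n) (mk_l2 y) < e" if "n \<ge> M" for n
    proof -
      have eq: "X n - mk_l2 y = mk_l2 (\<lambda>k. coord (X n) k - y k)"
        using l2_memI_and_bound(1)[OF M[OF that]] \<open>0 < e\<close>
        by (intro l2_eqI) (simp add: coord_mk_l2 sy)
      have "norm (mk_l2 (\<lambda>k. coord (X n) k - y k)) \<le> e/2"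
        using l2_memI_and_bound(2)[OF M[OF that]] \<open>0 < e\<close> by simp
      then show ?thesis
        using \<open>0 < e\<close> unfolding dist_norm eq by linarith
    qed
    then show "\<exists>M. \<forall>n\<ge>M. dist (X n) (mk_l2 y) < e" by blast
  qed
  then show "convergent X"
    by (rule convergentI)
qed

instance l2 :: banach ..

text \<open>Complex scalars act on \<open>l2\<close>, which is only a real normed space as far as the type classes go.\<close>

definition scaleC :: "complex \<Rightarrow> l2 \<Rightarrow> l2" where
  "scaleC c f = mk_l2 (\<lambda>n. c * coord f n)"

lemma coord_scaleC [simp]: "coord (scaleC c f) n = c * coord f n"
  by (simp add: scaleC_def coord_mk_l2 summable_square_mult summable_coord)

lemma norm_scaleC: "norm (scaleC c f) = cmod c * norm f"
proof -
  have "(norm (scaleC c f))\<^sup>2 = (cmod c * norm f)\<^sup>2"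
    by (simp add: norm_square_l2 norm_mult power_mult_distrib suminf_mult summable_coord)
  then show ?thesis
    by (simp add: power2_eq_iff_nonneg)
qed

lemma bounded_linear_scaleC: "bounded_linear (scaleC c)"
  by (rule bounded_linear_intro[where K = "cmod c"])
    (auto intro!: l2_eqI simp: algebra_simps norm_scaleC)

definition unit_l2 :: "nat \<Rightarrow> l2" where
  "unit_l2 k = mk_l2 (\<lambda>n. of_bool (n = k))"

lemma coord_unit_l2 [simp]: "coord (unit_l2 k) n = of_bool (n = k)"
proof -
  have "summable (\<lambda>n. (cmod (of_bool (n = k)))\<^sup>2)"
    by (rule summable_finite[of "{k}"]) auto
  then show ?thesis by (simp add: unit_l2_def coord_mk_l2)
qed

lemma norm_unit_l2 [simp]: "norm (unit_l2 k) = 1"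
proof -
  have "(norm (unit_l2 k))\<^sup>2 = (\<Sum>n\<in>{k}. (cmod (coord (unit_l2 k) n))\<^sup>2)"
    unfolding norm_square_l2 by (rule suminf_finite) auto
  then show ?thesis
    by (simp add: power2_eq_1_iff) (use norm_ge_zero[of "unit_l2 k"] in linarith)
qed

text \<open>Complex linearity is built into the type: among merely real-linear operators,
  multiplication by the imaginary unit is not central and \<open>cs_commute\<close> would
  fail.\<close>

typedef op = "{F :: l2 \<Rightarrow>\<^sub>L l2. \<forall>c x. blinfun_apply F (scaleC c x) = scaleC c (blinfun_apply F x)}"
  morphisms blf mk_op
  by (rule exI[of _ 0]) (auto intro!: l2_eqI)

lemma blf_scaleC: "blinfun_apply (blf F) (scaleC c x) = scaleC c (blinfun_apply (blf F) x)"
  using blf[of F] by simp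

lemma scaleC_simps:
  "scaleC c 0 = 0" "scaleC c (x + y) = scaleC c x + scaleC c y" "scaleC c (- x) = - scaleC c x"
  "scaleC c (x - y) = scaleC c x - scaleC c y" "scaleC c (scaleR r x) = scaleR r (scaleC c x)"
  by (auto intro!: l2_eqI simp: algebra_simps)

instantiation op :: real_normed_algebra_1
begin
definition "0 = mk_op 0"
definition "1 = mk_op id_blinfun"
definition "F + G = mk_op (blf F + blf G)"
definition "- F = mk_op (- blf F)"
definition "F - G = mk_op (blf F - blf G)"
definition "scaleR r F = mk_op (scaleR r (blf F))"
definition "F * G = mk_op (blf F o\<^sub>L blf G)"
definition "norm F = norm (blf F)"
definition "sgn (F::op) = scaleR (inverse (norm F)) F"
definition "dist (F::op) G = norm (F - G)"
definition "(uniformity :: (op \<times> op) filter) = (INF e\<in>{0 <..}. principal {(x, y). dist x y < e})"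
definition "open (S :: op set) = (\<forall>x\<in>S. \<forall>\<^sub>F (x', y) in uniformity. x' = x \<longrightarrow> y \<in> S)"

lemma blf_simps:
  "blf 0 = 0" "blf 1 = id_blinfun" "blf (F + G) = blf F + blf G" "blf (- F) = - blf F"
  "blf (F - G) = blf F - blf G" "blf (scaleR r F) = scaleR r (blf F)" "blf (F * G) = blf F o\<^sub>L blf G"
  unfolding zero_op_def one_op_def plus_op_def uminus_op_def minus_op_def scaleR_op_def times_op_def
  by (rule mk_op_inverse,
      simp add: zero_blinfun.rep_eq plus_blinfun.rep_eq uminus_blinfun.rep_eq minus_blinfun.rep_eq
        scaleR_blinfun.rep_eq scaleC_simps blf_scaleC)+

lemma op_eq_blf: "F = G \<longleftrightarrow> blf F = blf G"
  by (simp add: blf_inject)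

instance
proof
  fix x y :: op
  show "norm (1::op) = 1"
  proof -
    have "norm (unit_l2 0) \<le> norm (id_blinfun :: l2 \<Rightarrow>\<^sub>L l2) * norm (unit_l2 0)"
      using norm_blinfun[of id_blinfun "unit_l2 0"] by simp
    then show ?thesis
      unfolding norm_op_def blf_simps using norm_blinfun_id_le[where 'a = l2] by simp
  qed
  then show "(0::op) \<noteq> 1"
    by (metis blf_simps(1) norm_op_def norm_zero zero_neq_one)
  fix z :: op and r s :: real and U :: "op set"
  show "norm (x * y) \<le> norm x * norm y"
    by (simp add: norm_op_def blf_simps norm_blinfun_compose)
  show "x * y * z = x * (y * z)"
    by (auto simp: op_eq_blf blf_simps intro!: blinfun_eqI)
  show "(x + y) * z = x * z + y * z" "x * (y + z) = x * y + x * z"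
    "scaleR r x * y = scaleR r (x * y)" "x * scaleR r y = scaleR r (x * y)"
    "1 * x = x" "x * 1 = x"
    by (auto simp: op_eq_blf blf_simps blinfun.bilinear_simps intro!: blinfun_eqI)
  show "x + y + z = x + (y + z)" "x + y = y + x" "0 + x = x" "- x + x = 0" "x - y = x + - y"
    "scaleR r (x + y) = scaleR r x + scaleR r y" "scaleR (r + s) x = scaleR r x + scaleR s x"
    "scaleR r (scaleR s x) = scaleR (r * s) x" "scaleR 1 x = x"
    by (simp_all add: op_eq_blf blf_simps algebra_simps)
  show "norm x = 0 \<longleftrightarrow> x = 0" "norm (scaleR r x) = \<bar>r\<bar> * norm x"
    by (simp_all add: norm_op_def op_eq_blf blf_simps)
  show "norm (x + y) \<le> norm x + norm y"
    by (simp add: norm_op_def blf_simps norm_triangle_ineq)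
qed (fact sgn_op_def dist_op_def uniformity_op_def open_op_def)+
end

instance op :: banach
proof
  fix X :: "nat \<Rightarrow> op"
  assume X: "Cauchy X"
  then have "Cauchy (\<lambda>n. blf (X n))"
    by (simp add: Cauchy_def dist_norm norm_op_def blf_simps)
  then obtain F where F: "(\<lambda>n. blf (X n)) \<longlonglongrightarrow> F"
    using Cauchy_convergent convergent_def by blast
  have "blinfun_apply F (scaleC c x) = scaleC c (blinfun_apply F x)" for c x
  proof (rule LIMSEQ_unique)
    show "(\<lambda>n. blinfun_apply (blf (X n)) (scaleC c x)) \<longlonglongrightarrow> blinfun_apply F (scaleC c x)"
      by (intro tendsto_intros F)
    show "(\<lambda>n. blinfun_apply (blf (X n)) (scaleC c x)) \<longlonglongrightarrow> scaleC c (blinfun_apply F x)"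
      unfolding blf_scaleC by (intro bounded_linear.tendsto[OF bounded_linear_scaleC] tendsto_intros F)
  qed
  then have [simp]: "blf (mk_op F) = F"
    by (simp add: mk_op_inverse)
  have "X \<longlonglongrightarrow> mk_op F"
    using F by (simp add: LIMSEQ_def dist_norm norm_op_def blf_simps)
  then show "convergent X"
    by (rule convergentI)
qed

section \<open>Exponentials of skew-adjoint operators\<close>

definition app :: "op \<Rightarrow> l2 \<Rightarrow> l2" where
  "app F = blinfun_apply (blf F)"

lemma app_simps [simp]:
  "app 0 x = 0" "app 1 x = x" "app (F + G) x = app F x + app G x" "app (- F) x = - app F x"
  "app (F - G) x = app F x - app G x" "app (scaleR r F) x = scaleR r (app F x)"
  "app (F * G) x = app F (app G x)"
  by (simp_all add: app_def blf_simps blinfun.bilinear_simps)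

lemma app_0_right [simp]: "app F 0 = 0"
  by (simp add: app_def)

lemma op_eqI: "(\<And>x. app F x = app G x) \<Longrightarrow> F = G"
  by (simp add: app_def op_eq_blf blinfun_eqI)

lemma norm_app: "norm (app F x) \<le> norm F * norm x"
  by (simp add: app_def norm_op_def norm_blinfun)

lemma norm_op_leI: "0 \<le> b \<Longrightarrow> (\<And>x. norm (app F x) \<le> b * norm x) \<Longrightarrow> norm F \<le> b"
  by (simp add: app_def norm_op_def norm_blinfun_bound)

lemma bounded_bilinear_app: "bounded_bilinear app"
  by (rule bounded_bilinear.intro)
    (auto simp: app_def blf_simps blinfun.bilinear_simps norm_op_def intro!: exI[of _ 1] norm_blinfun)

lemmas has_vector_derivative_app = bounded_bilinear.has_vector_derivative[OF bounded_bilinear_app]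

lemma app_scaleC: "app F (scaleC c x) = scaleC c (app F x)"
  by (simp add: app_def blf_scaleC)

definition mk_app :: "(l2 \<Rightarrow> l2) \<Rightarrow> op" where
  "mk_app f = mk_op (Blinfun f)"

lemma app_mk_app:
  assumes "bounded_linear f" "\<And>c x. f (scaleC c x) = scaleC c (f x)"
  shows "app (mk_app f) = f"
  using assms by (simp add: mk_app_def app_def mk_op_inverse bounded_linear_Blinfun_apply)

definition cs :: "complex \<Rightarrow> op" where
  "cs c = mk_app (scaleC c)"

lemma app_cs [simp]: "app (cs c) x = scaleC c x"
  unfolding cs_def by (subst app_mk_app) (auto intro!: bounded_linear_scaleC l2_eqI)

lemma cs_commute: "F * cs c = cs c * F"
  by (rule op_eqI) (simp add: app_scaleC)

lemma cs_left_commute: "F * (cs c * G) = cs c * (F * G)"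
  by (simp add: mult.assoc[symmetric] cs_commute)

lemma cs_add: "cs (c + d) = cs c + cs d"
  by (auto intro!: op_eqI l2_eqI simp: algebra_simps)

lemma cs_mult: "cs (c * d) = cs c * cs d"
  by (auto intro!: op_eqI l2_eqI simp: algebra_simps)

lemma cs_of_real: "cs (of_real r) = scaleR r 1"
  by (auto intro!: op_eqI l2_eqI)

lemma cs_1: "cs 1 = 1"
  using cs_of_real[of 1] by simp

lemma norm_cs_le: "norm (cs c) \<le> cmod c"
  by (rule norm_op_leI) (simp_all add: norm_scaleC)

lemma norm_cs_mult_le: "norm (cs c * F) \<le> cmod c * norm F"
  by (meson mult_right_mono norm_cs_le norm_ge_zero norm_mult_ineq order_trans)

lemma bounded_linear_cs: "bounded_linear cs"
proof (rule bounded_linear_intro[where K = 1])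
  show "cs (scaleR r x) = scaleR r (cs x)" for r x
    by (simp add: scaleR_conv_of_real cs_mult cs_of_real)
qed (simp_all add: cs_add norm_cs_le)

lemma scaleC_eq_0: "scaleC 0 x = 0"
  by (auto intro!: l2_eqI)

lemma cs_0: "cs 0 = 0"
  by (auto intro!: op_eqI simp: scaleC_eq_0)

text \<open>\<open>inner\<close> is the real part of the hermitian product. For complex-linear
  \<open>X\<close> this is still full skew-adjointness, since \<open>v\<close> may be multiplied by
  the imaginary unit.\<close>

definition skew :: "op \<Rightarrow> bool" where
  "skew X \<longleftrightarrow> (\<forall>u v. inner (app X u) v = - inner u (app X v))"

lemma skew_0: "skew 0"
  by (simp add: skew_def)
lemma skew_add: "skew X \<Longrightarrow> skew Y \<Longrightarrow> skew (X + Y)"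
  by (simp add: skew_def inner_simps)
lemma skew_uminus: "skew X \<Longrightarrow> skew (- X)"
  by (simp add: skew_def)
lemma skew_scaleR: "skew X \<Longrightarrow> skew (scaleR r X)"
  by (simp add: skew_def)
lemma skew_sum: "(\<And>i. i \<in> I \<Longrightarrow> skew (f i)) \<Longrightarrow> skew (sum f I)"
  by (induction I rule: infinite_finite_induct) (auto simp: skew_0 skew_add)

definition br :: "op \<Rightarrow> op \<Rightarrow> op" where
  "br X Y = X * Y - Y * X"

lemma skew_br: "skew X \<Longrightarrow> skew Y \<Longrightarrow> skew (br X Y)"
  by (simp add: skew_def br_def inner_simps)

lemma br_simps:
  "br (X + Y) Z = br X Z + br Y Z" "br Z (X + Y) = br Z X + br Z Y"
  "br (X - Y) Z = br X Z - br Y Z" "br Z (X - Y) = br Z X - br Z Y"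
  "br (- X) Z = - br X Z" "br Z (- X) = - br Z X"
  "br (scaleR r X) Z = scaleR r (br X Z)" "br Z (scaleR r X) = scaleR r (br Z X)"
  "br 0 Z = 0" "br Z 0 = 0" "br Z Z = 0"
  by (simp_all add: br_def algebra_simps)

lemma br_swap: "br X Y = - br Y X"
  by (simp add: br_def)

lemma br_sum: "br (sum f A) Z = (\<Sum>i\<in>A. br (f i) Z)" "br Z (sum f A) = (\<Sum>i\<in>A. br Z (f i))"
  by (simp_all add: br_def sum_distrib_left sum_distrib_right sum_subtractf)

section \<open>Norm bounds for products, commutators and exponentials\<close>

lemma norm_mult_le: "norm A \<le> a \<Longrightarrow> norm B \<le> b \<Longrightarrow> norm (A * B :: op) \<le> a * b"
  by (meson mult_mono' norm_ge_zero norm_mult_ineq order_trans)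

lemma norm_br_le: "norm A \<le> a \<Longrightarrow> norm B \<le> b \<Longrightarrow> norm (br A B) \<le> 2 * a * b"
  unfolding br_def
  by (rule order_trans[OF norm_triangle_ineq4])
    (use norm_mult_le[of A a B b] norm_mult_le[of B b A a] in \<open>simp add: algebra_simps\<close>)

lemma norm_conj_le:
  fixes A :: op
  assumes "norm A \<le> 1" "norm B \<le> 1"
  shows "norm (A * X * B) \<le> norm X"
  using norm_mult_le[OF norm_mult_le[OF assms(1) order_refl[of "norm X"]] assms(2)] by simp

lemma norm_contraction_mult:
  fixes A :: op
  assumes "norm A \<le> 1"
  shows "norm (A * X) \<le> norm X" "norm (X * A) \<le> norm X"
  using norm_mult_le[OF assms order_refl[of "norm X"]] norm_mult_le[OF order_refl[of "norm X"] assms]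
  by simp_all

text \<open>The mean value inequality drives the estimates below: two quantities are joined by a
  path, and the velocity of the path is bounded.\<close>

lemma norm_increment_le:
  fixes f :: "real \<Rightarrow> 'a::real_normed_vector"
  assumes "a \<le> b"
    and "\<And>t. t \<in> {a..b} \<Longrightarrow> (f has_vector_derivative f' t) (at t within {a..b})"
    and "\<And>t. t \<in> {a..b} \<Longrightarrow> norm (f' t) \<le> B"
  shows "norm (f b - f a) \<le> B * (b - a)"
proof -
  have "norm (f b - f a) \<le> B * norm (b - a)"
  proof (rule differentiable_bound[where S = "{a..b}" and f' = "\<lambda>t x. scaleR x (f' t)"])
    show "onorm (\<lambda>x. scaleR x (f' t)) \<le> B" if "t \<in> {a..b}" for t
    proof (rule onorm_le)
      fix x :: real
      show "norm (scaleR x (f' t)) \<le> B * norm x"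
        using mult_right_mono[OF assms(3)[OF that], of "\<bar>x\<bar>"] by (simp add: mult.commute)
    qed
  qed (use assms in \<open>auto simp: has_vector_derivative_def\<close>)
  then show ?thesis using assms(1) by simp
qed

text \<open>A general \<open>g\<close> covers reversed times such as 1 - s and the quadratic time
  s^2 / 2.\<close>

lemma exp_scaleR_derivative:
  fixes W :: op
  assumes "(g has_real_derivative g') (at s within S)"
  shows "((\<lambda>s. exp (scaleR (g s) W)) has_vector_derivative scaleR g' (W * exp (scaleR (g s) W))) (at s within S)"
proof -
  have "((\<lambda>t. exp (scaleR t W)) has_vector_derivative W * exp (scaleR (g s) W)) (at (g s) within g ` S)"
    using exp_scaleR_has_vector_derivative_right[of W "g s" "g ` S"] by (simp add: exp_times_scaleR_commute)
  from vector_diff_chain_within[OF _ this, of g'] assms show ?thesis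
    by (simp add: has_real_derivative_iff_has_vector_derivative o_def)
qed

lemma exp_scaleR_left_commute: "exp (scaleR t A) * (A * X) = A * (exp (scaleR t A) * (X :: op))"
  by (simp add: mult.assoc[symmetric] exp_times_scaleR_commute)

text \<open>The derivative of the inner product in \<open>t\<close> has two terms that cancel by
  skewness, so it keeps its value at \<open>t = 0\<close>.\<close>

lemma inner_exp_skew:
  assumes "skew X"
  shows "inner (app (exp (scaleR t X)) u) (app (exp (scaleR t X)) v) = inner u v"
proof -
  let ?f = "\<lambda>t w. app (exp (scaleR t X)) w"
  have d: "((\<lambda>t. ?f t w) has_vector_derivative app X (?f t w)) (at t within UNIV)" for t w
    using has_vector_derivative_app[OF exp_scaleR_derivative[OF DERIV_ident] has_vector_derivative_const]
    by simp
  have "((\<lambda>t. inner (?f t u) (?f t v)) has_vector_derivative 0) (at t within UNIV)" for t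
    using bounded_bilinear.has_vector_derivative[OF bounded_bilinear_inner d[of u t] d[of v t]] assms
    by (simp add: skew_def)
  then obtain c where "\<And>t. inner (?f t u) (?f t v) = c"
    using has_vector_derivative_zero_constant[of UNIV "\<lambda>t. inner (?f t u) (?f t v)"] by auto
  from this[of t] this[of 0] show ?thesis by simp
qed

lemma norm_exp_skew_app: "skew X \<Longrightarrow> norm (app (exp X) u) = norm u"
  using inner_exp_skew[of X 1 u u] by (simp add: norm_eq_sqrt_inner)

lemma norm_exp_skew: "skew X \<Longrightarrow> norm (exp X) \<le> 1"
  by (rule norm_op_leI) (simp_all add: norm_exp_skew_app)

lemma norm_exp_scaleR_skew: "skew X \<Longrightarrow> norm (exp (scaleR t X)) \<le> 1"
  by (simp add: norm_exp_skew skew_scaleR)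

lemma exp_mult_exp_minus: "exp (X::op) * exp (- X) = 1" "exp (- X) * exp (X::op) = 1"
  using exp_add_commuting[of X "- X"] exp_add_commuting[of "- X" X] by simp_all

text \<open>Duhamel's argument: along exp(sP) exp((1-s)Q) the velocity is P - Q between two
  contractions. Hence no factor grows with \<open>P\<close> or \<open>Q\<close>.\<close>

lemma norm_exp_diff_le:
  assumes "skew P" "skew Q"
  shows "norm (exp P - exp Q) \<le> norm (P - Q)"
proof -
  let ?f = "\<lambda>s. exp (scaleR s P) * exp (scaleR (1 - s) Q)"
  let ?f' = "\<lambda>s. exp (scaleR s P) * (P - Q) * exp (scaleR (1 - s) Q)"
  have "norm (?f 1 - ?f 0) \<le> norm (P - Q) * (1 - 0)"
  proof (rule norm_increment_le[where f = ?f and f' = ?f'])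
    fix s :: real
    have "(?f has_vector_derivative
        exp (scaleR s P) * scaleR (0 - 1) (Q * exp (scaleR (1 - s) Q)) + scaleR 1 (P * exp (scaleR s P)) * exp (scaleR (1 - s) Q))
        (at s within {0..1})"
      by (intro has_vector_derivative_mult exp_scaleR_derivative derivative_intros)
    then show "(?f has_vector_derivative ?f' s) (at s within {0..1})"
      using exp_times_scaleR_commute[of s P] by (simp add: algebra_simps)
    show "norm (?f' s) \<le> norm (P - Q)"
      by (intro norm_conj_le norm_exp_scaleR_skew assms)
  qed simp
  then show ?thesis by simp
qed

text \<open>The path exp(sA) Z exp((1-s)A) leads from Z exp(A) to exp(A) Z, and its velocity is
  \<open>br A Z\<close> between contractions.\<close>

lemma norm_br_exp_le:
  assumes "skew A"
  shows "norm (br (exp A) Z) \<le> norm (br A Z)"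
proof -
  let ?f = "\<lambda>s. exp (scaleR s A) * Z * exp (scaleR (1 - s) A)"
  let ?f' = "\<lambda>s. exp (scaleR s A) * br A Z * exp (scaleR (1 - s) A)"
  have "norm (?f 1 - ?f 0) \<le> norm (br A Z) * (1 - 0)"
  proof (rule norm_increment_le[where f = ?f and f' = ?f'])
    fix s :: real
    have "(?f has_vector_derivative
        (exp (scaleR s A) * Z) * scaleR (0 - 1) (A * exp (scaleR (1 - s) A))
         + (exp (scaleR s A) * 0 + scaleR 1 (A * exp (scaleR s A)) * Z) * exp (scaleR (1 - s) A)) (at s within {0..1})"
      by (intro has_vector_derivative_mult exp_scaleR_derivative derivative_intros)
    then show "(?f has_vector_derivative ?f' s) (at s within {0..1})"
      by (simp add: algebra_simps br_def exp_scaleR_left_commute)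
    show "norm (?f' s) \<le> norm (br A Z)"
      by (intro norm_conj_le norm_exp_scaleR_skew assms)
  qed simp
  then show ?thesis by (simp add: br_def)
qed

text \<open>The path of \<open>norm_br_exp_le\<close> minus its linear first-order term. The
  velocity becomes a commutator of exp(sA) with \<open>br A Z\<close>, to which
  \<open>norm_br_exp_le\<close> applies once more.\<close>

lemma norm_br_exp_diff_le:
  assumes "skew A"
  shows "norm (br (exp A) Z - br A Z * exp A) \<le> norm (br A (br A Z))"
proof -
  let ?f = "\<lambda>s. exp (scaleR s A) * Z * exp (scaleR (1 - s) A) - scaleR s (br A Z * exp A)"
  let ?g = "\<lambda>s. br (exp (scaleR s A)) (br A Z) * exp (scaleR (1 - s) A)"
  have e: "exp A = exp (scaleR s A) * exp (scaleR (1 - s) A)" for s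
    using exp_add_commuting[of "scaleR s A" "scaleR (1 - s) A"] by (simp add: scaleR_add_left[symmetric])
  have "norm (?f 1 - ?f 0) \<le> norm (br A (br A Z)) * (1 - 0)"
  proof (rule norm_increment_le[where f = ?f and f' = ?g])
    fix s :: real assume s: "s \<in> {0..1}"
    have "(?f has_vector_derivative
        ((exp (scaleR s A) * Z) * scaleR (0 - 1) (A * exp (scaleR (1 - s) A))
         + (exp (scaleR s A) * 0 + scaleR 1 (A * exp (scaleR s A)) * Z) * exp (scaleR (1 - s) A))
         - (scaleR s 0 + scaleR 1 (br A Z * exp A))) (at s within {0..1})"
      by (intro has_vector_derivative_mult has_vector_derivative_scaleR exp_scaleR_derivative derivative_intros)
    then show "(?f has_vector_derivative ?g s) (at s within {0..1})"
      unfolding e[of s] by (simp add: algebra_simps br_def exp_scaleR_left_commute)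
    have "norm (br (exp (scaleR s A)) (br A Z)) \<le> norm (br (scaleR s A) (br A Z))"
      by (rule norm_br_exp_le) (simp add: assms skew_scaleR)
    also have "\<dots> \<le> norm (br A (br A Z))"
      using s by (simp add: br_simps mult_left_le_one_le)
    finally show "norm (?g s) \<le> norm (br A (br A Z))"
      by (rule order_trans[OF norm_contraction_mult(2)[OF norm_exp_scaleR_skew[OF assms]]])
  qed simp
  then show ?thesis by (simp add: br_def algebra_simps)
qed

text \<open>A product of three exponentials joins exp(A + C) to exp(A) exp(C); in its velocity
  everything cancels except the cost of moving \<open>C\<close> past exp(sA).\<close>

lemma norm_exp_add_le:
  assumes "skew A" "skew C"
  shows "norm (exp A * exp C - exp (A + C)) \<le> norm (br A C)"
proof -
  let ?f = "\<lambda>s. exp (scaleR (1 - s) (A + C)) * exp (scaleR s A) * exp (scaleR s C)"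
  let ?f' = "\<lambda>s. exp (scaleR (1 - s) (A + C)) * br (exp (scaleR s A)) C * exp (scaleR s C)"
  have "norm (?f 1 - ?f 0) \<le> norm (br A C) * (1 - 0)"
  proof (rule norm_increment_le[where f = ?f and f' = ?f'])
    fix s :: real assume s: "s \<in> {0..1}"
    have "(?f has_vector_derivative
        (exp (scaleR (1 - s) (A + C)) * exp (scaleR s A)) * scaleR 1 (C * exp (scaleR s C))
        + (exp (scaleR (1 - s) (A + C)) * scaleR 1 (A * exp (scaleR s A))
        + scaleR (0 - 1) ((A + C) * exp (scaleR (1 - s) (A + C))) * exp (scaleR s A)) * exp (scaleR s C)) (at s within {0..1})"
      by (intro has_vector_derivative_mult exp_scaleR_derivative derivative_intros)
    then show "(?f has_vector_derivative ?f' s) (at s within {0..1})"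
      unfolding exp_times_scaleR_commute[of "1 - s" "A + C", symmetric] by (simp add: algebra_simps br_def)
    have "norm (?f' s) \<le> norm (br (exp (scaleR s A)) C)"
      by (intro norm_conj_le norm_exp_scaleR_skew assms skew_add)
    also have "\<dots> \<le> norm (br (scaleR s A) C)"
      by (rule norm_br_exp_le) (simp add: assms skew_scaleR)
    also have "\<dots> \<le> norm (br A C)"
      using s by (simp add: br_simps mult_left_le_one_le)
    finally show "norm (?f' s) \<le> norm (br A C)" .
  qed simp
  then show ?thesis by simp
qed

text \<open>The next estimate is the Zassenhaus formula to second order: interpolate between the two sides
  by replacing \<open>Y, Z\<close> with \<open>sY, sZ\<close> and composing with the remaining \<open>exp ((1 - s) (Y + Z))\<close>.\<close>

lemma norm_exp_add_second_order_le:
  assumes "skew Y" "skew Z"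
  defines "W \<equiv> br Y Z"
  shows "norm (exp Z * exp (scaleR (1/2) W) * exp Y - exp (Y + Z)) \<le> norm (br Y W) + 2 * norm (br Z W)"
proof -
  have W: "skew W" using assms by (simp add: skew_br)
  let ?a = "\<lambda>s. exp (scaleR (1 - s) (Y + Z))" and ?z = "\<lambda>s. exp (scaleR s Z)"
    and ?w = "\<lambda>s. exp (scaleR (s\<^sup>2 / 2) W)" and ?y = "\<lambda>s. exp (scaleR s Y)"
  let ?f = "\<lambda>s. ?a s * (?z s * ?w s) * ?y s"
  \<comment> \<open>Moving \<open>Y\<close> past \<open>?z s * ?w s\<close> produces - s W at first
    order. The exponent s^2 / 2 in \<open>?w\<close> is chosen so that its derivative contributes +
    s W; only the remainders collected in \<open>?d\<close> are left.\<close>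
  let ?d = "\<lambda>s. ?z s * br (?w s) Y + (br (?z s) Y - br (scaleR s Z) Y * ?z s) * ?w s
      + scaleR s (?z s * br (?w s) W + br (?z s) W * ?w s)"
  have "norm (?f 1 - ?f 0) \<le> (norm (br Y W) + 2 * norm (br Z W)) * (1 - 0)"
  proof (rule norm_increment_le[where f = ?f and f' = "\<lambda>s. ?a s * ?d s * ?y s"])
    fix s :: real assume s: "s \<in> {0..1}"
    have bz: "br (scaleR s Z) Y = - scaleR s W"
      by (simp add: W_def br_simps br_swap[of Z Y])
    have "(?f has_vector_derivative
        (?a s * (?z s * ?w s)) * scaleR 1 (Y * ?y s)
        + (?a s * (?z s * scaleR s (W * ?w s) + scaleR 1 (Z * ?z s) * ?w s)
        + scaleR (0 - 1) ((Y + Z) * ?a s) * (?z s * ?w s)) * ?y s) (at s within {0..1})"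
      by (intro has_vector_derivative_mult exp_scaleR_derivative) (auto intro!: derivative_eq_intros)
    then show "(?f has_vector_derivative ?a s * ?d s * ?y s) (at s within {0..1})"
      unfolding exp_times_scaleR_commute[of "1 - s" "Y + Z", symmetric] bz
      by (simp add: algebra_simps br_def scaleR_diff_right exp_times_scaleR_commute exp_scaleR_left_commute)
    have le: "norm (scaleR r X) \<le> norm X" if "0 \<le> r" "r \<le> 1" for r and X :: op
      using that by (simp add: mult_left_le_one_le)
    have s2: "0 \<le> s\<^sup>2 / 2" "s\<^sup>2 / 2 \<le> 1"
      using s power_le_one[of s 2] by auto
    have zc: "norm (?z s) \<le> 1" and wc: "norm (?w s) \<le> 1"
      by (intro norm_exp_scaleR_skew assms W)+
    have "norm (br (?w s) Y) \<le> norm (br (scaleR (s\<^sup>2 / 2) W) Y)"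
      by (rule norm_br_exp_le) (simp add: W skew_scaleR)
    also have "\<dots> \<le> norm (br Y W)"
      unfolding br_simps by (rule order_trans[OF le[OF s2]]) (simp add: br_swap[of W Y])
    finally have 1: "norm (?z s * br (?w s) Y) \<le> norm (br Y W)"
      by (rule order_trans[OF norm_contraction_mult(1)[OF zc]])
    have "norm (br (?z s) Y - br (scaleR s Z) Y * ?z s) \<le> norm (br (scaleR s Z) (br (scaleR s Z) Y))"
      by (rule norm_br_exp_diff_le) (simp add: assms skew_scaleR)
    also have "\<dots> = norm (scaleR (s\<^sup>2) (br Z W))"
      unfolding bz by (simp add: br_simps power2_eq_square)
    also have "\<dots> \<le> norm (br Z W)"
      by (rule le) (use s power_le_one[of s 2] in auto)
    finally have 2: "norm ((br (?z s) Y - br (scaleR s Z) Y * ?z s) * ?w s) \<le> norm (br Z W)"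
      by (rule order_trans[OF norm_contraction_mult(2)[OF wc]])
    have "norm (br (?w s) W) \<le> norm (br (scaleR (s\<^sup>2 / 2) W) W)"
      by (rule norm_br_exp_le) (simp add: W skew_scaleR)
    then have w0: "br (?w s) W = 0"
      by (simp add: br_simps)
    have "norm (br (?z s) W) \<le> norm (br (scaleR s Z) W)"
      by (rule norm_br_exp_le) (simp add: assms skew_scaleR)
    also have "\<dots> \<le> norm (br Z W)"
      unfolding br_simps by (rule le) (use s in auto)
    finally have "norm (br (?z s) W * ?w s) \<le> norm (br Z W)"
      by (rule order_trans[OF norm_contraction_mult(2)[OF wc]])
    then have 3: "norm (scaleR s (?z s * br (?w s) W + br (?z s) W * ?w s)) \<le> norm (br Z W)"
      unfolding w0 by (intro order_trans[OF le]) (use s in auto)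
    have "norm (?a s * ?d s * ?y s) \<le> norm (?d s)"
      by (intro norm_conj_le norm_exp_scaleR_skew assms skew_add)
    also have "\<dots> \<le> norm (br Y W) + norm (br Z W) + norm (br Z W)"
      by (intro norm_triangle_mono 1 2 3)
    finally show "norm (?a s * ?d s * ?y s) \<le> norm (br Y W) + 2 * norm (br Z W)"
      by simp
  qed simp
  then show ?thesis by (simp add: mult.assoc)
qed

section \<open>The Magnus step for piecewise constant generators\<close>

text \<open>Put \<open>Y = S + D\<close>, \<open>Z = X + C\<close> with \<open>C\<close> half of
  \<open>br X S\<close>. The commutator of \<open>Y\<close> and \<open>Z\<close> is - 2 C up to
  terms of size w h^4, so the second-order Zassenhaus product is close to exp(Z) exp(-C) exp(Y), and
  exp(Z) exp(-C) is close to exp(X).\<close>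

lemma magnus_step_error:
  fixes S D X :: op and q w h :: real
  assumes sk: "skew S" "skew D" "skew X"
    and q: "1 \<le> q" and h: "0 \<le> h" "h \<le> 1" and w: "0 \<le> w" "w \<le> 1"
    and X: "norm X \<le> w * q" and S: "norm S \<le> h * q" and D: "norm D \<le> h ^ 3 * q"
    and XS: "norm (br X S) \<le> w * h\<^sup>2 * q"
    and SXS: "norm (br S (br X S)) \<le> w * h ^ 4 * q" and XXS: "norm (br X (br X S)) \<le> w * h ^ 4 * q"
    and DX: "norm (br D X) \<le> w * h ^ 4 * q"
  shows "norm (exp X * exp (S + D) - exp (S + D + X + scaleR (1/2) (br X S))) \<le> 45 * q ^ 3 * (w * h ^ 4)"
proof -
  define \<delta> where "\<delta> = w * h ^ 4"
  define C where "C = scaleR (1/2) (br X S)"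
  define V where "V = br S C + br D X + br D C"
  define Y where "Y = S + D"
  define Z where "Z = X + C"
  define W where "W = br Y Z"
  have \<delta>: "0 \<le> \<delta>" using h w by (simp add: \<delta>_def)
  have skC: "skew C" and skY: "skew Y" and skZ: "skew Z"
    using sk by (simp_all add: C_def Y_def Z_def skew_add skew_scaleR skew_br)
  then have skW: "skew W" by (simp add: W_def skew_br)
  have qq: "q \<le> q\<^sup>2" "q\<^sup>2 \<le> q ^ 3" "q \<le> q ^ 3"
    using power_increasing[of 1 2 q] power_increasing[of 2 3 q] power_increasing[of 1 3 q] q by auto
  have dq: "\<delta> * q \<le> \<delta> * q\<^sup>2" "\<delta> * q\<^sup>2 \<le> \<delta> * q ^ 3" "\<delta> * q \<le> \<delta> * q ^ 3"
    using qq \<delta> by (simp_all add: mult_left_mono)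
  have d0: "0 \<le> \<delta> * q ^ 3"
    using \<delta> q by simp
  have C: "norm C \<le> w * h\<^sup>2 * q / 2"
    using XS by (simp add: C_def)
  have le1: "a * q \<le> q" if "a \<le> 1" for a
    using that q mult_right_mono[of a 1 q] by simp
  have wh: "w * h\<^sup>2 \<le> 1"
    using w h by (simp add: mult_le_one power_le_one)
  have nY: "norm Y \<le> 2 * q"
    unfolding Y_def using norm_triangle_ineq[of S D] S D le1[OF h(2)] le1[of "h ^ 3"] h
    by (simp add: power_le_one)
  have nZ: "norm Z \<le> 2 * q"
    unfolding Z_def using norm_triangle_ineq[of X C] X C le1[OF w(2)] le1[OF wh] q by linarith
  have SC: "norm (br S C) \<le> \<delta> * q / 2" and XC: "norm (br X C) \<le> \<delta> * q / 2"
    using SXS XXS by (simp_all add: C_def br_simps \<delta>_def)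
  have "norm (br D C) \<le> 2 * (h ^ 3 * q) * (w * h\<^sup>2 * q / 2)"
    by (rule norm_br_le[OF D C])
  also have "\<dots> = h * (\<delta> * q\<^sup>2)"
    by (simp add: \<delta>_def power_numeral_reduce algebra_simps)
  also have "\<dots> \<le> \<delta> * q\<^sup>2"
    using h \<delta> by (intro mult_left_le_one_le) auto
  finally have DC: "norm (br D C) \<le> \<delta> * q\<^sup>2" .
  have "norm V \<le> \<delta> * q / 2 + \<delta> * q + \<delta> * q\<^sup>2"
    unfolding V_def by (intro norm_triangle_mono SC DC DX[folded \<delta>_def])
  then have V: "norm V \<le> 3 * (\<delta> * q\<^sup>2)"
    using dq mult_nonneg_nonneg[OF \<delta> zero_le_power2[of q]] by simp
  \<comment> \<open>\<open>br S X\<close> is exactly - 2 C; \<open>V\<close> collects the three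
    commutators of order w h^4.\<close>
  have W: "W = V - scaleR 2 C"
    by (simp add: W_def V_def Y_def Z_def br_simps C_def br_swap[of S X] scaleR_add_right)
  have vq: "2 * (2 * q) * (3 * (\<delta> * q\<^sup>2)) = 12 * (\<delta> * q ^ 3)"
    by (simp add: power_numeral_reduce)
  have eYW: "br Y W = br Y V - scaleR 2 (br S C) - scaleR 2 (br D C)"
    unfolding W by (simp add: Y_def br_simps algebra_simps)
  have "norm (br Y W) \<le> norm (br Y V) + norm (scaleR 2 (br S C)) + norm (scaleR 2 (br D C))"
    unfolding eYW using norm_triangle_ineq4[of "br Y V - scaleR 2 (br S C)" "scaleR 2 (br D C)"]
      norm_triangle_ineq4[of "br Y V" "scaleR 2 (br S C)"] by linarith
  also have "\<dots> \<le> 15 * (\<delta> * q ^ 3)"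
    using norm_br_le[OF nY V, unfolded vq] SC DC dq by simp
  finally have YW: "norm (br Y W) \<le> 15 * (\<delta> * q ^ 3)" .
  have "br Z W = br Z V - scaleR 2 (br X C)"
    unfolding W by (simp add: Z_def br_simps algebra_simps)
  then have "norm (br Z W) \<le> norm (br Z V) + norm (scaleR 2 (br X C))"
    using norm_triangle_ineq4[of "br Z V" "scaleR 2 (br X C)"] by simp
  also have "\<dots> \<le> 13 * (\<delta> * q ^ 3)"
    using norm_br_le[OF nZ V, unfolded vq] XC dq by simp
  finally have ZW: "norm (br Z W) \<le> 13 * (\<delta> * q ^ 3)" .
  have cZ: "norm (exp Z) \<le> 1" and cY: "norm (exp Y) \<le> 1"
    using skZ skY by (simp_all add: norm_exp_skew)
  have e1: "norm (exp Z * exp (scaleR (1/2) W) * exp Y - exp (Y + Z)) \<le> 41 * (\<delta> * q ^ 3)"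
    using norm_exp_add_second_order_le[OF skY skZ, folded W_def] YW ZW by linarith
  have "norm (exp Z * exp (- C) * exp Y - exp Z * exp (scaleR (1/2) W) * exp Y)
      = norm (exp Z * (exp (- C) - exp (scaleR (1/2) W)) * exp Y)"
    by (simp add: algebra_simps)
  also have "\<dots> \<le> norm (exp (- C) - exp (scaleR (1/2) W))"
    by (rule norm_conj_le[OF cZ cY])
  also have "\<dots> \<le> norm (- C - scaleR (1/2) W)"
    by (intro norm_exp_diff_le skew_uminus skew_scaleR skC skW)
  also have "\<dots> = norm V / 2"
    unfolding W by (simp add: scaleR_diff_right)
  finally have e2: "norm (exp Z * exp (- C) * exp Y - exp Z * exp (scaleR (1/2) W) * exp Y) \<le> 2 * (\<delta> * q ^ 3)"
    using V dq d0 by linarith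
  have "norm (exp X * exp Y - exp Z * exp (- C) * exp Y) = norm ((exp Z * exp (- C) - exp X) * exp Y)"
    by (simp add: algebra_simps norm_minus_commute)
  also have "\<dots> \<le> norm (exp Z * exp (- C) - exp (Z + - C))"
    by (rule order_trans[OF norm_contraction_mult(2)[OF cY]]) (simp add: Z_def)
  also have "\<dots> \<le> norm (br Z (- C))"
    by (intro norm_exp_add_le skZ skew_uminus skC)
  also have "\<dots> \<le> \<delta> * q / 2"
    using XC by (simp add: Z_def br_simps)
  finally have e3: "norm (exp X * exp Y - exp Z * exp (- C) * exp Y) \<le> \<delta> * q ^ 3"
    using dq d0 by linarith
  have "exp X * exp Y - exp (Y + Z) = (exp X * exp Y - exp Z * exp (- C) * exp Y)
      + (exp Z * exp (- C) * exp Y - exp Z * exp (scaleR (1/2) W) * exp Y)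
      + (exp Z * exp (scaleR (1/2) W) * exp Y - exp (Y + Z))"
    by simp
  also have "norm \<dots> \<le> \<delta> * q ^ 3 + 2 * (\<delta> * q ^ 3) + 41 * (\<delta> * q ^ 3)"
    by (intro norm_triangle_mono e1 e2 e3)
  \<comment> \<open>1 + 2 + 41 = 44 is rounded up, where 41 = 15 + 2 * 13 comes from
    \<open>YW\<close> and \<open>ZW\<close>.\<close>
  also have "\<dots> \<le> 45 * (\<delta> * q ^ 3)"
    using d0 by simp
  finally have "norm (exp X * exp Y - exp (Y + Z)) \<le> 45 * (\<delta> * q ^ 3)" .
  then show ?thesis
    by (simp add: Y_def Z_def C_def \<delta>_def add.assoc mult_ac)
qed

section \<open>Ordered products of exponentials and their Magnus exponent\<close>

primrec ordered_exp :: "(nat \<Rightarrow> op) \<Rightarrow> nat \<Rightarrow> op" where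
  "ordered_exp X 0 = 1"
| "ordered_exp X (Suc n) = exp (X n) * ordered_exp X n"

text \<open>The nested time integral reduces to pairs \<open>l < k\<close>, because within one piece
  a constant generator commutes with itself.\<close>

definition magnus2 :: "(nat \<Rightarrow> op) \<Rightarrow> nat \<Rightarrow> op" where
  "magnus2 X n = (\<Sum>k<n. X k) + scaleR (1/2) (\<Sum>k<n. \<Sum>l<k. br (X k) (X l))"

lemma magnus2_Suc: "magnus2 X (Suc n) = magnus2 X n + X n + scaleR (1/2) (br (X n) (\<Sum>k<n. X k))"
  by (simp add: magnus2_def br_sum scaleR_add_right)

lemma skew_magnus2: "(\<And>k. k < n \<Longrightarrow> skew (X k)) \<Longrightarrow> skew (magnus2 X n)"
  unfolding magnus2_def by (intro skew_add skew_scaleR skew_sum skew_br) auto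

lemma sum_const_bound:
  fixes f :: "nat \<Rightarrow> 'a::real_normed_vector"
  assumes "\<And>k. k < n \<Longrightarrow> norm (f k) \<le> B" "n \<le> M" "0 \<le> B"
  shows "norm (\<Sum>k<n. f k) \<le> real M * B"
proof -
  have "norm (\<Sum>k<n. f k) \<le> (\<Sum>k<n. B)"
    by (rule order_trans[OF norm_sum sum_mono]) (use assms in auto)
  also have "\<dots> \<le> real M * B"
    using assms by (simp add: mult_right_mono)
  finally show ?thesis .
qed

text \<open>By \<open>magnus2_Suc\<close> the exponent is updated as in
  \<open>magnus_step_error\<close>, with \<open>S\<close> the linear and \<open>D\<close> the
  quadratic part of \<open>magnus2\<close>. Each of the \<open>M\<close> factors costs w h^4, and M
  w = h turns the total into h^5.\<close>

lemma ordered_exp_magnus2: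
  fixes X :: "nat \<Rightarrow> op" and q w h :: real and M :: nat
  assumes sk: "\<And>k. k < M \<Longrightarrow> skew (X k)"
    and q: "1 \<le> q" and h: "0 \<le> h" "h \<le> 1" and M: "0 < M" and w: "w = h / real M"
    and X1: "\<And>k. k < M \<Longrightarrow> norm (X k) \<le> w * q"
    and X2: "\<And>k l. k < M \<Longrightarrow> l < M \<Longrightarrow> norm (br (X k) (X l)) \<le> w\<^sup>2 * h * q"
    and X3: "\<And>j k l. j < M \<Longrightarrow> k < M \<Longrightarrow> l < M \<Longrightarrow> norm (br (X j) (br (X k) (X l))) \<le> w ^ 3 * h\<^sup>2 * q"
  shows "norm (ordered_exp X M - exp (magnus2 X M)) \<le> 45 * q ^ 3 * h ^ 5"
proof -
  have w0: "0 \<le> w" "w \<le> h"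
    using M h mult_left_mono[of 1 "real M" h] by (simp_all add: w divide_le_eq)
  have Mw: "real M * w = h"
    using M by (simp add: w)
  have nn: "0 \<le> w * q" "0 \<le> w\<^sup>2 * h * q" "0 \<le> w ^ 3 * h\<^sup>2 * q"
    using w0 q h by simp_all
  have "norm (ordered_exp X n - exp (magnus2 X n)) \<le> real n * (45 * q ^ 3 * (w * h ^ 4))" if "n \<le> M" for n
    using that
  proof (induction n)
    case 0
    then show ?case by (simp add: magnus2_def)
  next
    case (Suc n)
    then have n: "n < M" "n \<le> M" by auto
    define S where "S = (\<Sum>k<n. X k)"
    define D where "D = scaleR (1/2) (\<Sum>k<n. \<Sum>l<k. br (X k) (X l))"
    have mg: "magnus2 X n = S + D"
      by (simp add: magnus2_def S_def D_def)
    have XS: "br (X n) S = (\<Sum>k<n. br (X n) (X k))"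
      by (simp add: S_def br_sum)
    have skS: "skew S" and skD: "skew D"
      unfolding S_def D_def using n by (auto intro!: skew_sum skew_scaleR skew_br sk)
    have step: "norm (exp (X n) * exp (S + D) - exp (S + D + X n + scaleR (1/2) (br (X n) S))) \<le> 45 * q ^ 3 * (w * h ^ 4)"
    proof (rule magnus_step_error)
      have "norm S \<le> real M * (w * q)"
        unfolding S_def by (rule sum_const_bound) (use n X1 nn in auto)
      then show "norm S \<le> h * q" by (simp add: Mw mult.assoc[symmetric])
      have "norm (\<Sum>k<n. \<Sum>l<k. br (X k) (X l)) \<le> real M * (real M * (w\<^sup>2 * h * q))"
        by (intro sum_const_bound) (use n X2 nn in auto)
      also have "\<dots> = (real M * w)\<^sup>2 * h * q"
        by (simp add: power2_eq_square)
      also have "\<dots> = h ^ 3 * q"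
        unfolding Mw by (simp add: power_numeral_reduce)
      finally show "norm D \<le> h ^ 3 * q"
        unfolding D_def using norm_ge_zero[of "\<Sum>k<n. \<Sum>l<k. br (X k) (X l)"] by (simp del: norm_ge_zero)
      have "norm (br (X n) S) \<le> real M * (w\<^sup>2 * h * q)"
        unfolding XS by (rule sum_const_bound) (use n X2 nn in auto)
      also have "\<dots> = w * (real M * w) * h * q"
        by (simp add: power2_eq_square)
      also have "\<dots> = w * h\<^sup>2 * q"
        unfolding Mw by (simp add: power2_eq_square)
      finally show "norm (br (X n) S) \<le> w * h\<^sup>2 * q" .
      have e: "real M * (real M * (w ^ 3 * h\<^sup>2 * q)) = w * h ^ 4 * q"
      proof -
        have "real M * (real M * (w ^ 3 * h\<^sup>2 * q)) = w * (real M * w)\<^sup>2 * h\<^sup>2 * q"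
          by (simp add: power_numeral_reduce)
        also have "\<dots> = w * h ^ 4 * q"
          unfolding Mw by (simp add: power_numeral_reduce)
        finally show ?thesis .
      qed
      \<comment> \<open>The two sums over at most \<open>M\<close> nodes turn two of the three
        factors \<open>w\<close> into \<open>h\<close>.\<close>
      have "norm (\<Sum>j<n. \<Sum>k<n. br (X j) (br (X n) (X k))) \<le> real M * (real M * (w ^ 3 * h\<^sup>2 * q))"
        by (intro sum_const_bound) (use n X3 nn in auto)
      moreover have "br S (br (X n) S) = (\<Sum>j<n. \<Sum>k<n. br (X j) (br (X n) (X k)))"
        unfolding XS S_def br_sum by (rule sum.swap)
      ultimately show "norm (br S (br (X n) S)) \<le> w * h ^ 4 * q"
        by (simp add: e)
      have "norm (br (X n) (br (X n) S)) \<le> real M * (w ^ 3 * h\<^sup>2 * q)"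
        unfolding XS br_sum by (intro sum_const_bound) (use n X3 nn in auto)
      also have "\<dots> \<le> real M * (real M * (w ^ 3 * h\<^sup>2 * q))"
        using nn M mult_right_mono[of 1 "real M" "real M * (w ^ 3 * h\<^sup>2 * q)"] by simp
      finally show "norm (br (X n) (br (X n) S)) \<le> w * h ^ 4 * q"
        by (simp add: e)
      have "norm (br (\<Sum>k<n. \<Sum>l<k. br (X k) (X l)) (X n)) \<le> real M * (real M * (w ^ 3 * h\<^sup>2 * q))"
        unfolding br_sum
      proof (intro sum_const_bound)
        show "norm (br (br (X k) (X l)) (X n)) \<le> w ^ 3 * h\<^sup>2 * q" if "k < n" "l < k" for k l
          using X3[of n k l] that n unfolding br_swap[of "br (X k) (X l)"] by simp
      qed (use n nn in auto)
      then have "norm (br (\<Sum>k<n. \<Sum>l<k. br (X k) (X l)) (X n)) \<le> w * h ^ 4 * q"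
        by (simp add: e)
      then show "norm (br D (X n)) \<le> w * h ^ 4 * q"
        unfolding D_def br_simps using norm_ge_zero[of "br (\<Sum>k<n. \<Sum>l<k. br (X k) (X l)) (X n)"]
        by (simp del: norm_ge_zero)
    qed (use skS skD sk n q h w0 X1 in auto)
    have "norm (ordered_exp X (Suc n) - exp (magnus2 X (Suc n)))
        \<le> norm (exp (X n) * (ordered_exp X n - exp (magnus2 X n)))
         + norm (exp (X n) * exp (magnus2 X n) - exp (magnus2 X (Suc n)))"
      using norm_triangle_ineq[of "exp (X n) * (ordered_exp X n - exp (magnus2 X n))"
          "exp (X n) * exp (magnus2 X n) - exp (magnus2 X (Suc n))"]
      by (simp add: algebra_simps)
    also have "\<dots> \<le> norm (ordered_exp X n - exp (magnus2 X n)) + 45 * q ^ 3 * (w * h ^ 4)"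
      using step[folded mg]
      by (intro add_mono norm_contraction_mult norm_exp_skew sk n) (simp add: magnus2_Suc S_def)
    also have "\<dots> \<le> real (Suc n) * (45 * q ^ 3 * (w * h ^ 4))"
      using Suc.IH n by (simp add: algebra_simps)
    finally show ?case .
  qed
  from this[of M] have "norm (ordered_exp X M - exp (magnus2 X M)) \<le> 45 * q ^ 3 * ((real M * w) * h ^ 4)"
    by (simp add: mult_ac)
  then show ?thesis
    unfolding Mw by (simp add: power_numeral_reduce)
qed

text \<open>The nodes being left endpoints, the quadrature replaces \<open>Y\<close> by a piecewise constant generator.\<close>

lemma ode_step_error:
  assumes w: "0 \<le> w" and sub: "{s..s + w} \<subseteq> {0..T}"
    and U: "\<And>t. t \<in> {0..T} \<Longrightarrow> (U has_vector_derivative Y t * U t) (at t within {0..T})"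
    and sk: "skew (Y s)"
    and lip: "\<And>t. t \<in> {s..s + w} \<Longrightarrow> norm (Y t - Y s) \<le> \<Lambda> * (t - s)"
    and nU: "\<And>t. t \<in> {0..T} \<Longrightarrow> norm (U t) \<le> 1" and L: "0 \<le> \<Lambda>"
  shows "norm (U (s + w) - exp (scaleR w (Y s)) * U s) \<le> \<Lambda> * w\<^sup>2"
proof -
  let ?X = "Y s"
  let ?f = "\<lambda>t. exp (scaleR (s + w - t) ?X) * U t"
  let ?f' = "\<lambda>t. exp (scaleR (s + w - t) ?X) * ((Y t - ?X) * U t)"
  have "norm (?f (s + w) - ?f s) \<le> (\<Lambda> * w) * (s + w - s)"
  proof (rule norm_increment_le[where f = ?f and f' = ?f'])
    fix t assume t: "t \<in> {s..s + w}"
    then have t0: "t \<in> {0..T}" using sub by auto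
    have "(?f has_vector_derivative
        exp (scaleR (s + w - t) ?X) * (Y t * U t) + scaleR (0 - 1) (?X * exp (scaleR (s + w - t) ?X)) * U t)
        (at t within {s..s + w})"
      by (intro has_vector_derivative_mult exp_scaleR_derivative
          has_vector_derivative_within_subset[OF U[OF t0] sub] derivative_eq_intros) auto
    then show "(?f has_vector_derivative ?f' t) (at t within {s..s + w})"
      unfolding exp_times_scaleR_commute[symmetric] by (simp add: algebra_simps)
    have "norm (?f' t) \<le> norm ((Y t - ?X) * U t)"
      by (intro norm_contraction_mult norm_exp_scaleR_skew sk)
    also have "\<dots> \<le> norm (Y t - ?X)"
      by (intro norm_contraction_mult nU t0)
    also have "\<dots> \<le> \<Lambda> * (t - s)"
      by (rule lip[OF t])
    also have "\<dots> \<le> \<Lambda> * w"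
      using t L by (intro mult_left_mono) auto
    finally show "norm (?f' t) \<le> \<Lambda> * w" .
  qed (use w in auto)
  then show ?thesis by (simp add: power2_eq_square mult_ac)
qed

text \<open>Skewness makes the norm of \<open>app (U t) v\<close> constant in time. The initial
  value is a contraction rather than 1 because an embedded identity matrix is
  \<open>proj m\<close>.\<close>

lemma norm_ode_solution:
  assumes U: "\<And>t. t \<in> {0..T} \<Longrightarrow> (U has_vector_derivative Y t * U t) (at t within {0..T})"
    and sk: "\<And>t. t \<in> {0..T} \<Longrightarrow> skew (Y t)"
    and U0: "norm (U 0) \<le> 1" and t: "t \<in> {0..T}"
  shows "norm (U t) \<le> 1"
proof (rule norm_op_leI)
  fix v
  let ?g = "\<lambda>t. inner (app (U t) v) (app (U t) v)"
  have d: "((\<lambda>t. app (U t) v) has_vector_derivative app (Y t) (app (U t) v)) (at t within {0..T})"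
    if "t \<in> {0..T}" for t
    using has_vector_derivative_app[OF U[OF that] has_vector_derivative_const[of v]] by simp
  have "(?g has_vector_derivative 0) (at t within {0..T})" if "t \<in> {0..T}" for t
    using bounded_bilinear.has_vector_derivative[OF bounded_bilinear_inner d[OF that] d[OF that]] sk[OF that]
    by (simp add: skew_def)
  then obtain c where "\<And>t. t \<in> {0..T} \<Longrightarrow> ?g t = c"
    using has_vector_derivative_zero_constant[of "{0..T}" ?g] by auto
  from this[OF t] this[of 0] t have "norm (app (U t) v) = norm (app (U 0) v)"
    by (auto simp: norm_eq_sqrt_inner)
  also have "\<dots> \<le> 1 * norm v"
    using norm_app[of "U 0" v] U0 mult_right_mono[OF U0 norm_ge_zero[of v]] by linarith
  finally show "norm (app (U t) v) \<le> 1 * norm v" .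
qed simp

text \<open>Telescoping: each new factor is a contraction, so earlier errors are carried along
  unamplified and the local errors \<Lambda> w^2 simply add.\<close>

lemma ode_ordered_exp:
  assumes w: "0 \<le> w" and L: "0 \<le> \<Lambda>" and s: "0 \<le> s" "s + real n * w \<le> T"
    and U: "\<And>t. t \<in> {0..T} \<Longrightarrow> (U has_vector_derivative Y t * U t) (at t within {0..T})"
    and sk: "\<And>t. t \<in> {0..T} \<Longrightarrow> skew (Y t)"
    and lip: "\<And>t t'. t \<in> {0..T} \<Longrightarrow> t' \<in> {0..T} \<Longrightarrow> t' \<le> t \<Longrightarrow> norm (Y t - Y t') \<le> \<Lambda> * (t - t')"
    and U0: "norm (U 0) \<le> 1"
  shows "norm (U (s + real n * w) - ordered_exp (\<lambda>k. scaleR w (Y (s + real k * w))) n * U s) \<le> real n * (\<Lambda> * w\<^sup>2)"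
  using s(2)
proof (induction n)
  case (Suc n)
  let ?P = "ordered_exp (\<lambda>k. scaleR w (Y (s + real k * w)))" and ?r = "s + real n * w"
  have r: "0 \<le> ?r" "?r + w \<le> T" "?r \<le> T"
    using Suc.prems s w by (auto simp: algebra_simps)
  let ?E = "exp (scaleR w (Y ?r))"
  have "norm (U (?r + w) - ?E * U ?r) \<le> \<Lambda> * w\<^sup>2"
    by (rule ode_step_error[where T = T])
      (use r w L U sk lip norm_ode_solution[OF U sk U0] in auto)
  moreover have "norm (?E * (U ?r - ?P n * U s)) \<le> real n * (\<Lambda> * w\<^sup>2)"
    by (rule order_trans[OF norm_contraction_mult(1)[OF norm_exp_scaleR_skew[OF sk]]])
      (use r Suc.IH in auto)
  moreover have "U (?r + w) - ?P (Suc n) * U s = (U (?r + w) - ?E * U ?r) + ?E * (U ?r - ?P n * U s)"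
    by (simp add: algebra_simps)
  ultimately have "norm (U (?r + w) - ?P (Suc n) * U s) \<le> \<Lambda> * w\<^sup>2 + real n * (\<Lambda> * w\<^sup>2)"
    by (metis norm_triangle_mono)
  moreover have "s + real (Suc n) * w = ?r + w"
    by (simp add: algebra_simps)
  ultimately show ?case
    by (simp add: algebra_simps)
qed simp

primrec magnus_product :: "(real \<Rightarrow> op) \<Rightarrow> nat \<Rightarrow> real \<Rightarrow> nat \<Rightarrow> op" where
  "magnus_product Y M h 0 = 1"
| "magnus_product Y M h (Suc j) =
     exp (magnus2 (\<lambda>k. scaleR (h / real M) (Y (real j * h + real k * (h / real M)))) M) * magnus_product Y M h j"

text \<open>A step adds the quadrature error M \<Lambda> w^2 = \<Lambda> h^2 / M and the Magnus
  error 45 q^3 h^5, while the error inherited so far meets a contraction. Summing \<open>L\<close>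
  steps with L h = T trades one power of \<open>h\<close> for \<open>T\<close>.\<close>

lemma magnus_global_error:
  fixes Y U :: "real \<Rightarrow> op" and q h \<Lambda> T :: real and M L :: nat
  assumes h: "0 \<le> h" "h \<le> 1" and M: "0 < M" and q: "1 \<le> q" and LL: "0 \<le> \<Lambda>" and T: "T = real L * h"
    and U: "\<And>t. t \<in> {0..T} \<Longrightarrow> (U has_vector_derivative Y t * U t) (at t within {0..T})"
    and sk: "\<And>t. t \<in> {0..T} \<Longrightarrow> skew (Y t)"
    and lip: "\<And>t t'. t \<in> {0..T} \<Longrightarrow> t' \<in> {0..T} \<Longrightarrow> t' \<le> t \<Longrightarrow> norm (Y t - Y t') \<le> \<Lambda> * (t - t')"
    and U0: "norm (U 0) \<le> 1"
    and Y1: "\<And>t. t \<in> {0..T} \<Longrightarrow> norm (Y t) \<le> q"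
    and Y2: "\<And>t s. t \<in> {0..T} \<Longrightarrow> s \<in> {0..T} \<Longrightarrow> \<bar>t - s\<bar> \<le> h \<Longrightarrow> norm (br (Y t) (Y s)) \<le> h * q"
    and Y3: "\<And>r t s. r \<in> {0..T} \<Longrightarrow> t \<in> {0..T} \<Longrightarrow> s \<in> {0..T} \<Longrightarrow>
        \<bar>r - t\<bar> \<le> h \<Longrightarrow> \<bar>r - s\<bar> \<le> h \<Longrightarrow> \<bar>t - s\<bar> \<le> h \<Longrightarrow> norm (br (Y r) (br (Y t) (Y s))) \<le> h\<^sup>2 * q"
  shows "norm (U T - magnus_product Y M h L * U 0) \<le> T * (\<Lambda> * h / real M + 45 * q ^ 3 * h ^ 4)"
proof -
  define w where "w = h / real M"
  have w: "0 \<le> w" "real M * w = h" using h M by (simp_all add: w_def)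
  let ?B = "h * (\<Lambda> * h / real M + 45 * q ^ 3 * h ^ 4)"
  have "norm (U (real j * h) - magnus_product Y M h j * U 0) \<le> real j * ?B" if "j \<le> L" for j
    using that
  proof (induction j)
    case (Suc j)
    let ?s = "real j * h"
    let ?X = "\<lambda>k. scaleR w (Y (?s + real k * w))"
    have le: "real (Suc j) * h \<le> T"
      unfolding T using Suc.prems h by (intro mult_right_mono) auto
    have s: "0 \<le> ?s" "?s + h \<le> T" "?s \<le> T"
      using h le by (auto simp: algebra_simps)
    have kw: "0 \<le> real k * w \<and> real k * w \<le> h" if "k < M" for k
      using that w(1) mult_right_mono[of "real k" "real M" w] by (simp add: w(2))
    have node: "?s + real k * w \<in> {0..T}" if "k < M" for k
      using kw[OF that] s by auto
    have close: "\<bar>?s + real k * w - (?s + real l * w)\<bar> \<le> h" if "k < M" "l < M" for k l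
      using kw[OF that(1)] kw[OF that(2)] by auto
    have skX: "\<And>k. k < M \<Longrightarrow> skew (?X k)"
      by (intro skew_scaleR sk node)
    have loc: "norm (ordered_exp ?X M - exp (magnus2 ?X M)) \<le> 45 * q ^ 3 * h ^ 5"
    proof (rule ordered_exp_magnus2[where w = w])
      fix j k l assume *: "j < M" "k < M" "l < M"
      show "norm (?X k) \<le> w * q"
        using Y1[OF node[OF *(2)]] w by (simp add: mult_left_mono)
      have "norm (br (?X k) (?X l)) = w\<^sup>2 * norm (br (Y (?s + real k * w)) (Y (?s + real l * w)))"
        by (simp add: br_simps power2_eq_square abs_mult w)
      also have "\<dots> \<le> w\<^sup>2 * (h * q)"
        by (intro mult_left_mono Y2 node close *) simp
      finally show "norm (br (?X k) (?X l)) \<le> w\<^sup>2 * h * q" by (simp add: mult_ac)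
      have "norm (br (?X j) (br (?X k) (?X l)))
          = w ^ 3 * norm (br (Y (?s + real j * w)) (br (Y (?s + real k * w)) (Y (?s + real l * w))))"
        using w by (simp add: br_simps power_numeral_reduce abs_mult)
      also have "\<dots> \<le> w ^ 3 * (h\<^sup>2 * q)"
        by (intro mult_left_mono Y3 node close *) (use w in simp)
      finally show "norm (br (?X j) (br (?X k) (?X l))) \<le> w ^ 3 * h\<^sup>2 * q" by (simp add: mult_ac)
    qed (use skX q h M w_def in auto)
    have nUs: "norm (U ?s) \<le> 1"
      by (rule norm_ode_solution[OF U sk U0]) (use s in auto)
    have "norm (U (?s + real M * w) - ordered_exp ?X M * U ?s) \<le> real M * (\<Lambda> * w\<^sup>2)"
      by (rule ode_ordered_exp[where T = T]) (use w LL s U sk lip U0 in auto)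
    then have a: "norm (U (?s + h) - ordered_exp ?X M * U ?s) \<le> \<Lambda> * h\<^sup>2 / real M"
      using M by (simp add: w w_def power2_eq_square)
    have b: "norm ((ordered_exp ?X M - exp (magnus2 ?X M)) * U ?s) \<le> 45 * q ^ 3 * h ^ 5"
      by (rule order_trans[OF norm_contraction_mult(2)[OF nUs] loc])
    have c: "norm (exp (magnus2 ?X M) * (U ?s - magnus_product Y M h j * U 0)) \<le> real j * ?B"
      by (rule order_trans[OF norm_contraction_mult(1)[OF norm_exp_skew[OF skew_magnus2]]])
        (use skX Suc in auto)
    have "U (real (Suc j) * h) - magnus_product Y M h (Suc j) * U 0
        = (U (?s + h) - ordered_exp ?X M * U ?s) + (ordered_exp ?X M - exp (magnus2 ?X M)) * U ?s
          + exp (magnus2 ?X M) * (U ?s - magnus_product Y M h j * U 0)"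
      by (simp add: algebra_simps w_def)
    also have "norm \<dots> \<le> \<Lambda> * h\<^sup>2 / real M + 45 * q ^ 3 * h ^ 5 + real j * ?B"
      by (intro norm_triangle_mono a b c)
    also have "\<dots> = real (Suc j) * ?B"
      by (simp add: algebra_simps add_divide_distrib power_numeral_reduce)
    finally show ?case .
  qed simp
  from this[of L] show ?thesis
    by (simp add: T mult.assoc)
qed

section \<open>Matrices as operators\<close>

lemma norm_finite_support:
  assumes "\<And>n. n \<ge> m \<Longrightarrow> coord f n = 0"
  shows "norm f = L2_set (\<lambda>n. cmod (coord f n)) {..<m}"
proof -
  have "(norm f)\<^sup>2 = (\<Sum>n<m. (cmod (coord f n))\<^sup>2)"
    unfolding norm_square_l2 by (rule suminf_finite) (use assms in auto)
  then show ?thesis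
    unfolding L2_set_def by (metis norm_ge_zero real_sqrt_unique)
qed

lemma inner_finite_support:
  assumes "\<And>n. n \<ge> m \<Longrightarrow> coord f n = 0 \<or> coord g n = 0"
  shows "inner f g = (\<Sum>n<m. inner (coord f n) (coord g n))"
  unfolding inner_l2_def
proof (rule suminf_finite)
  show "inner (coord f n) (coord g n) = 0" if "n \<notin> {..<m}" for n
    using assms[of n] that by auto
qed simp

lemma inner_mult_left_complex: "inner (a * b) c = inner b (cnj a * c)" for a b c :: complex
  by (simp add: inner_complex_def algebra_simps)

definition ker_fun :: "nat \<Rightarrow> (nat \<Rightarrow> nat \<Rightarrow> complex) \<Rightarrow> l2 \<Rightarrow> l2" where
  "ker_fun m K f = mk_l2 (\<lambda>p. if p < m then \<Sum>q<m. K p q * coord f q else 0)"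

text \<open>Extension by zero beyond the first \<open>m\<close> coordinates lets matrices of all
  sizes share one type.\<close>

definition ker :: "nat \<Rightarrow> (nat \<Rightarrow> nat \<Rightarrow> complex) \<Rightarrow> op" where
  "ker m K = mk_app (ker_fun m K)"

lemma coord_ker_fun: "coord (ker_fun m K f) p = (if p < m then \<Sum>q<m. K p q * coord f q else 0)"
proof -
  have "summable (\<lambda>p. (cmod (if p < m then \<Sum>q<m. K p q * coord f q else 0))\<^sup>2)"
    by (rule summable_finite[of "{..<m}"]) auto
  then show ?thesis by (simp add: ker_fun_def coord_mk_l2)
qed

lemma bounded_linear_ker_fun: "bounded_linear (ker_fun m K)"
proof (rule bounded_linear_intro[where K = "\<Sum>p<m. \<Sum>q<m. cmod (K p q)"])
  fix f
  have "norm (ker_fun m K f) = L2_set (\<lambda>n. cmod (coord (ker_fun m K f) n)) {..<m}"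
    by (rule norm_finite_support) (simp add: coord_ker_fun)
  also have "\<dots> \<le> (\<Sum>p<m. cmod (\<Sum>q<m. K p q * coord f q))"
    by (rule order_trans[OF L2_set_le_sum]) (simp_all add: coord_ker_fun)
  also have "\<dots> \<le> (\<Sum>p<m. \<Sum>q<m. cmod (K p q) * norm f)"
    by (intro sum_mono order_trans[OF norm_sum]) (simp add: norm_mult mult_left_mono cmod_coord_le)
  finally show "norm (ker_fun m K f) \<le> norm f * (\<Sum>p<m. \<Sum>q<m. cmod (K p q))"
    by (simp add: sum_distrib_left mult.commute)
qed (auto intro!: l2_eqI simp: coord_ker_fun algebra_simps sum.distrib sum_distrib_left)

lemma coord_ker [simp]: "coord (app (ker m K) f) p = (if p < m then \<Sum>q<m. K p q * coord f q else 0)"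
  unfolding ker_def
  by (subst app_mk_app[OF bounded_linear_ker_fun])
    (auto intro!: l2_eqI simp: coord_ker_fun sum_distrib_left mult_ac)

lemma ker_cong: "(\<And>p q. p < m \<Longrightarrow> q < m \<Longrightarrow> K p q = K' p q) \<Longrightarrow> ker m K = ker m K'"
  by (auto intro!: op_eqI l2_eqI)

lemma ker_add: "ker m K + ker m K' = ker m (\<lambda>p q. K p q + K' p q)"
  by (auto intro!: op_eqI l2_eqI simp: algebra_simps sum.distrib)

lemma ker_diff: "ker m K - ker m K' = ker m (\<lambda>p q. K p q - K' p q)"
  by (auto intro!: op_eqI l2_eqI simp: algebra_simps sum_subtractf)

lemma cs_ker: "cs c * ker m K = ker m (\<lambda>p q. c * K p q)"
  by (auto intro!: op_eqI l2_eqI simp: sum_distrib_left mult_ac)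

lemma ker_0: "ker m (\<lambda>p q. 0) = 0"
  by (auto intro!: op_eqI l2_eqI)

lemma ker_sum: "(\<Sum>i\<in>I. ker m (K i)) = ker m (\<lambda>p q. \<Sum>i\<in>I. K i p q)"
  by (induction I rule: infinite_finite_induct) (simp_all add: ker_0 ker_add)

lemma ker_mult: "ker m K * ker m K' = ker m (\<lambda>p q. \<Sum>r<m. K p r * K' r q)"
proof (rule op_eqI, rule l2_eqI)
  fix f p
  have "(\<Sum>r<m. K p r * (\<Sum>q<m. K' r q * coord f q)) = (\<Sum>q<m. (\<Sum>r<m. K p r * K' r q) * coord f q)"
    by (simp add: sum_distrib_left sum_distrib_right mult.assoc) (rule sum.swap)
  then show "coord (app (ker m K * ker m K') f) p = coord (app (ker m (\<lambda>p q. \<Sum>r<m. K p r * K' r q)) f) p"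
    by simp
qed

lemma inner_ker_adjoint:
  "inner (app (ker m K) u) v = inner u (app (ker m (\<lambda>p q. cnj (K q p))) v)"
proof -
  have "inner (app (ker m K) u) v = (\<Sum>p<m. \<Sum>q<m. inner (K p q * coord u q) (coord v p))"
    by (subst inner_finite_support[of m]) (auto simp: inner_sum_left)
  also have "\<dots> = (\<Sum>q<m. \<Sum>p<m. inner (coord u q) (cnj (K p q) * coord v p))"
    by (subst sum.swap) (simp add: inner_mult_left_complex)
  also have "\<dots> = inner u (app (ker m (\<lambda>p q. cnj (K q p))) v)"
    by (subst inner_finite_support[of m]) (auto simp: inner_sum_right)
  finally show ?thesis .
qed

lemma skew_ker:
  assumes "\<And>p q. p < m \<Longrightarrow> q < m \<Longrightarrow> K p q = - cnj (K q p)"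
  shows "skew (ker m K)"
proof -
  have "ker m (\<lambda>p q. cnj (K q p)) = 0 - ker m K"
    unfolding ker_0[of m, symmetric] ker_diff
  proof (rule ker_cong)
    show "cnj (K q p) = 0 - K p q" if "p < m" "q < m" for p q
      unfolding assms[OF that] by simp
  qed
  then show ?thesis
    unfolding skew_def inner_ker_adjoint by simp
qed

text \<open>The unit of the corner formed by all \<open>ker m K\<close>; it takes the place of 1
  whenever an identity matrix is embedded.\<close>

definition proj :: "nat \<Rightarrow> op" where
  "proj m = ker m (\<lambda>p q. of_bool (p = q))"

lemma coord_proj [simp]: "coord (app (proj m) f) p = (if p < m then coord f p else 0)"
  by (auto simp: proj_def of_bool_def if_distrib[of "\<lambda>x. x * _"] cong: if_cong)

lemma proj_ker: "proj m * ker m K = ker m K" "ker m K * proj m = ker m K"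
  by (auto intro!: op_eqI l2_eqI)

lemma proj_proj: "proj m * proj m = proj m"
  using proj_ker(1)[of m "\<lambda>p q. of_bool (p = q)"] by (simp add: proj_def)

lemma norm_proj: "norm (proj m) \<le> 1"
proof (rule norm_op_leI)
  fix f
  have "(norm (app (proj m) f))\<^sup>2 = (\<Sum>n<m. (cmod (coord f n))\<^sup>2)"
    by (subst norm_finite_support[of m]) (auto simp: L2_set_def sum_nonneg)
  also have "\<dots> \<le> (norm f)\<^sup>2"
    by (rule sum_coord_le) simp
  finally have "norm (app (proj m) f) \<le> norm f"
    by (rule power2_le_imp_le) simp
  then show "norm (app (proj m) f) \<le> 1 * norm f"
    by simp
qed simp

lemma app_sum_left: "app (sum F I) x = (\<Sum>i\<in>I. app (F i) x)"
  by (induction I rule: infinite_finite_induct) auto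

lemma app_add_right: "app F (x + y) = app F x + app F y"
  by (simp add: app_def blinfun.bilinear_simps)

lemma app_sum_right: "app F (sum x I) = (\<Sum>i\<in>I. app F (x i))"
  by (induction I rule: infinite_finite_induct) (auto simp: app_add_right)

lemma coord_sum: "coord (sum x I) n = (\<Sum>i\<in>I. coord (x i) n)"
  by (induction I rule: infinite_finite_induct) auto

definition entry :: "nat \<Rightarrow> nat \<Rightarrow> op \<Rightarrow> complex" where
  "entry p q F = coord (app F (unit_l2 q)) p"

lemma bounded_linear_entry: "bounded_linear (entry p q)"
proof (rule bounded_linear_intro[where K = 1])
  fix F
  show "norm (entry p q F) \<le> norm F * 1"
    using cmod_coord_le[of "app F (unit_l2 q)" p] norm_app[of F "unit_l2 q"] by (simp add: entry_def)
qed (auto simp: entry_def scaleR_conv_of_real[where 'a = complex])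

lemma entry_ker: "p < m \<Longrightarrow> q < m \<Longrightarrow> entry p q (ker m K) = K p q"
  by (simp add: entry_def of_bool_def if_distrib[of "\<lambda>x. _ * x"] cong: if_cong)

lemma proj_mult_proj: "proj m * F * proj m = ker m (\<lambda>p q. entry p q F)"
proof (rule op_eqI, rule l2_eqI)
  fix f p
  have "app (proj m) f = (\<Sum>q<m. scaleC (coord f q) (unit_l2 q))"
    by (rule l2_eqI) (auto simp: coord_sum of_bool_def if_distrib[of "\<lambda>x. _ * x"] cong: if_cong)
  then have "app F (app (proj m) f) = (\<Sum>q<m. scaleC (coord f q) (app F (unit_l2 q)))"
    by (simp add: app_sum_right app_scaleC)
  then show "coord (app (proj m * F * proj m) f) p = coord (app (ker m (\<lambda>p q. entry p q F)) f) p"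
    by (simp add: coord_sum entry_def mult.commute)
qed

text \<open>The relation passes to powers and hence through the series. It serves to commute
  \<open>proj m\<close> with exponentials and to pull plane waves through them at the price of a
  changed exponent.\<close>

lemma exp_intertwine:
  fixes X Y E :: op
  assumes "X * E = E * Y"
  shows "exp X * E = E * exp Y"
proof -
  have pw: "X ^ n * E = E * Y ^ n" for n
  proof (induction n)
    case (Suc n)
    have "X ^ Suc n * E = X * (E * Y ^ n)"
      by (simp add: mult.assoc Suc.IH)
    also have "\<dots> = E * Y ^ Suc n"
      by (simp add: mult.assoc[symmetric] assms)
    finally show ?case .
  qed simp
  have "exp X * E = (\<Sum>n. (X ^ n /\<^sub>R fact n) * E)"
    unfolding exp_def by (rule suminf_mult2[OF summable_exp_generic])
  also have "\<dots> = (\<Sum>n. E * (Y ^ n /\<^sub>R fact n))"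
    by (simp add: pw)
  also have "\<dots> = E * exp Y"
    unfolding exp_def by (rule suminf_mult[OF summable_exp_generic])
  finally show ?thesis .
qed

section \<open>Embedding complex matrices into the operator algebra\<close>

definition emb :: "nat \<Rightarrow> complex mat \<Rightarrow> op" where
  "emb m X = ker m (\<lambda>p q. X $$ (p, q))"

lemma emb_add: "Y \<in> carrier_mat m m \<Longrightarrow> emb m (X + Y) = emb m X + emb m Y"
  unfolding emb_def ker_add by (rule ker_cong) auto

lemma emb_diff: "Y \<in> carrier_mat m m \<Longrightarrow> emb m (X - Y) = emb m X - emb m Y"
  unfolding emb_def ker_diff by (rule ker_cong) auto

lemma emb_smult: "X \<in> carrier_mat m m \<Longrightarrow> emb m (c \<cdot>\<^sub>m X) = cs c * emb m X"
  unfolding emb_def cs_ker by (rule ker_cong) auto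

lemma emb_mult: "X \<in> carrier_mat m m \<Longrightarrow> Y \<in> carrier_mat m m \<Longrightarrow> emb m (X * Y) = emb m X * emb m Y"
  unfolding emb_def ker_mult by (rule ker_cong) (auto simp: scalar_prod_def lessThan_atLeast0)

lemma emb_one: "emb m (1\<^sub>m m) = proj m"
  unfolding emb_def proj_def by (rule ker_cong) auto

lemma emb_msum: "emb m (msum m F I) = (\<Sum>k\<in>I. emb m (F k))"
  unfolding emb_def ker_sum by (rule ker_cong) (auto simp: msum_def)

lemma proj_emb: "proj m * emb m X = emb m X" "emb m X * proj m = emb m X"
  by (simp_all add: emb_def proj_ker)

lemma msum_carrier: "msum m F I \<in> carrier_mat m m"
  by (simp add: msum_def)

lemma emb_commutator:
  "X \<in> carrier_mat m m \<Longrightarrow> Y \<in> carrier_mat m m \<Longrightarrow> emb m (commutator X Y) = br (emb m X) (emb m Y)"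
  by (auto simp: commutator_def br_def emb_mult emb_diff mult_carrier_mat[where n = m])

lemma mat_exp_carrier: "X \<in> carrier_mat m m \<Longrightarrow> mat_exp X \<in> carrier_mat m m"
  by (auto simp: mat_exp_def)

lemma exp_emb_proj: "exp (emb m X) * proj m = proj m * exp (emb m X)"
  by (rule exp_intertwine) (simp add: proj_emb)

text \<open>Outside the corner \<open>exp (emb m X)\<close> is the identity, whereas an embedded
  matrix vanishes there; hence the factor \<open>proj m\<close>. Inside, the entries agree because
  \<open>entry p q\<close> is bounded linear and passes through the series.\<close>

lemma emb_mat_exp:
  assumes X: "X \<in> carrier_mat m m"
  shows "emb m (mat_exp X) = exp (emb m X) * proj m"
proof -
  have pow: "emb m (X ^\<^sub>m k) = emb m X ^ k * proj m" for k
  proof (induction k)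
    case 0
    show ?case using X by (simp add: emb_one)
  next
    case (Suc k)
    have "emb m (X ^\<^sub>m Suc k) = emb m (X ^\<^sub>m k) * emb m X"
      using X by (simp add: emb_mult pow_carrier_mat)
    also have "\<dots> = emb m X ^ k * (emb m X * proj m)"
      by (simp add: Suc.IH mult.assoc proj_emb)
    finally show ?case
      by (simp add: mult.assoc[symmetric] power_commutes)
  qed
  have e: "mat_exp X $$ (p, q) = entry p q (exp (emb m X) * proj m)" if "p < m" "q < m" for p q
  proof -
    have "entry p q (exp (emb m X) * proj m) = (\<Sum>k. entry p q ((emb m X ^ k /\<^sub>R fact k) * proj m))"
      unfolding exp_def
      by (subst bounded_linear.suminf[OF bounded_linear_compose[OF bounded_linear_entry bounded_linear_mult_left], symmetric])
        (auto intro: summable_exp_generic)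
    also have "\<dots> = (\<Sum>k. (X ^\<^sub>m k) $$ (p, q) / fact k)"
    proof (rule suminf_cong)
      fix k
      have "entry p q ((emb m X ^ k /\<^sub>R fact k) * proj m) = entry p q (emb m (X ^\<^sub>m k)) /\<^sub>R fact k"
        by (simp add: pow linear_scale[OF bounded_linear.linear[OF bounded_linear_entry]])
      also have "\<dots> = (X ^\<^sub>m k) $$ (p, q) / fact k"
        unfolding emb_def by (simp add: entry_ker that scaleR_conv_of_real divide_inverse mult.commute)
      finally show "entry p q ((emb m X ^ k /\<^sub>R fact k) * proj m) = (X ^\<^sub>m k) $$ (p, q) / fact k" .
    qed
    finally show ?thesis
      using X that by (simp add: mat_exp_def)
  qed
  have "exp (emb m X) * proj m = proj m * (exp (emb m X) * proj m) * proj m"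
    by (simp add: exp_emb_proj mult.assoc proj_proj) (simp add: mult.assoc[symmetric] proj_proj)
  also have "\<dots> = ker m (\<lambda>p q. entry p q (exp (emb m X) * proj m))"
    by (rule proj_mult_proj)
  also have "\<dots> = emb m (mat_exp X)"
    unfolding emb_def by (rule ker_cong) (simp add: e emb_def)
  finally show ?thesis by simp
qed

lemma euclid_norm_mult_le:
  assumes X: "X \<in> carrier_mat m m" and v: "v \<in> carrier_vec m" "euclid_norm v = 1"
  shows "euclid_norm (X *\<^sub>v v) \<le> norm (emb m X)"
proof -
  define f where "f = (\<Sum>q<m. scaleC (vec_index v q) (unit_l2 q))"
  have f: "coord f p = (if p < m then vec_index v p else 0)" for p
    by (auto simp: f_def coord_sum of_bool_def if_distrib[of "\<lambda>x. _ * x"] cong: if_cong)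
  have "norm f = euclid_norm v"
    using v(1) by (subst norm_finite_support[of m]) (auto simp: f euclid_norm_def intro!: L2_set_cong)
  moreover have "norm (app (emb m X) f) = euclid_norm (X *\<^sub>v v)"
    using X v(1) unfolding emb_def
    by (subst norm_finite_support[of m])
      (auto simp: f euclid_norm_def scalar_prod_def lessThan_atLeast0 intro!: L2_set_cong arg_cong[of _ _ cmod] sum.cong)
  ultimately show ?thesis
    using norm_app[of "emb m X" f] v(2) by simp
qed

text \<open>\<open>0 < m\<close> provides a unit vector, so the supremum runs over a nonempty set;
  the operator norm bounds it above.\<close>

lemma spectral_norm_bounds:
  assumes X: "X \<in> carrier_mat m m" and m: "0 < m"
  shows "spectral_norm X \<le> norm (emb m X)" and "0 \<le> spectral_norm X"
proof -
  let ?S = "{v \<in> carrier_vec (dim_col X). euclid_norm v = 1}"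
  have u: "unit_vec m 0 \<in> ?S"
    using X m by (auto simp: euclid_norm_def unit_vec_def L2_set_def if_distrib[of "\<lambda>x. (cmod x)\<^sup>2"] cong: if_cong)
  have le: "euclid_norm (X *\<^sub>v v) \<le> norm (emb m X)" if "v \<in> ?S" for v
    using euclid_norm_mult_le[OF X] that X by auto
  show "spectral_norm X \<le> norm (emb m X)"
    unfolding spectral_norm_def by (rule cSUP_least) (use u le in auto)
  have "0 \<le> euclid_norm (X *\<^sub>v unit_vec m 0)"
    by (simp add: euclid_norm_def L2_set_nonneg)
  also have "\<dots> \<le> spectral_norm X"
    unfolding spectral_norm_def by (rule cSUP_upper[OF u]) (use le in \<open>auto intro!: bdd_aboveI2\<close>)
  finally show "0 \<le> spectral_norm X" .
qed

lemma H_int_carrier: "A \<in> carrier_mat m m \<Longrightarrow> B \<in> carrier_mat m m \<Longrightarrow> H_int A B t \<in> carrier_mat m m"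
  unfolding H_int_def by (intro mult_carrier_mat[where n = m] mat_exp_carrier smult_carrier_mat)

text \<open>Each matrix exponential brings a factor \<open>proj m\<close>; once the second has been
  moved through its exponential, \<open>emb m B\<close> absorbs both.\<close>

lemma emb_H_int:
  assumes A: "A \<in> carrier_mat m m" and B: "B \<in> carrier_mat m m"
  defines "G \<equiv> cs \<i> * emb m A"
  shows "emb m (H_int A B t) = exp (scaleR t G) * emb m B * exp (scaleR (- t) G)"
proof -
  have m: "cs (- \<i>) = - cs \<i>"
    using linear_neg[OF bounded_linear.linear[OF bounded_linear_cs], of \<i>] .
  have e1: "emb m ((\<i> * complex_of_real t) \<cdot>\<^sub>m A) = scaleR t G"
    unfolding emb_smult[OF A] cs_mult cs_of_real G_def by simp
  have e2: "emb m ((- \<i> * complex_of_real t) \<cdot>\<^sub>m A) = - scaleR t G"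
    unfolding emb_smult[OF A] cs_mult cs_of_real G_def m by simp
  note c = mat_exp_carrier[OF smult_carrier_mat[OF A]]
  have "emb m (H_int A B t) = exp (scaleR t G) * (proj m * emb m B) * (exp (- scaleR t G) * proj m)"
    unfolding H_int_def emb_mult[OF mult_carrier_mat[OF c B] c] emb_mult[OF c B]
      emb_mat_exp[OF smult_carrier_mat[OF A]] e1 e2 by (simp add: mult.assoc)
  also have "exp (- scaleR t G) * proj m = proj m * exp (- scaleR t G)"
    by (rule exp_intertwine)
      (simp add: G_def mult.assoc cs_left_commute proj_emb)
  finally show ?thesis
    by (simp add: mult.assoc proj_emb) (simp add: mult.assoc[symmetric] proj_emb)
qed

lemma emb_magnus_Omega2:
  fixes M :: nat and h :: real
  assumes H: "\<And>s. H s \<in> carrier_mat m m"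
  defines "w \<equiv> h / real M"
  shows "emb m (magnus_Omega2 m M H t h) = magnus2 (\<lambda>k. scaleR w (cs (- \<i>) * emb m (H (t + real k * w)))) M"
proof -
  let ?E = "\<lambda>k. emb m (H (t + real k * w))"
  have c: "cs (- (\<i> * complex_of_real w)) = scaleR w (cs (- \<i>))"
    using cs_mult[of "- \<i>" "complex_of_real w"] by (simp add: cs_of_real)
  have "emb m (magnus_Omega2 m M H t h) = (\<Sum>k<M. scaleR w (cs (- \<i>) * ?E k))
      + scaleR (w\<^sup>2 / 2) (\<Sum>k<M. br (\<Sum>l<k. ?E l) (?E k))"
    unfolding magnus_Omega2_def Let_def w_def[symmetric]
    by (subst emb_add)
      (simp_all add: emb_smult msum_carrier H emb_msum emb_commutator cs_of_real c sum_distrib_left scaleR_sum_right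
        del: of_real_power of_real_divide of_real_minus mult_minus_left)
  also have "scaleR (w\<^sup>2 / 2) (\<Sum>k<M. br (\<Sum>l<k. ?E l) (?E k))
      = scaleR (1/2) (\<Sum>k<M. \<Sum>l<k. br (scaleR w (cs (- \<i>) * ?E k)) (scaleR w (cs (- \<i>) * ?E l)))"
  proof -
    \<comment> \<open>The square of - \<i> is -1 and reverses the commutator. This reconciles the
      order [H l, H k] in \<open>magnus_Omega2\<close> with the order (k, l) in
      \<open>magnus2\<close>.\<close>
    have "br (cs (- \<i>) * F) (cs (- \<i>) * G) = br G F" for F G
    proof -
      have "br (cs (- \<i>) * F) (cs (- \<i>) * G) = cs (- \<i> * - \<i>) * br F G"
        unfolding br_def cs_mult by (simp add: mult.assoc cs_left_commute[of F] cs_left_commute[of G] right_diff_distrib)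
      also have "\<dots> = - br F G"
        using cs_of_real[of "-1"] by simp
      finally show ?thesis by (simp add: br_swap[of F])
    qed
    then show ?thesis
      by (simp add: br_simps br_sum scaleR_sum_right power2_eq_square)
  qed
  finally show ?thesis
    by (simp add: magnus2_def)
qed

lemma emb_magnus_U2:
  assumes H: "\<And>s. H s \<in> carrier_mat m m"
  shows "emb m (magnus_U2 m M H h j) = magnus_product (\<lambda>t. cs (- \<i>) * emb m (H t)) M h j * proj m"
    and "magnus_U2 m M H h j \<in> carrier_mat m m"
proof (induction j)
  case 0
  { case 1 show ?case by (simp add: emb_one) }
  { case 2 show ?case by simp }
next
  case (Suc j)
  have O: "magnus_Omega2 m M H t h \<in> carrier_mat m m" for t
    by (simp add: magnus_Omega2_def Let_def msum_carrier)
  { case 1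
    have "emb m (magnus_U2 m M H h (Suc j))
        = exp (emb m (magnus_Omega2 m M H (real j * h) h)) * emb m (magnus_U2 m M H h j)"
      unfolding magnus_U2.simps emb_mult[OF mat_exp_carrier[OF O] Suc(2)] emb_mat_exp[OF O] mult.assoc proj_emb ..
    then show ?case
      unfolding Suc(1) emb_magnus_Omega2[OF H] by (simp add: mult.assoc) }
  { case 2 show ?case
      by (simp add: mult_carrier_mat[where n = m] mat_exp_carrier O Suc) }
qed

text \<open>The definition differentiates entries, the estimates need a derivative in operator norm;
  an expansion into finitely many matrix units leads from one to the other.\<close>

lemma emb_time_ordered_exp:
  assumes U: "time_ordered_exp m H T U" and H: "\<And>s. H s \<in> carrier_mat m m" and t: "t \<in> {0..T}"
  shows "((\<lambda>s. emb m (U s)) has_vector_derivative (cs (- \<i>) * emb m (H t)) * emb m (U t)) (at t within {0..T})"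
proof -
  let ?e = "\<lambda>a b. ker m (\<lambda>p q. of_bool (p = a \<and> q = b))"
  have expand: "ker m K = (\<Sum>a<m. \<Sum>b<m. cs (K a b) * ?e a b)" for K
  proof -
    have "(\<Sum>a<m. \<Sum>b<m. cs (K a b) * ?e a b)
        = ker m (\<lambda>p q. \<Sum>a<m. \<Sum>b<m. K a b * of_bool (p = a \<and> q = b))"
      by (simp add: cs_ker ker_sum)
    also have "\<dots> = ker m K"
    proof (rule ker_cong)
      fix p q assume "p < m" "q < m"
      moreover have "K a b * of_bool (p = a \<and> q = b) = (if a = p then if b = q then K a b else 0 else 0)" for a b
        by auto
      ultimately show "(\<Sum>a<m. \<Sum>b<m. K a b * of_bool (p = a \<and> q = b)) = K p q"
        by (simp add: if_distrib[of "\<lambda>f. sum f _"] sum.If_cases cong: if_cong)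
    qed
    finally show ?thesis by simp
  qed
  have Ut: "U t \<in> carrier_mat m m"
    using U t by (auto simp: time_ordered_exp_def)
  have "((\<lambda>s. \<Sum>a<m. \<Sum>b<m. cs (U s $$ (a, b)) * ?e a b) has_vector_derivative
      (\<Sum>a<m. \<Sum>b<m. cs (((- \<i>) \<cdot>\<^sub>m (H t * U t)) $$ (a, b)) * ?e a b)) (at t within {0..T})"
  proof (intro has_vector_derivative_sum)
    fix a b assume "a \<in> {..<m}" "b \<in> {..<m}"
    then have "((\<lambda>s. U s $$ (a, b)) has_vector_derivative ((- \<i>) \<cdot>\<^sub>m (H t * U t)) $$ (a, b)) (at t within {0..T})"
      using U t by (auto simp: time_ordered_exp_def)
    from bounded_linear.has_vector_derivative[OF bounded_linear_compose[OF bounded_linear_mult_left bounded_linear_cs] this]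
    show "((\<lambda>s. cs (U s $$ (a, b)) * ?e a b) has_vector_derivative
        cs (((- \<i>) \<cdot>\<^sub>m (H t * U t)) $$ (a, b)) * ?e a b) (at t within {0..T})" .
  qed
  then have "((\<lambda>s. emb m (U s)) has_vector_derivative emb m ((- \<i>) \<cdot>\<^sub>m (H t * U t))) (at t within {0..T})"
    unfolding emb_def expand[symmetric] .
  then show ?thesis
    using emb_smult[of "H t * U t" m "- \<i>"] emb_mult[of "H t" m "U t"] H[of t] Ut by (simp add: mult.assoc)
qed

section \<open>Digits and shifts on the grid\<close>

definition place :: "nat \<Rightarrow> 'd::finite \<Rightarrow> nat" where
  "place N i = N ^ (CARD('d) - 1 - to_nat_on (UNIV :: 'd set) i)"

definition dg :: "nat \<Rightarrow> nat \<Rightarrow> 'd::finite \<Rightarrow> nat" where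
  "dg N p i = (p div place N i) mod N"

text \<open>The neighbouring grid point in direction \<open>i\<close> under periodic boundary
  conditions, expressed on row indices.\<close>

definition sh :: "nat \<Rightarrow> 'd::finite \<Rightarrow> nat \<Rightarrow> nat" where
  "sh N i p = (p div (place N i * N)) * (place N i * N) + ((dg N p i + 1) mod N) * place N i + p mod place N i"

lemma to_nat_on_lt: "to_nat_on (UNIV :: 'd::finite set) i < CARD('d)"
  using bij_betwE[OF to_nat_on_finite[of "UNIV :: 'd set"]] by auto

lemma dg_lt: "0 < N \<Longrightarrow> dg N p i < N"
  by (simp add: dg_def)

lemma digit_decomposition: "p = (p div (P * N)) * (P * N) + ((p div P) mod N) * P + p mod P" for p P N :: nat
proof -
  have "p = (p div P) * P + p mod P" by simp
  also have "p div P = (p div P div N) * N + (p div P) mod N" by simp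
  also have "p div P div N = p div (P * N)" by (simp add: div_mult2_eq)
  finally show ?thesis by (simp add: algebra_simps)
qed

lemma digit_composition:
  fixes u g r P N :: nat
  assumes "g < N" "r < P"
  defines "x \<equiv> u * (P * N) + g * P + r"
  shows "x div (P * N) = u" "(x div P) mod N = g" "x mod P = r"
proof -
  have x: "x = (u * N + g) * P + r" by (simp add: x_def algebra_simps)
  have d: "x div P = u * N + g" unfolding x using assms by simp
  show "x mod P = r" unfolding x using assms by simp
  show "(x div P) mod N = g" unfolding d using assms by simp
  show "x div (P * N) = u" unfolding div_mult2_eq d using assms by simp
qed

context
  fixes N :: nat assumes N: "0 < N"
begin

lemma place_pos: "0 < place N i"
  using N by (simp add: place_def)

lemma sh_parts:
  "sh N i p div (place N i * N) = p div (place N i * N)"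
  "dg N (sh N i p) i = (dg N p i + 1) mod N"
  "sh N i p mod place N i = p mod place N i"
  unfolding dg_def[of N "sh N i p"] unfolding sh_def
  by (rule digit_composition; use N place_pos[of i] in simp)+

lemma eq_sh_iff:
  "q = sh N i p \<longleftrightarrow> q div (place N i * N) = p div (place N i * N) \<and> dg N q i = (dg N p i + 1) mod N
     \<and> q mod place N i = p mod place N i"
  (is "_ \<longleftrightarrow> ?R")
proof
  assume ?R
  then show "q = sh N i p"
    using digit_decomposition[of q "place N i" N] unfolding sh_def by (simp add: dg_def)
qed (simp add: sh_parts)

lemma size_factor: "\<exists>R. N ^ CARD('d) = R * (place N i * N)" for i :: "'d::finite"
proof -
  have "N ^ CARD('d) = N ^ (to_nat_on (UNIV :: 'd set) i) * (place N i * N)"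
    unfolding place_def power_Suc2[symmetric] power_add[symmetric] using to_nat_on_lt[of i] by simp
  then show ?thesis by blast
qed

lemma sh_lt:
  fixes i :: "'d::finite"
  assumes "p < N ^ CARD('d)"
  shows "sh N i p < N ^ CARD('d)"
proof -
  obtain R where R: "N ^ CARD('d) = R * (place N i * N)"
    using size_factor by blast
  have pos: "0 < place N i * N" using N place_pos[of i] by simp
  have "p div (place N i * N) < R"
    using assms unfolding R by (simp add: div_less_iff_less_mult[OF pos])
  then have "sh N i p div (place N i * N) < R"
    by (simp add: sh_parts)
  then show ?thesis
    unfolding R by (simp add: div_less_iff_less_mult[OF pos])
qed

text \<open>Digits below that of \<open>i\<close> depend only on \<open>p mod place N i\<close>,
  digits above only on \<open>p div (place N i * N)\<close>, and \<open>sh\<close> preserves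
  both.\<close>

lemma dg_sh_other:
  fixes i j :: "'d::finite"
  assumes "j \<noteq> i"
  shows "dg N (sh N i p) j = dg N p j"
proof -
  define e where "e = (\<lambda>i::'d. CARD('d) - 1 - to_nat_on (UNIV :: 'd set) i)"
  have pl: "place N k = N ^ e k" for k by (simp add: place_def e_def)
  have "to_nat_on (UNIV :: 'd set) i \<noteq> to_nat_on (UNIV :: 'd set) j"
    using assms bij_betw_imp_inj_on[OF to_nat_on_finite[of "UNIV :: 'd set"]] by (auto dest: inj_onD)
  then have "e i \<noteq> e j"
    using to_nat_on_lt[of i] to_nat_on_lt[of j] unfolding e_def by linarith
  then consider "e j < e i" | "e i < e j" by linarith
  then show ?thesis
  proof cases
    case 1
    then have P: "place N i = place N j * (N * N ^ (e i - e j - 1))"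
      unfolding pl power_Suc[symmetric] power_add[symmetric] by simp
    have low: "dg N x j = (x mod place N i) div place N j mod N" for x
    proof -
      have "(x mod place N i) div place N j = (x div place N j) mod (N * N ^ (e i - e j - 1))"
        unfolding P mod_mult2_eq[of x "place N j"] using place_pos[of j] by simp
      then show ?thesis by (simp add: dg_def mod_mod_cancel)
    qed
    show ?thesis by (simp add: low sh_parts)
  next
    case 2
    then have P: "place N j = (place N i * N) * N ^ (e j - e i - 1)"
      unfolding pl power_Suc2[symmetric] power_add[symmetric] by simp
    have high: "dg N x j = x div (place N i * N) div N ^ (e j - e i - 1) mod N" for x
      unfolding dg_def P by (simp add: div_mult2_eq)
    show ?thesis by (simp add: high sh_parts)
  qed
qed

lemma digits_inject:
  assumes "p < N ^ n" "q < N ^ n" "\<And>e. e < n \<Longrightarrow> (p div N ^ e) mod N = (q div N ^ e) mod N"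
  shows "p = q"
  using assms
proof (induction n arbitrary: p q)
  case (Suc n)
  have "p div N = q div N"
  proof (rule Suc.IH)
    show "p div N < N ^ n" "q div N < N ^ n"
      using Suc.prems N by (simp_all add: div_less_iff_less_mult mult.commute)
    show "(p div N div N ^ e) mod N = (q div N div N ^ e) mod N" if "e < n" for e
      using Suc.prems(3)[of "Suc e"] that by (simp add: div_mult2_eq[symmetric])
  qed
  moreover have "p mod N = q mod N"
    using Suc.prems(3)[of 0] by simp
  ultimately show ?case
    by (metis div_mult_mod_eq)
qed simp

lemma dg_inject:
  assumes "p < N ^ CARD('d)" "q < N ^ CARD('d)" "\<And>i::'d::finite. dg N p i = dg N q i"
  shows "p = q"
proof (rule digits_inject[OF assms(1,2)])
  fix e assume e: "e < CARD('d)"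
  then obtain i :: 'd where "to_nat_on UNIV i = CARD('d) - 1 - e"
    using bij_betw_imp_surj_on[OF to_nat_on_finite[of "UNIV :: 'd set"]]
    by (metis (no_types, lifting) diff_less finite imageE lessThan_iff less_imp_diff_less zero_less_one not_gr_zero
        less_nat_zero_code diff_Suc_less diff_diff_left plus_1_eq_Suc)
  then have "place N i = N ^ e"
    using e by (simp add: place_def)
  then show "(p div N ^ e) mod N = (q div N ^ e) mod N"
    using assms(3)[of i] by (simp add: dg_def)
qed

lemma sh_inject:
  fixes i :: "'d::finite"
  assumes "p < N ^ CARD('d)" "q < N ^ CARD('d)" "sh N i p = sh N i q"
  shows "p = q"
proof (rule dg_inject[where 'd = 'd, OF assms(1,2)])
  fix j :: 'd
  have "(dg N p i + 1) mod N = (dg N q i + 1) mod N"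
    using arg_cong[OF assms(3), of "\<lambda>x. dg N x i"] by (simp add: sh_parts)
  moreover have "a = b" if "a < N" "b < N" "(a + 1) mod N = (b + 1) mod N" for a b
    using that by (cases "a + 1 = N"; cases "b + 1 = N") auto
  ultimately have "dg N p i = dg N q i"
    using N dg_lt by blast
  then show "dg N p j = dg N q j"
    using dg_sh_other[of j i p] dg_sh_other[of j i q] assms(3) by (cases "j = i") auto
qed

lemma sh_image: "sh N i ` {..<N ^ CARD('d)} = {..<N ^ CARD('d)}" for i :: "'d::finite"
  by (rule endo_inj_surj) (auto simp: sh_lt intro!: inj_onI dest: sh_inject)

lemma sh_commute:
  fixes i j :: "'d::finite"
  assumes "p < N ^ CARD('d)"
  shows "sh N i (sh N j p) = sh N j (sh N i p)"
proof (rule dg_inject[where 'd = 'd])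
  fix k :: 'd
  show "dg N (sh N i (sh N j p)) k = dg N (sh N j (sh N i p)) k"
    by (cases "i = j"; cases "k = i"; cases "k = j") (auto simp: dg_sh_other sh_parts)
qed (simp_all add: sh_lt assms)

lemma A_dis_carrier: "A_dis d a b N \<in> carrier_mat (N ^ d) (N ^ d)"
  by (simp add: A_dis_def msum_def)

text \<open>The left identity factor compares the digits above that of \<open>i\<close>, the right
  one the digits below, and \<open>X\<close> sees the digit of \<open>i\<close> itself.\<close>

lemma kronecker_ident_entry:
  fixes i :: "'d::finite" and X :: "complex mat"
  defines "l \<equiv> to_nat_on (UNIV :: 'd set) i"
  assumes X: "X \<in> carrier_mat N N" and p: "p < N ^ CARD('d)" and q: "q < N ^ CARD('d)"
  shows "(1\<^sub>m (N ^ l) \<otimes>\<^sub>m X \<otimes>\<^sub>m 1\<^sub>m (N ^ (CARD('d) - 1 - l))) $$ (p, q)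
    = of_bool (p div (place N i * N) = q div (place N i * N)) * X $$ (dg N p i, dg N q i)
      * of_bool (p mod place N i = q mod place N i)"
proof -
  define P where "P = place N i"
  have P0: "0 < P" by (simp add: P_def place_pos)
  have P: "N ^ (CARD('d) - 1 - l) = P" by (simp add: P_def place_def l_def)
  have NP: "0 < N * P" using P0 N by simp
  have R: "N ^ CARD('d) = N ^ l * (N * P)"
    unfolding P[symmetric] power_Suc[symmetric] power_add[symmetric] using to_nat_on_lt[of i] by (simp add: l_def)
  have div: "x div (N * P) < N ^ l" if "x < N ^ CARD('d)" for x
    using that unfolding R by (simp add: div_less_iff_less_mult[OF NP])
  have lt: "x mod (N * P) < N * P" for x
    using NP by simp
  have dgx: "x mod (N * P) div P = dg N x i" for x
  proof -
    have "x mod (P * N) div P = (x div P) mod N"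
      unfolding mod_mult2_eq using P0 by simp
    then show ?thesis by (simp add: dg_def P_def mult.commute)
  qed
  have md: "x mod (N * P) mod P = x mod P" for x
    by (simp add: mod_mod_cancel)
  have inner: "(X \<otimes>\<^sub>m 1\<^sub>m P) $$ (x mod (N * P), y mod (N * P)) = X $$ (dg N x i, dg N y i) * of_bool (x mod P = y mod P)" for x y
    using X lt[of x] lt[of y] P0 by (simp add: kronecker_def dgx md)
  have dims: "dim_row (X \<otimes>\<^sub>m 1\<^sub>m P) = N * P" "dim_col (X \<otimes>\<^sub>m 1\<^sub>m P) = N * P"
    using X by (simp_all add: kronecker_def)
  show ?thesis
    unfolding P kronecker_def[of "1\<^sub>m (N ^ l)"] dims
    using p q div[OF p] div[OF q] unfolding R by (simp add: inner P_def[symmetric] mult.commute[of P N])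
qed

lemma A_dis_entry:
  assumes p: "p < N ^ CARD('d)" and q: "q < N ^ CARD('d)"
  shows "A_dis CARD('d::finite) a b N $$ (p, q) =
    (\<Sum>i\<in>(UNIV :: 'd set). complex_of_real ((real N)\<^sup>2 / (2 * (b - a)\<^sup>2)) *
       (2 * of_bool (p = q) - of_bool (q = sh N i p) - of_bool (p = sh N i q)))"
proof -
  let ?c = "complex_of_real ((real N)\<^sup>2 / (2 * (b - a)\<^sup>2))"
  \<comment> \<open>The predecessor is rewritten as a successor relation read from the other side,
    so \<open>sh\<close> and its transpose describe both neighbours without an inverse
    shift.\<close>
  have pred_iff: "k = (j + N - 1) mod N \<longleftrightarrow> j = (k + 1) mod N" if "j < N" "k < N" for j k
    using that by (cases "j = 0"; cases "k + 1 = N") (auto simp: mod_if)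
  have "A_dis CARD('d) a b N $$ (p, q)
      = (\<Sum>l<CARD('d). (1\<^sub>m (N ^ l) \<otimes>\<^sub>m A_dis1 a b N \<otimes>\<^sub>m 1\<^sub>m (N ^ (CARD('d) - 1 - l))) $$ (p, q))"
    using p q by (simp add: A_dis_def msum_def)
  also have "\<dots> = (\<Sum>i\<in>(UNIV :: 'd set). (1\<^sub>m (N ^ to_nat_on (UNIV :: 'd set) i) \<otimes>\<^sub>m A_dis1 a b N
      \<otimes>\<^sub>m 1\<^sub>m (N ^ (CARD('d) - 1 - to_nat_on (UNIV :: 'd set) i))) $$ (p, q))"
    by (rule sum.reindex_bij_betw[OF to_nat_on_finite[OF finite], symmetric])
  also have "\<dots> = (\<Sum>i\<in>(UNIV :: 'd set). ?c *
       (2 * of_bool (p = q) - of_bool (q = sh N i p) - of_bool (p = sh N i q)))"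
  proof (rule sum.cong[OF refl])
    fix i :: 'd
    have A1: "A_dis1 a b N $$ (dg N p i, dg N q i) = ?c * (2 * of_bool (dg N q i = dg N p i)
        - of_bool (dg N q i = (dg N p i + 1) mod N) - of_bool (dg N p i = (dg N q i + 1) mod N))"
      unfolding pred_iff[OF dg_lt[OF N, of p i] dg_lt[OF N, of q i], symmetric]
      using dg_lt[OF N, of p i] dg_lt[OF N, of q i]
      by (simp add: A_dis1_def)
    have eq: "p = q \<longleftrightarrow> q div (place N i * N) = p div (place N i * N) \<and> dg N q i = dg N p i
        \<and> q mod place N i = p mod place N i"
      using digit_decomposition[of p "place N i" N] digit_decomposition[of q "place N i" N]
      by (auto simp: dg_def)
    have c: "A_dis1 a b N \<in> carrier_mat N N"
      by (simp add: A_dis1_def)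
    show "(1\<^sub>m (N ^ to_nat_on (UNIV :: 'd set) i) \<otimes>\<^sub>m A_dis1 a b N
      \<otimes>\<^sub>m 1\<^sub>m (N ^ (CARD('d) - 1 - to_nat_on (UNIV :: 'd set) i))) $$ (p, q)
      = ?c * (2 * of_bool (p = q) - of_bool (q = sh N i p) - of_bool (p = sh N i q))"
      unfolding kronecker_ident_entry[OF c p q] A1 eq eq_sh_iff by auto
  qed
  finally show ?thesis .
qed

end

section \<open>Conjugating plane waves by the discrete Laplacian\<close>

lemma cnj_of_bool [simp]: "cnj (of_bool b) = of_bool b"
  by (cases b) auto

section \<open>Diagonal operators\<close>

definition Dg :: "nat \<Rightarrow> (nat \<Rightarrow> complex) \<Rightarrow> op" where
  "Dg m f = ker m (\<lambda>p q. f p * of_bool (p = q))"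

lemma coord_Dg: "coord (app (Dg m f) u) p = (if p < m then f p * coord u p else 0)"
proof (cases "p < m")
  case True
  have "(\<Sum>q<m. f p * of_bool (p = q) * coord u q) = (\<Sum>q<m. if p = q then f p * coord u q else 0)"
    by (rule sum.cong) auto
  then show ?thesis using True by (simp add: Dg_def)
qed (simp add: Dg_def)

text \<open>Injectivity of \<open>\<pi>\<close> ensures that each coordinate of \<open>u\<close> is
  counted at most once. This treats diagonal operators and the forward shifts together.\<close>

lemma norm_op_le_coordwise:
  assumes B: "0 \<le> B" and inj: "inj_on \<pi> {..<m}"
    and F: "\<And>u p. coord (app F u) p = (if p < m then f p * coord u (\<pi> p) else 0)"
    and f: "\<And>p. p < m \<Longrightarrow> cmod (f p) \<le> B"
  shows "norm F \<le> B"
proof (rule norm_op_leI[OF B])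
  fix u
  have "(norm (app F u))\<^sup>2 = (\<Sum>p<m. (cmod (coord (app F u) p))\<^sup>2)"
    by (subst norm_finite_support[of m]) (auto simp: F L2_set_def sum_nonneg)
  also have "\<dots> \<le> (\<Sum>p<m. B\<^sup>2 * (cmod (coord u (\<pi> p)))\<^sup>2)"
    using f by (intro sum_mono) (auto simp: F norm_mult power_mult_distrib intro!: mult_right_mono power_mono)
  also have "\<dots> = B\<^sup>2 * (\<Sum>q\<in>\<pi> ` {..<m}. (cmod (coord u q))\<^sup>2)"
    by (simp add: sum_distrib_left sum.reindex[OF inj])
  also have "\<dots> \<le> B\<^sup>2 * (norm u)\<^sup>2"
    by (intro mult_left_mono sum_coord_le) auto
  finally have "(norm (app F u))\<^sup>2 \<le> (B * norm u)\<^sup>2"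
    by (simp add: power_mult_distrib)
  then show "norm (app F u) \<le> B * norm u"
    by (rule power2_le_imp_le) (simp add: B)
qed

lemma norm_Dg: "0 \<le> B \<Longrightarrow> (\<And>p. p < m \<Longrightarrow> cmod (f p) \<le> B) \<Longrightarrow> norm (Dg m f) \<le> B"
  by (rule norm_op_le_coordwise[where \<pi> = "\<lambda>p. p"]) (auto simp: coord_Dg)

lemma Dg_mult: "Dg m f * Dg m g = Dg m (\<lambda>p. f p * g p)"
  by (auto intro!: op_eqI l2_eqI simp: coord_Dg)

lemma Dg_diff: "Dg m f - Dg m g = Dg m (\<lambda>p. f p - g p)"
  by (auto intro!: op_eqI l2_eqI simp: coord_Dg algebra_simps)

lemma Dg_cong: "(\<And>p. p < m \<Longrightarrow> f p = g p) \<Longrightarrow> Dg m f = Dg m g"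
  by (auto intro!: op_eqI l2_eqI simp: coord_Dg)

lemma cs_Dg: "cs c * Dg m f = Dg m (\<lambda>p. c * f p)"
  by (auto intro!: op_eqI l2_eqI simp: coord_Dg)

lemma proj_Dg: "proj m * Dg m f = Dg m f" "Dg m f * proj m = Dg m f"
  by (simp_all add: Dg_def proj_ker)

lemma Dg_sum: "(\<Sum>i\<in>I. Dg m (f i)) = Dg m (\<lambda>p. \<Sum>i\<in>I. f i p)"
  by (auto intro!: op_eqI l2_eqI simp: coord_Dg app_sum_left coord_sum sum_distrib_right)

text \<open>\<open>\<kappa> N\<^sup>2 / 2\<close> is the coefficient of the difference operator, so that \<open>\<kappa> = 1 / (b - a)\<^sup>2\<close>. On the
  span of the first \<open>m\<close> coordinates \<open>Sf i\<close> and \<open>Sb i\<close> are the two cyclic shifts in direction \<open>i\<close>;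
  \<open>Lt (\<lambda>_. 1)\<close> is \<open>\<i>\<close> times the off-diagonal part of the matrix \<open>A\<close>, and \<open>Lt z\<close> is its conjugate by the
  plane wave \<open>Ez z\<close>.\<close>

locale torus_grid =
  fixes N m :: nat and \<kappa> :: real and ty :: "'d::finite itself"
  assumes N: "0 < N" and m: "m = N ^ CARD('d)" and \<kappa>: "0 \<le> \<kappa>"
begin

definition Sf :: "'d \<Rightarrow> op" where
  "Sf i = ker m (\<lambda>p q. of_bool (q = sh N i p))"

definition Sb :: "'d \<Rightarrow> op" where
  "Sb i = ker m (\<lambda>p q. of_bool (p = sh N i q))"

lemma sh_lt_m: "p < m \<Longrightarrow> sh N (i::'d) p < m"
  using sh_lt[OF N] by (simp add: m)

lemma sh_eq_iff: "p < m \<Longrightarrow> q < m \<Longrightarrow> sh N (i::'d) p = sh N i q \<longleftrightarrow> p = q"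
  using sh_inject[OF N, where 'd = 'd] by (auto simp: m)

lemma coord_Sf: "coord (app (Sf i) u) p = (if p < m then coord u (sh N i p) else 0)"
proof (cases "p < m")
  case True
  have "(\<Sum>q<m. of_bool (q = sh N i p) * coord u q) = (\<Sum>q<m. if sh N i p = q then coord u q else 0)"
    by (rule sum.cong) auto
  then show ?thesis using True sh_lt_m by (simp add: Sf_def)
qed (simp add: Sf_def)

lemma inner_Sb: "inner (app (Sb i) u) v = inner u (app (Sf i) v)"
  unfolding Sb_def Sf_def inner_ker_adjoint by simp

lemma norm_Sf: "norm (Sf i) \<le> 1"
  by (rule norm_op_le_coordwise[where \<pi> = "sh N i" and f = "\<lambda>_. 1" and m = m])
    (auto simp: coord_Sf sh_eq_iff intro!: inj_onI)

text \<open>\<open>Sb i\<close> is the adjoint of \<open>Sf i\<close>, so the squared norm of Sb u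
  is the inner product of u with Sf Sb u, and the bound for \<open>Sf i\<close> carries
  over.\<close>

lemma norm_Sb: "norm (Sb i) \<le> 1"
proof (rule norm_op_leI)
  fix u
  have "norm (app (Sf i) (app (Sb i) u)) \<le> norm (app (Sb i) u)"
    using norm_app[of "Sf i" "app (Sb i) u"] norm_Sf[of i] mult_right_mono[OF norm_Sf[of i] norm_ge_zero[of "app (Sb i) u"]]
    by linarith
  have "(norm (app (Sb i) u))\<^sup>2 = inner u (app (Sf i) (app (Sb i) u))"
    by (simp add: power2_norm_eq_inner inner_Sb)
  also have "\<dots> \<le> norm u * norm (app (Sf i) (app (Sb i) u))"
    by (rule norm_cauchy_schwarz)
  also have "\<dots> \<le> norm u * norm (app (Sb i) u)"
    by (intro mult_left_mono norm_ge_zero) fact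
  finally have "norm (app (Sb i) u) * norm (app (Sb i) u) \<le> norm u * norm (app (Sb i) u)"
    by (simp add: power2_eq_square)
  then show "norm (app (Sb i) u) \<le> 1 * norm u"
    by (cases "app (Sb i) u = 0") auto
qed simp

lemma Sf_Sb: "Sf i * Sb i = proj m"
  unfolding Sf_def Sb_def proj_def ker_mult
proof (rule ker_cong)
  fix p q assume pq: "p < m" "q < m"
  have "(\<Sum>r<m. of_bool (r = sh N i p) * of_bool (r = sh N i q) :: complex)
      = (\<Sum>r<m. if sh N i p = r then of_bool (sh N i p = sh N i q) else 0)"
    by (rule sum.cong) auto
  then show "(\<Sum>r<m. of_bool (r = sh N i p) * of_bool (r = sh N i q)) = (of_bool (p = q) :: complex)"
    using pq sh_lt_m[of p i] by (simp add: sh_eq_iff)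
qed

lemma Sb_Sf: "Sb i * Sf i = proj m"
  unfolding Sf_def Sb_def proj_def ker_mult
proof (rule ker_cong)
  fix p q assume pq: "p < m" "q < m"
  obtain r0 where r0: "r0 < m" "p = sh N i r0"
    using sh_image[OF N, of i] pq(1) unfolding m by blast
  have "(\<Sum>r<m. of_bool (p = sh N i r) * of_bool (q = sh N i r) :: complex)
      = (\<Sum>r<m. if r0 = r then of_bool (q = p) else 0)"
    using r0 by (intro sum.cong) (auto simp: sh_eq_iff)
  then show "(\<Sum>r<m. of_bool (p = sh N i r) * of_bool (q = sh N i r)) = (of_bool (p = q) :: complex)"
    using r0 by auto
qed

lemma proj_S: "proj m * Sf i = Sf i" "Sf i * proj m = Sf i" "proj m * Sb i = Sb i" "Sb i * proj m = Sb i"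
  by (simp_all add: Sf_def Sb_def proj_ker)

lemma Sf_Dg: "Sf i * Dg m f = Dg m (\<lambda>p. f (sh N i p)) * Sf i"
  by (auto intro!: op_eqI l2_eqI simp: coord_Sf coord_Dg sh_lt_m)

lemma Sb_Dg: "Dg m f * Sb i = Sb i * Dg m (\<lambda>p. f (sh N i p))"
proof -
  have "Dg m f * Sb i = Sb i * (Sf i * Dg m f) * Sb i"
    by (simp add: mult.assoc[symmetric] Sb_Sf proj_Dg)
  also have "\<dots> = Sb i * Dg m (\<lambda>p. f (sh N i p)) * (Sf i * Sb i)"
    by (simp add: Sf_Dg mult.assoc)
  finally show ?thesis
    by (simp add: Sf_Sb mult.assoc proj_Dg)
qed

lemma Sf_Sf: "Sf i * Sf j = Sf j * Sf i"
proof -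
  have "p < m \<Longrightarrow> sh N i (sh N j p) = sh N j (sh N i p)" for p
    by (simp add: m sh_commute[OF N])
  then show ?thesis
    by (auto intro!: op_eqI l2_eqI simp: coord_Sf sh_lt_m)
qed

lemma Sb_Sf_commute: "Sb i * Sf j = Sf j * Sb i"
proof -
  have "Sb i * Sf j = Sb i * (Sf j * Sf i) * Sb i"
    by (simp add: mult.assoc Sf_Sb proj_S)
  also have "\<dots> = (Sb i * Sf i) * Sf j * Sb i"
    by (simp add: mult.assoc Sf_Sf)
  finally show ?thesis
    by (simp add: Sb_Sf proj_S)
qed

lemma Sb_Sb: "Sb i * Sb j = Sb j * Sb i"
proof -
  have "Sb i * Sb j = Sb i * Sb j * (Sf i * Sb i)"
    by (simp add: mult.assoc Sf_Sb proj_S)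
  also have "\<dots> = (Sb i * Sf i) * Sb j * Sb i"
    by (metis Sb_Sf_commute mult.assoc)
  finally show ?thesis
    by (simp add: Sb_Sf proj_S)
qed

text \<open>This is \<i> times the coefficient of the neighbour terms of the difference operator.
  Being purely imaginary, it makes every \<open>Lt x\<close> skew.\<close>

definition \<gamma> :: complex where
  "\<gamma> = - \<i> * of_real (\<kappa> * (real N)\<^sup>2 / 2)"

lemma cnj_gamma: "cnj \<gamma> = - \<gamma>"
  by (simp add: \<gamma>_def)

lemma cmod_gamma: "cmod \<gamma> = \<kappa> * (real N)\<^sup>2 / 2"
  using \<kappa> by (simp add: \<gamma>_def norm_mult norm_power)

definition Lt :: "('d \<Rightarrow> complex) \<Rightarrow> op" where
  "Lt x = (\<Sum>i\<in>UNIV. cs (\<gamma> * x i) * Sf i + cs (\<gamma> * cnj (x i)) * Sb i)"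

lemma Lt_add: "Lt (\<lambda>i. x i + y i) = Lt x + Lt y"
  by (simp add: Lt_def cs_add distrib_left distrib_right sum.distrib add_ac)

lemma cs_scaleR: "cs (scaleR r c) = scaleR r (cs c)"
  by (rule linear_scale[OF bounded_linear.linear[OF bounded_linear_cs]])

lemma Lt_scaleR: "scaleR r (Lt x) = Lt (\<lambda>i. of_real r * x i)"
proof -
  have "cs (\<gamma> * (of_real r * c)) * F = scaleR r (cs (\<gamma> * c) * F)" for c F
    using cs_scaleR[of r "\<gamma> * c"] by (simp add: scaleR_conv_of_real[where 'a = complex] mult.left_commute)
  then show ?thesis
    by (simp add: Lt_def scaleR_sum_right scaleR_add_right)
qed

lemma Lt_diff: "Lt (\<lambda>i. x i - y i) = Lt x - Lt y"
  using Lt_add[of "\<lambda>i. x i - y i" y] by simp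

lemma Lt_commute: "Lt x * Lt y = Lt y * Lt x"
proof -
  have *: "(cs a * Sf i + cs b * Sb i) * (cs c * Sf j + cs d * Sb j)
      = (cs c * Sf j + cs d * Sb j) * (cs a * Sf i + cs b * Sb i)" for a b c d i j
  proof -
    have swap: "cs a * X * (cs b * Y) = cs b * Y * (cs a * X)" if "X * Y = Y * X" for a b X Y
    proof -
      have "cs a * X * (cs b * Y) = cs (a * b) * (X * Y)"
        unfolding cs_mult by (simp add: mult.assoc cs_left_commute[of X])
      moreover have "cs b * Y * (cs a * X) = cs (b * a) * (Y * X)"
        unfolding cs_mult by (simp add: mult.assoc cs_left_commute[of Y])
      ultimately show ?thesis using that by (simp add: mult.commute)
    qed
    show ?thesis
      unfolding distrib_left distrib_right
      using swap[OF Sf_Sf[of i j], of a c] swap[OF Sb_Sb[of i j], of b d]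
        swap[OF Sb_Sf_commute[of i j], of b c] swap[OF Sb_Sf_commute[of j i, symmetric], of a d]
      by simp
  qed
  show ?thesis
    unfolding Lt_def sum_product by (subst sum.swap) (simp only: *)
qed

lemma norm_Lt: "norm (Lt x) \<le> \<kappa> * (real N)\<^sup>2 * (\<Sum>i\<in>UNIV. cmod (x i))"
proof -
  have "norm (Lt x) \<le> (\<Sum>i\<in>UNIV. cmod \<gamma> * cmod (x i) + cmod \<gamma> * cmod (x i))"
    unfolding Lt_def
  proof (rule order_trans[OF norm_sum sum_mono], rule norm_triangle_mono)
    fix i
    show "norm (cs (\<gamma> * x i) * Sf i) \<le> cmod \<gamma> * cmod (x i)"
      using order_trans[OF norm_contraction_mult(2)[OF norm_Sf] norm_cs_le, of "\<gamma> * x i" i]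
      by (simp add: norm_mult)
    show "norm (cs (\<gamma> * cnj (x i)) * Sb i) \<le> cmod \<gamma> * cmod (x i)"
      using order_trans[OF norm_contraction_mult(2)[OF norm_Sb] norm_cs_le, of "\<gamma> * cnj (x i)" i]
      by (simp add: norm_mult)
  qed
  also have "\<dots> = 2 * cmod \<gamma> * (\<Sum>i\<in>UNIV. cmod (x i))"
    unfolding sum_distrib_left by (rule sum.cong) simp_all
  finally show ?thesis
    by (simp add: cmod_gamma)
qed

lemma Lt_ker:
  "Lt x = ker m (\<lambda>p q. \<Sum>i\<in>UNIV. \<gamma> * (x i * of_bool (q = sh N i p) + cnj (x i) * of_bool (p = sh N i q)))"
  unfolding Lt_def Sf_def Sb_def cs_ker ker_add ker_sum
  by (rule ker_cong) (simp add: algebra_simps)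

lemma skew_Lt: "skew (Lt x)"
  unfolding Lt_ker by (rule skew_ker) (simp add: sum_negf[symmetric] cnj_gamma algebra_simps)

definition Ez :: "('d \<Rightarrow> complex) \<Rightarrow> op" where
  "Ez z = Dg m (\<lambda>p. \<Prod>i\<in>UNIV. z i ^ dg N p i)"

definition root_tuple :: "('d \<Rightarrow> complex) \<Rightarrow> bool" where
  "root_tuple z \<longleftrightarrow> (\<forall>i. z i ^ N = 1)"

lemma cmod_root_tuple: "root_tuple z \<Longrightarrow> cmod (z i) = 1"
proof -
  assume "root_tuple z"
  then have "cmod (z i) ^ N = 1 ^ N"
    by (simp add: root_tuple_def norm_power[symmetric])
  then show ?thesis
    by (rule power_eq_imp_eq_base) (use N in auto)
qed

lemma root_tuple_cnj: "root_tuple z \<Longrightarrow> z i * cnj (z i) = 1"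
  using cmod_root_tuple[of z i] by (metis complex_norm_square of_real_1 power_one)

lemma norm_Ez: "root_tuple z \<Longrightarrow> norm (Ez z) \<le> 1"
  unfolding Ez_def by (rule norm_Dg) (auto simp: prod_norm[symmetric] norm_power cmod_root_tuple)

lemma Ez_commute: "Ez z * Ez w = Ez w * Ez z"
  by (simp add: Ez_def Dg_mult mult.commute)

lemma proj_Ez: "proj m * Ez z = Ez z" "Ez z * proj m = Ez z"
  by (simp_all add: Ez_def proj_Dg)

text \<open>At the wrap-around from digit N - 1 to 0 the factor \<open>z i\<close> persists because
  \<open>z i ^ N = 1\<close>; the other digits do not move.\<close>

lemma phase_shift:
  assumes "root_tuple z"
  shows "(\<Prod>j\<in>UNIV. z j ^ dg N (sh N i p) j) = z i * (\<Prod>j\<in>UNIV. z j ^ dg N p j)"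
proof -
  have "z i ^ ((g + 1) mod N) = z i * z i ^ g" if "g < N" for g
  proof (cases "g + 1 = N")
    case True
    then have "z i * z i ^ g = 1"
      using assms by (metis power_Suc Suc_eq_plus1 root_tuple_def)
    then show ?thesis using True by simp
  qed (use that in simp)
  from this[OF dg_lt[OF N]] have i: "z i ^ dg N (sh N i p) i = z i * z i ^ dg N p i"
    by (simp add: sh_parts[OF N])
  have "(\<Prod>j\<in>UNIV - {i}. z j ^ dg N (sh N i p) j) = (\<Prod>j\<in>UNIV - {i}. z j ^ dg N p j)"
    by (rule prod.cong) (auto simp: dg_sh_other[OF N])
  then show ?thesis
    by (simp add: prod.remove[of UNIV i] i mult.assoc)
qed

lemma Sf_Ez: "root_tuple z \<Longrightarrow> Sf i * Ez z = cs (z i) * (Ez z * Sf i)"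
  unfolding Ez_def by (simp add: Sf_Dg phase_shift cs_Dg[symmetric] mult.assoc)

lemma Sb_Ez:
  assumes "root_tuple z"
  shows "Sb i * Ez z = cs (cnj (z i)) * (Ez z * Sb i)"
proof -
  have "Ez z * Sb i = cs (z i) * (Sb i * Ez z)"
    unfolding Ez_def by (simp add: Sb_Dg phase_shift[OF assms] cs_Dg[symmetric] cs_left_commute)
  then have "cs (cnj (z i)) * (Ez z * Sb i) = cs (cnj (z i) * z i) * (Sb i * Ez z)"
    by (simp add: cs_mult mult.assoc)
  then show ?thesis
    using root_tuple_cnj[OF assms, of i] by (simp add: mult.commute cs_1)
qed

lemma Lt_Ez:
  assumes z: "root_tuple z"
  shows "Lt x * Ez z = Ez z * Lt (\<lambda>i. z i * x i)"
proof -
  have f: "cs a * Sf i * Ez z = Ez z * (cs (a * z i) * Sf i)" for a i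
    unfolding mult.assoc Sf_Ez[OF z] cs_left_commute[of "Ez z"] cs_mult ..
  have b: "cs a * Sb i * Ez z = Ez z * (cs (a * cnj (z i)) * Sb i)" for a i
    unfolding mult.assoc Sb_Ez[OF z] cs_left_commute[of "Ez z"] cs_mult ..
  have c: "\<gamma> * (z i * x i) = \<gamma> * x i * z i" "\<gamma> * cnj (z i * x i) = \<gamma> * cnj (x i) * cnj (z i)" for i
    by simp_all
  show ?thesis
    unfolding Lt_def sum_distrib_left sum_distrib_right
    by (rule sum.cong[OF refl]) (simp only: distrib_left distrib_right f b c)
qed

lemma exp_Lt_Ez: "root_tuple z \<Longrightarrow> exp (Lt x) * Ez z = Ez z * exp (Lt (\<lambda>i. z i * x i))"
  by (rule exp_intertwine) (rule Lt_Ez)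

lemma exp_Lt_add: "exp (Lt x) * exp (Lt y) = exp (Lt (\<lambda>i. x i + y i))"
  unfolding Lt_add by (rule exp_add_commuting[OF Lt_commute, symmetric])

text \<open>The plane wave conjugated by the flow of the discrete Laplacian, in the closed form
  established by \<open>conj_Ez\<close>.\<close>

definition Fz :: "('d \<Rightarrow> complex) \<Rightarrow> real \<Rightarrow> op" where
  "Fz z t = Ez z * exp (Lt (\<lambda>i. of_real t * (z i - 1)))"

lemma norm_Fz: "root_tuple z \<Longrightarrow> norm (Fz z t) \<le> 1"
  unfolding Fz_def
  by (rule order_trans[OF norm_contraction_mult(2)[OF norm_exp_skew[OF skew_Lt]] norm_Ez])

text \<open>The first summand of \<open>G\<close> is scalar on the corner and cancels. Pulling
  \<open>Ez z\<close> to the left turns the unit coefficients of \<open>Lt\<close> into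
  \<open>z\<close>, and the two commuting exponentials merge into one with coefficients t (z i -
  1).\<close>

lemma conj_Ez:
  fixes r t :: real
  assumes "root_tuple z"
  defines "G \<equiv> cs (\<i> * of_real r) * proj m + Lt (\<lambda>_. 1)"
  shows "exp (scaleR t G) * Ez z * exp (scaleR (- t) G) = Fz z t"
proof -
  define G' where "G' = cs (\<i> * of_real r) * proj m + Lt z"
  have "G * Ez z = Ez z * G'"
    unfolding G_def G'_def distrib_left distrib_right
    using Lt_Ez[OF assms(1), of "\<lambda>_. 1"] by (simp add: mult.assoc proj_Ez cs_left_commute)
  then have "exp (scaleR t G) * Ez z = Ez z * exp (scaleR t G')"
    by (intro exp_intertwine) simp
  moreover have "exp (scaleR t G') * exp (scaleR (- t) G) = exp (scaleR t G' + scaleR (- t) G)"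
  proof (rule exp_add_commuting[symmetric])
    have pL: "proj m * Lt x = Lt x * proj m" for x
      unfolding Lt_ker proj_ker ..
    have "G' * G = G * G'"
      unfolding G_def G'_def distrib_left distrib_right
      by (simp add: mult.assoc cs_left_commute[of "Lt _"] Lt_commute[of z] pL)
    then show "scaleR t G' * scaleR (- t) G = scaleR (- t) G * scaleR t G'"
      by simp
  qed
  moreover have "scaleR t G' + scaleR (- t) G = Lt (\<lambda>i. of_real t * (z i - 1))"
    unfolding Lt_scaleR[symmetric] Lt_diff by (simp add: G_def G'_def algebra_simps)
  ultimately show ?thesis
    by (simp add: Fz_def mult.assoc)
qed

end

section \<open>Commutator bounds\<close>

lemma sum_mult_le_mult_sum:
  fixes f g :: "'a \<Rightarrow> real"
  assumes "finite I" "\<And>i. i \<in> I \<Longrightarrow> 0 \<le> f i" "\<And>i. i \<in> I \<Longrightarrow> 0 \<le> g i"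
  shows "(\<Sum>i\<in>I. f i * g i) \<le> (\<Sum>i\<in>I. f i) * (\<Sum>i\<in>I. g i)"
proof -
  have "(\<Sum>i\<in>I. f i * g i) \<le> (\<Sum>i\<in>I. f i * (\<Sum>j\<in>I. g j))"
    using assms by (intro sum_mono mult_left_mono member_le_sum) auto
  then show ?thesis by (simp add: sum_distrib_right)
qed

lemma br_cs: "br (cs a * X) (cs b * Y) = cs (a * b) * br X Y"
proof -
  have "cs a * X * (cs b * Y) = cs (a * b) * (X * Y)"
    unfolding cs_mult by (simp add: mult.assoc cs_left_commute[of X])
  moreover have "cs b * Y * (cs a * X) = cs (a * b) * (Y * X)"
    unfolding cs_mult mult.commute[of a b] by (simp add: mult.assoc cs_left_commute[of Y] cs_left_commute[of "cs b"])
  ultimately show ?thesis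
    by (simp add: br_def right_diff_distrib)
qed

context torus_grid
begin

text \<open>Size of the frequency of \<open>z\<close>: at the k-th root of unity a summand is 2 N
  sin(pi k / N), comparable to the distance from \<open>k\<close> to the multiples of
  \<open>N\<close>.\<close>

definition mu :: "('d \<Rightarrow> complex) \<Rightarrow> real" where
  "mu z = (\<Sum>i\<in>UNIV. real N * cmod (z i - 1))"

lemma mu_nonneg: "0 \<le> mu z"
  by (simp add: mu_def sum_nonneg)

lemma norm_exp_Lt_diff: "norm (exp (Lt x) - exp (Lt y)) \<le> norm (Lt (\<lambda>i. x i - y i))"
  unfolding Lt_diff by (rule norm_exp_diff_le[OF skew_Lt skew_Lt])

text \<open>Since all \<open>Lt\<close> commute, the combination equals (e^a - e^b)(1 - e^(c-a)) +
  (e^d - e^(b+c-a)): a product of two first differences plus a term governed by the second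
  difference of the exponents.\<close>

lemma norm_exp_Lt_second_diff:
  "norm (exp (Lt a) - exp (Lt b) - exp (Lt c) + exp (Lt d))
    \<le> norm (Lt (\<lambda>i. a i - b i)) * norm (Lt (\<lambda>i. c i - a i)) + norm (Lt (\<lambda>i. a i - b i - c i + d i))"
proof -
  let ?e = "\<lambda>i. b i + (c i - a i)"
  have m: "exp (Lt a) * exp (Lt (\<lambda>i. c i - a i)) = exp (Lt c)" "exp (Lt b) * exp (Lt (\<lambda>i. c i - a i)) = exp (Lt ?e)"
    unfolding exp_Lt_add by simp_all
  have alg: "A - B - C + D = (A - B) * (1 - X) + (D - E)" if "A * X = C" "B * X = E" for A B C D E X :: op
    unfolding left_diff_distrib right_diff_distrib that by simp
  have z: "Lt (\<lambda>_. 0) = 0"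
    by (simp add: Lt_def cs_0)
  have neg: "Lt (\<lambda>i. 0 - (c i - a i)) = - Lt (\<lambda>i. c i - a i)"
    using Lt_diff[of "\<lambda>i. 0" "\<lambda>i. c i - a i"] unfolding z by (simp only: diff_0)
  have rest: "(\<lambda>i. d i - ?e i) = (\<lambda>i. a i - b i - c i + d i)"
    by (simp add: fun_eq_iff)
  have e: "exp (Lt a) - exp (Lt b) - exp (Lt c) + exp (Lt d)
      = (exp (Lt a) - exp (Lt b)) * (exp (Lt (\<lambda>_. 0)) - exp (Lt (\<lambda>i. c i - a i))) + (exp (Lt d) - exp (Lt ?e))"
    unfolding z exp_zero by (rule alg[OF m])
  show ?thesis
    unfolding e
    using norm_triangle_mono[OF norm_mult_le[OF norm_exp_Lt_diff[of a b] norm_exp_Lt_diff[of "\<lambda>_. 0" "\<lambda>i. c i - a i"]]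
        norm_exp_Lt_diff[of d ?e]]
    unfolding neg rest norm_minus_cancel .
qed

lemma Fz_mult:
  assumes "root_tuple w"
  shows "Fz z t * Fz w s = Ez z * Ez w * exp (Lt (\<lambda>i. of_real t * (z i - 1) * w i + of_real s * (w i - 1)))"
proof -
  have "Fz z t * Fz w s = Ez z * (exp (Lt (\<lambda>i. of_real t * (z i - 1))) * Ez w) * exp (Lt (\<lambda>i. of_real s * (w i - 1)))"
    by (simp add: Fz_def mult.assoc)
  also have "\<dots> = Ez z * Ez w * (exp (Lt (\<lambda>i. w i * (of_real t * (z i - 1)))) * exp (Lt (\<lambda>i. of_real s * (w i - 1))))"
    by (simp add: exp_Lt_Ez[OF assms] mult.assoc)
  finally show ?thesis
    by (simp add: exp_Lt_add mult_ac)
qed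

lemma Fz_mult3:
  assumes "root_tuple w" "root_tuple v"
  shows "Fz z r * (Fz w t * Fz v s) = Ez z * (Ez w * Ez v)
    * exp (Lt (\<lambda>i. of_real r * (z i - 1) * w i * v i + of_real t * (w i - 1) * v i + of_real s * (v i - 1)))"
proof -
  let ?x = "\<lambda>i. of_real t * (w i - 1) * v i + of_real s * (v i - 1)"
  have "Fz z r * (Fz w t * Fz v s) = Ez z * ((exp (Lt (\<lambda>i. of_real r * (z i - 1))) * Ez w) * Ez v) * exp (Lt ?x)"
    unfolding Fz_mult[OF assms(2)] by (simp add: Fz_def mult.assoc)
  also have "(exp (Lt (\<lambda>i. of_real r * (z i - 1))) * Ez w) * Ez v
      = Ez w * (exp (Lt (\<lambda>i. w i * (of_real r * (z i - 1)))) * Ez v)"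
    by (simp add: exp_Lt_Ez[OF assms(1)] mult.assoc)
  also have "\<dots> = Ez w * Ez v * exp (Lt (\<lambda>i. v i * (w i * (of_real r * (z i - 1)))))"
    by (simp add: exp_Lt_Ez[OF assms(2)] mult.assoc)
  also have "Ez z * (Ez w * Ez v * exp (Lt (\<lambda>i. v i * (w i * (of_real r * (z i - 1)))))) * exp (Lt ?x)
      = Ez z * (Ez w * Ez v) * exp (Lt (\<lambda>i. v i * (w i * (of_real r * (z i - 1))) + ?x i))"
    unfolding exp_Lt_add[symmetric] by (simp add: mult.assoc)
  also have "(\<lambda>i. v i * (w i * (of_real r * (z i - 1))) + ?x i) =
      (\<lambda>i. of_real r * (z i - 1) * w i * v i + of_real t * (w i - 1) * v i + of_real s * (v i - 1))"
    by (simp add: fun_eq_iff)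
  finally show ?thesis .
qed

lemma norm_Ez_mult: "root_tuple z \<Longrightarrow> norm (Ez z * X) \<le> norm X"
  by (rule norm_contraction_mult(1)[OF norm_Ez])

text \<open>The factor N^2 of \<open>norm_Lt\<close> is used up by the two differences, one
  \<open>N\<close> for each.\<close>

lemma norm_Lt_le2:
  assumes "\<And>i. cmod (x i) \<le> h * (cmod (z i - 1) * cmod (w i - 1))" "0 \<le> h"
  shows "norm (Lt x) \<le> h * \<kappa> * (mu z * mu w)"
proof -
  have "norm (Lt x) \<le> \<kappa> * (real N)\<^sup>2 * (\<Sum>i\<in>UNIV. h * (cmod (z i - 1) * cmod (w i - 1)))"
    by (rule order_trans[OF norm_Lt]) (intro mult_left_mono sum_mono assms, use \<kappa> in simp)
  also have "\<dots> = h * \<kappa> * (\<Sum>i\<in>UNIV. (real N * cmod (z i - 1)) * (real N * cmod (w i - 1)))"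
    unfolding sum_distrib_left by (rule sum.cong) (simp_all add: power2_eq_square)
  also have "\<dots> \<le> h * \<kappa> * (mu z * mu w)"
    unfolding mu_def by (intro mult_left_mono sum_mult_le_mult_sum) (use \<kappa> assms in auto)
  finally show ?thesis .
qed

text \<open>Both products carry the same plane wave, and their exponents differ by exactly (t - s)(z
  i - 1)(w i - 1).\<close>

lemma norm_br_Fz:
  assumes "root_tuple z" "root_tuple w"
  shows "norm (br (Fz z t) (Fz w s)) \<le> \<bar>t - s\<bar> * \<kappa> * (mu z * mu w)"
proof -
  let ?a = "\<lambda>i. of_real t * (z i - 1) * w i + of_real s * (w i - 1)"
  let ?b = "\<lambda>i. of_real s * (w i - 1) * z i + of_real t * (z i - 1)"
  have "br (Fz z t) (Fz w s) = Ez z * (Ez w * (exp (Lt ?a) - exp (Lt ?b)))"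
    unfolding br_def Fz_mult[OF assms(1)] Fz_mult[OF assms(2)] Ez_commute[of w z]
    by (simp add: right_diff_distrib mult.assoc)
  then have "norm (br (Fz z t) (Fz w s)) \<le> norm (exp (Lt ?a) - exp (Lt ?b))"
    by (simp add: order_trans[OF norm_Ez_mult[OF assms(1)] norm_Ez_mult[OF assms(2)]])
  also have "\<dots> \<le> norm (Lt (\<lambda>i. ?a i - ?b i))"
    by (rule norm_exp_Lt_diff)
  also have "\<dots> \<le> \<bar>t - s\<bar> * \<kappa> * (mu z * mu w)"
  proof (rule norm_Lt_le2)
    fix i
    have "?a i - ?b i = of_real (t - s) * ((z i - 1) * (w i - 1))"
      by (simp add: algebra_simps)
    then show "cmod (?a i - ?b i) \<le> \<bar>t - s\<bar> * (cmod (z i - 1) * cmod (w i - 1))"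
      by (simp only: norm_mult norm_of_real order_refl)
  qed simp
  finally show ?thesis .
qed

text \<open>The square is dictated by the double commutator, whose bound contains
  \<open>(mu w)\<^sup>2\<close> and \<open>(mu v)\<^sup>2\<close> but no higher power of any
  \<open>mu\<close>.\<close>

definition weight :: "('d \<Rightarrow> complex) \<Rightarrow> real" where
  "weight z = (1 + mu z)\<^sup>2"

lemma weight_ge: "1 \<le> weight z" "mu z \<le> weight z" "(mu z)\<^sup>2 \<le> weight z"
  using mu_nonneg[of z] zero_le_power2[of "mu z"] by (simp_all add: weight_def power2_eq_square algebra_simps)

text \<open>The third difference of the symbol of the discrete Laplacian is of size \<open>1 / N\<close>; this is where
  the condition \<open>1 / N \<le> \<Delta>t\<close> enters.\<close>

lemma norm_br_br_Fz:
  assumes z: "root_tuple z" and w: "root_tuple w" and v: "root_tuple v"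
    and h: "1 / real N \<le> h" "\<bar>r - t\<bar> \<le> h" "\<bar>r - s\<bar> \<le> h" "\<bar>t - s\<bar> \<le> h"
  shows "norm (br (Fz z r) (br (Fz w t) (Fz v s))) \<le> h\<^sup>2 * (2 * \<kappa>\<^sup>2 + \<kappa>) * (weight z * weight w * weight v)"
proof -
  have h0: "0 \<le> h" using h by linarith
  \<comment> \<open>Exponents of the four orderings zwv, zvw, wvz, vwz; the four products share one
    plane-wave factor.\<close>
  let ?a = "\<lambda>i. of_real r * (z i - 1) * w i * v i + of_real t * (w i - 1) * v i + of_real s * (v i - 1)"
  let ?b = "\<lambda>i. of_real r * (z i - 1) * v i * w i + of_real s * (v i - 1) * w i + of_real t * (w i - 1)"
  let ?c = "\<lambda>i. of_real t * (w i - 1) * v i * z i + of_real s * (v i - 1) * z i + of_real r * (z i - 1)"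
  let ?d = "\<lambda>i. of_real s * (v i - 1) * w i * z i + of_real t * (w i - 1) * z i + of_real r * (z i - 1)"
  have br3: "br (Fz z r) (br (Fz w t) (Fz v s)) = Fz z r * (Fz w t * Fz v s) - Fz z r * (Fz v s * Fz w t)
      - Fz w t * (Fz v s * Fz z r) + Fz v s * (Fz w t * Fz z r)"
    by (simp add: br_def algebra_simps)
  have factor: "br (Fz z r) (br (Fz w t) (Fz v s)) = Ez z * (Ez w * (Ez v * (exp (Lt ?a) - exp (Lt ?b) - exp (Lt ?c) + exp (Lt ?d))))"
  proof -
    have e: "Ez z * (Ez v * Ez w) = Ez z * (Ez w * Ez v)" "Ez w * (Ez v * Ez z) = Ez z * (Ez w * Ez v)"
      "Ez v * (Ez w * Ez z) = Ez z * (Ez w * Ez v)"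
      by (metis Ez_commute mult.assoc)+
    show ?thesis
      unfolding br3 Fz_mult3[OF w v] Fz_mult3[OF v w] Fz_mult3[OF v z] Fz_mult3[OF w z] e
      by (simp only: right_diff_distrib distrib_left mult.assoc)
  qed
  have "norm (br (Fz z r) (br (Fz w t) (Fz v s))) \<le> norm (exp (Lt ?a) - exp (Lt ?b) - exp (Lt ?c) + exp (Lt ?d))"
    unfolding factor
    by (rule order_trans[OF norm_Ez_mult[OF z] order_trans[OF norm_Ez_mult[OF w] norm_Ez_mult[OF v]]])
  also have "\<dots> \<le> norm (Lt (\<lambda>i. ?a i - ?b i)) * norm (Lt (\<lambda>i. ?c i - ?a i)) + norm (Lt (\<lambda>i. ?a i - ?b i - ?c i + ?d i))"
    by (rule norm_exp_Lt_second_diff)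
  also have "\<dots> \<le> (h * \<kappa> * (mu w * mu v)) * (h * \<kappa> * (mu z * mu w) + h * \<kappa> * (mu z * mu v))
      + h * h * \<kappa> * (mu w * mu v * mu z)"
  proof (intro add_mono mult_mono)
    show "norm (Lt (\<lambda>i. ?a i - ?b i)) \<le> h * \<kappa> * (mu w * mu v)"
    proof (rule norm_Lt_le2[OF _ h0])
      fix i
      have "?a i - ?b i = of_real (t - s) * ((w i - 1) * (v i - 1))"
        by (simp add: algebra_simps)
      then show "cmod (?a i - ?b i) \<le> h * (cmod (w i - 1) * cmod (v i - 1))"
        using h by (simp only: norm_mult norm_of_real) (simp add: mult_right_mono)
    qed
    have ca: "(\<lambda>i. ?c i - ?a i) = (\<lambda>i. of_real (t - r) * ((z i - 1) * (w i - 1)) * v i + of_real (s - r) * ((z i - 1) * (v i - 1)))"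
      by (simp add: fun_eq_iff algebra_simps)
    show "norm (Lt (\<lambda>i. ?c i - ?a i)) \<le> h * \<kappa> * (mu z * mu w) + h * \<kappa> * (mu z * mu v)"
      unfolding ca Lt_add
    proof (rule norm_triangle_mono; rule norm_Lt_le2[OF _ h0])
      fix i
      show "cmod (of_real (t - r) * ((z i - 1) * (w i - 1)) * v i) \<le> h * (cmod (z i - 1) * cmod (w i - 1))"
        using h unfolding norm_mult norm_of_real cmod_root_tuple[OF v] by (simp add: mult_right_mono abs_minus_commute)
      show "cmod (of_real (s - r) * ((z i - 1) * (v i - 1))) \<le> h * (cmod (z i - 1) * cmod (v i - 1))"
        using h unfolding norm_mult norm_of_real by (simp add: mult_right_mono abs_minus_commute)
    qed
    have "norm (Lt (\<lambda>i. ?a i - ?b i - ?c i + ?d i)) \<le> (h * (h * mu z)) * \<kappa> * (mu w * mu v)"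
    proof (rule norm_Lt_le2)
      fix i
      have "?a i - ?b i - ?c i + ?d i = of_real (t - s) * ((w i - 1) * (v i - 1)) * - (z i - 1)"
        by (simp add: algebra_simps)
      then have "cmod (?a i - ?b i - ?c i + ?d i) = \<bar>t - s\<bar> * (cmod (w i - 1) * cmod (v i - 1)) * cmod (z i - 1)"
        by (simp only: norm_mult norm_of_real norm_minus_cancel)
      also have "\<dots> \<le> h * (cmod (w i - 1) * cmod (v i - 1)) * (h * mu z)"
      proof (intro mult_mono)
        \<comment> \<open>No \<open>N\<close> is left over for this third difference; it is supplied
          as 1 / N times N, and 1 / N is at most \<open>h\<close>.\<close>
        have "cmod (z i - 1) = 1 / real N * (real N * cmod (z i - 1))"
          using N by simp
        also have "\<dots> \<le> h * mu z"
          unfolding mu_def by (intro mult_mono h member_le_sum[where f = "\<lambda>i. real N * cmod (z i - 1)"] h0) auto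
        finally show "cmod (z i - 1) \<le> h * mu z" .
      qed (use h h0 in auto)
      finally show "cmod (?a i - ?b i - ?c i + ?d i) \<le> (h * (h * mu z)) * (cmod (w i - 1) * cmod (v i - 1))"
        by (simp add: mult_ac)
    qed (simp add: h0 mu_nonneg)
    then show "norm (Lt (\<lambda>i. ?a i - ?b i - ?c i + ?d i)) \<le> h * h * \<kappa> * (mu w * mu v * mu z)"
      by (simp add: mult_ac)
  qed (use h0 \<kappa> mu_nonneg in auto)
  also have "\<dots> = h\<^sup>2 * (\<kappa>\<^sup>2 * (mu z * (mu w)\<^sup>2 * mu v) + \<kappa>\<^sup>2 * (mu z * mu w * (mu v)\<^sup>2) + \<kappa> * (mu z * mu w * mu v))"
    by (simp add: algebra_simps power2_eq_square)
  also have "\<dots> \<le> h\<^sup>2 * (\<kappa>\<^sup>2 * (weight z * weight w * weight v) + \<kappa>\<^sup>2 * (weight z * weight w * weight v) + \<kappa> * (weight z * weight w * weight v))"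
    by (intro mult_left_mono add_mono mult_mono weight_ge) (auto simp: \<kappa> mu_nonneg weight_def)
  finally show ?thesis
    by (simp add: algebra_simps)
qed

section \<open>Commutators of sums over frequencies\<close>

lemma norm_Fz_sum:
  assumes "finite I" "\<And>k. k \<in> I \<Longrightarrow> root_tuple (z k)"
  shows "norm (\<Sum>k\<in>I. cs (v k) * Fz (z k) t) \<le> (\<Sum>k\<in>I. cmod (v k) * weight (z k))"
proof (rule order_trans[OF norm_sum sum_mono])
  fix k assume "k \<in> I"
  then have "norm (Fz (z k) t) \<le> weight (z k)"
    using norm_Fz[OF assms(2)] weight_ge(1) order_trans by blast
  then show "norm (cs (v k) * Fz (z k) t) \<le> cmod (v k) * weight (z k)"
    by (meson norm_cs_mult_le mult_left_mono norm_ge_zero order_trans)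
qed

lemma norm_br_Fz_sum:
  fixes v :: "'k \<Rightarrow> complex" and z :: "'k \<Rightarrow> 'd \<Rightarrow> complex" and I :: "'k set"
  assumes "finite I" "\<And>k. k \<in> I \<Longrightarrow> root_tuple (z k)"
  defines "Q \<equiv> \<Sum>k\<in>I. cmod (v k) * weight (z k)"
  shows "norm (br (\<Sum>k\<in>I. cs (v k) * Fz (z k) t) (\<Sum>k\<in>I. cs (v k) * Fz (z k) s)) \<le> \<bar>t - s\<bar> * \<kappa> * Q\<^sup>2"
proof -
  have "norm (br (\<Sum>k\<in>I. cs (v k) * Fz (z k) t) (\<Sum>k\<in>I. cs (v k) * Fz (z k) s))
      \<le> (\<Sum>k\<in>I. \<Sum>l\<in>I. \<bar>t - s\<bar> * \<kappa> * ((cmod (v k) * weight (z k)) * (cmod (v l) * weight (z l))))"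
    unfolding br_sum br_cs
  proof (subst sum.swap, intro order_trans[OF norm_sum sum_mono])
    fix k l assume kl: "k \<in> I" "l \<in> I"
    have "norm (cs (v k * v l) * br (Fz (z k) t) (Fz (z l) s)) \<le> cmod (v k * v l) * (\<bar>t - s\<bar> * \<kappa> * (weight (z k) * weight (z l)))"
    proof (rule order_trans[OF norm_cs_mult_le mult_left_mono])
      show "norm (br (Fz (z k) t) (Fz (z l) s)) \<le> \<bar>t - s\<bar> * \<kappa> * (weight (z k) * weight (z l))"
        by (rule order_trans[OF norm_br_Fz[OF assms(2)[OF kl(1)] assms(2)[OF kl(2)]]])
          (intro mult_left_mono mult_mono weight_ge, use \<kappa> mu_nonneg in \<open>auto simp: weight_def\<close>)
    qed simp
    then show "norm (cs (v k * v l) * br (Fz (z k) t) (Fz (z l) s))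
        \<le> \<bar>t - s\<bar> * \<kappa> * ((cmod (v k) * weight (z k)) * (cmod (v l) * weight (z l)))"
      by (simp add: norm_mult mult_ac)
  qed
  also have "\<dots> = \<bar>t - s\<bar> * \<kappa> * Q\<^sup>2"
    by (simp only: Q_def power2_eq_square sum_product) (simp only: sum_distrib_left)
  finally show ?thesis .
qed

lemma norm_br_br_Fz_sum:
  fixes v :: "'k \<Rightarrow> complex" and z :: "'k \<Rightarrow> 'd \<Rightarrow> complex" and I :: "'k set"
  assumes "finite I" "\<And>k. k \<in> I \<Longrightarrow> root_tuple (z k)"
    and h: "1 / real N \<le> h" "\<bar>r - t\<bar> \<le> h" "\<bar>r - s\<bar> \<le> h" "\<bar>t - s\<bar> \<le> h"
  defines "Q \<equiv> \<Sum>k\<in>I. cmod (v k) * weight (z k)"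
  shows "norm (br (\<Sum>k\<in>I. cs (v k) * Fz (z k) r)
      (br (\<Sum>k\<in>I. cs (v k) * Fz (z k) t) (\<Sum>k\<in>I. cs (v k) * Fz (z k) s))) \<le> h\<^sup>2 * (2 * \<kappa>\<^sup>2 + \<kappa>) * Q ^ 3"
proof -
  let ?w = "\<lambda>k. cmod (v k) * weight (z k)" and ?C = "h\<^sup>2 * (2 * \<kappa>\<^sup>2 + \<kappa>)"
  have expand: "br (\<Sum>k\<in>I. cs (v k) * Fz (z k) r)
      (br (\<Sum>k\<in>I. cs (v k) * Fz (z k) t) (\<Sum>k\<in>I. cs (v k) * Fz (z k) s))
      = (\<Sum>l\<in>I. \<Sum>k\<in>I. \<Sum>j\<in>I. cs (v j * (v k * v l)) * br (Fz (z j) r) (br (Fz (z k) t) (Fz (z l) s)))"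
    unfolding br_sum br_cs ..
  have "norm (br (\<Sum>k\<in>I. cs (v k) * Fz (z k) r)
      (br (\<Sum>k\<in>I. cs (v k) * Fz (z k) t) (\<Sum>k\<in>I. cs (v k) * Fz (z k) s)))
      \<le> (\<Sum>l\<in>I. \<Sum>k\<in>I. \<Sum>j\<in>I. ?C * (?w j * ?w k * ?w l))"
    unfolding expand
  proof (intro order_trans[OF norm_sum sum_mono])
    fix j k l assume jkl: "j \<in> I" "k \<in> I" "l \<in> I"
    have "norm (cs (v j * (v k * v l)) * br (Fz (z j) r) (br (Fz (z k) t) (Fz (z l) s)))
        \<le> cmod (v j * (v k * v l)) * (?C * (weight (z j) * weight (z k) * weight (z l)))"
      by (intro order_trans[OF norm_cs_mult_le mult_left_mono] norm_br_br_Fz assms jkl) simp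
    then show "norm (cs (v j * (v k * v l)) * br (Fz (z j) r) (br (Fz (z k) t) (Fz (z l) s)))
        \<le> ?C * (?w j * ?w k * ?w l)"
      by (simp add: norm_mult mult_ac)
  qed
  also have "\<dots> = ?C * (\<Sum>l\<in>I. \<Sum>k\<in>I. \<Sum>j\<in>I. ?w j * ?w k * ?w l)"
    by (simp only: sum_distrib_left)
  also have "(\<Sum>l\<in>I. \<Sum>k\<in>I. \<Sum>j\<in>I. ?w j * ?w k * ?w l) = Q ^ 3"
    unfolding Q_def power3_eq_cube by (simp only: sum_distrib_left[symmetric] sum_distrib_right[symmetric])
  finally show ?thesis .
qed

end

section \<open>Finite differences and roots of unity\<close>

definition fdiff :: "real \<Rightarrow> 'd::finite \<Rightarrow> (real^'d \<Rightarrow> real) \<Rightarrow> real^'d \<Rightarrow> real" where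
  "fdiff \<epsilon> i f x = f (x + axis i \<epsilon>) - f x"

lemma S1_differentiable: "symbol_class_S1 f \<Longrightarrow> foldr partial_deriv js f differentiable at x"
  by (auto simp: symbol_class_S1_def differentiable_on_def)

lemma S1_partial_deriv: "symbol_class_S1 f \<Longrightarrow> symbol_class_S1 (partial_deriv i f)"
  unfolding symbol_class_S1_def
proof (intro allI)
  fix js
  assume "\<forall>js. foldr partial_deriv js f differentiable_on UNIV \<and> bounded (range (foldr partial_deriv js f))"
  from this[rule_format, of "js @ [i]"]
  show "foldr partial_deriv js (partial_deriv i f) differentiable_on UNIV
      \<and> bounded (range (foldr partial_deriv js (partial_deriv i f)))"
    by simp
qed

lemma S1_bounded:
  assumes "symbol_class_S1 f"
  obtains B where "0 \<le> B" "\<And>x. \<bar>foldr partial_deriv js f x\<bar> \<le> B"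
proof -
  have "bounded (range (foldr partial_deriv js f))"
    using assms by (simp add: symbol_class_S1_def)
  then obtain B where "\<And>x. \<bar>foldr partial_deriv js f x\<bar> \<le> B"
    unfolding bounded_iff by auto
  moreover from this[of undefined] have "0 \<le> B" by linarith
  ultimately show ?thesis using that by blast
qed

lemma partial_deriv_fdiff:
  assumes "\<And>x. f differentiable at x"
  shows "partial_deriv i (fdiff \<epsilon> j f) = fdiff \<epsilon> j (partial_deriv i f)" and "fdiff \<epsilon> j f differentiable at x"
proof -
  have D: "(f has_derivative frechet_derivative f (at y)) (at y)" for y
    using assms frechet_derivative_works by blast
  have S: "((\<lambda>x. f (x + v)) has_derivative frechet_derivative f (at (x + v))) (at x)" for x v
  proof -
    have "((\<lambda>x. x + v) has_derivative (\<lambda>h. h)) (at x)"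
      by (auto intro!: derivative_eq_intros)
    from has_derivative_compose[OF this D] show ?thesis .
  qed
  have FD: "(fdiff \<epsilon> j f has_derivative
      (\<lambda>h. frechet_derivative f (at (x + axis j \<epsilon>)) h - frechet_derivative f (at x) h)) (at x)" for x
    unfolding fdiff_def[abs_def] by (intro has_derivative_diff S D)
  then show "fdiff \<epsilon> j f differentiable at x"
    unfolding differentiable_def by blast
  show "partial_deriv i (fdiff \<epsilon> j f) = fdiff \<epsilon> j (partial_deriv i f)"
    by (rule ext) (simp add: partial_deriv_def fdiff_def[of _ _ "partial_deriv i f"] frechet_derivative_at[OF FD, symmetric])
qed

lemma foldr_partial_deriv_fdiff:
  assumes "symbol_class_S1 f"
  shows "foldr partial_deriv js (fdiff \<epsilon> j f) = fdiff \<epsilon> j (foldr partial_deriv js f)"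
  by (induction js) (simp_all add: partial_deriv_fdiff S1_differentiable[OF assms])

lemma S1_fdiff:
  assumes "symbol_class_S1 f"
  shows "symbol_class_S1 (fdiff \<epsilon> j f)"
  unfolding symbol_class_S1_def
proof (intro allI conjI)
  fix js
  show "foldr partial_deriv js (fdiff \<epsilon> j f) differentiable_on UNIV"
    unfolding foldr_partial_deriv_fdiff[OF assms] differentiable_on_def
    by (auto intro: partial_deriv_fdiff(2) S1_differentiable[OF assms])
  obtain B where B: "\<And>x. \<bar>foldr partial_deriv js f x\<bar> \<le> B"
    using S1_bounded[OF assms] by blast
  have "\<bar>fdiff \<epsilon> j (foldr partial_deriv js f) x\<bar> \<le> B + B" for x
    unfolding fdiff_def by (rule order_trans[OF abs_triangle_ineq4 add_mono[OF B B]])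
  then show "bounded (range (foldr partial_deriv js (fdiff \<epsilon> j f)))"
    unfolding foldr_partial_deriv_fdiff[OF assms] bounded_iff by auto
qed

lemma fdiff_bound:
  fixes f :: "real^'d::finite \<Rightarrow> real"
  assumes f: "\<And>x. f differentiable at x" and B: "\<And>x. \<bar>partial_deriv i f x\<bar> \<le> B" and e: "0 \<le> \<epsilon>"
  shows "\<bar>fdiff \<epsilon> i f x\<bar> \<le> \<epsilon> * B"
proof -
  let ?g = "\<lambda>t. x + scaleR t (axis i (1::real))"
  have ax: "scaleR t (axis i (1::real)) = axis i t" for t
    by (simp add: Finite_Cartesian_Product.vec_eq_iff axis_def)
  have a0: "axis i (0::real) = 0"
    using ax[of 0] by simp
  have "norm (f (?g \<epsilon>) - f (?g 0)) \<le> B * (\<epsilon> - 0)"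
  proof (rule norm_increment_le[where f = "\<lambda>t. f (?g t)" and f' = "\<lambda>t. partial_deriv i f (?g t)", OF e])
    fix t
    have "(?g has_derivative (\<lambda>h. scaleR h (axis i 1))) (at t within {0..\<epsilon>})"
      by (auto intro!: derivative_eq_intros)
    moreover have D: "(f has_derivative frechet_derivative f (at (?g t))) (at (?g t))"
      using f frechet_derivative_works by blast
    ultimately have "((\<lambda>t. f (?g t)) has_derivative (\<lambda>h. frechet_derivative f (at (?g t)) (scaleR h (axis i 1)))) (at t within {0..\<epsilon>})"
      by (rule has_derivative_compose)
    then show "((\<lambda>t. f (?g t)) has_vector_derivative partial_deriv i f (?g t)) (at t within {0..\<epsilon>})"
      using linear_scale[OF has_derivative_linear[OF D]]
      by (simp add: has_vector_derivative_def partial_deriv_def)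
    show "norm (partial_deriv i f (?g t)) \<le> B"
      using B by simp
  qed
  then show ?thesis
    by (simp add: fdiff_def ax a0 mult.commute)
qed

text \<open>Each step uses the mean value inequality and then moves the partial derivative inside
  the remaining differences. Derivatives thus reach \<open>f\<close> in reverse order, hence
  \<open>rev is\<close>; mixed partials are never interchanged.\<close>

lemma iterated_fdiff_bound:
  assumes "symbol_class_S1 f" "\<And>x. \<bar>foldr partial_deriv (rev is) f x\<bar> \<le> B" "0 \<le> \<epsilon>"
  shows "\<bar>foldr (fdiff \<epsilon>) is f x\<bar> \<le> \<epsilon> ^ length is * B"
  using assms
proof (induction "is" arbitrary: f x)
  case (Cons i "is")
  let ?g = "foldr (fdiff \<epsilon>) is f"
  have S1: "symbol_class_S1 (foldr (fdiff \<epsilon>) js f)" for js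
    by (induction js) (simp_all add: Cons.prems S1_fdiff)
  have comm: "partial_deriv i (foldr (fdiff \<epsilon>) js f) = foldr (fdiff \<epsilon>) js (partial_deriv i f)" for js
  proof (induction js)
    case (Cons j js)
    then show ?case
      using partial_deriv_fdiff(1)[of "foldr (fdiff \<epsilon>) js f" i \<epsilon> j] S1_differentiable[OF S1[of js], of "[]"] by simp
  qed simp
  have "\<bar>fdiff \<epsilon> i ?g x\<bar> \<le> \<epsilon> * (\<epsilon> ^ length is * B)"
  proof (rule fdiff_bound)
    show "?g differentiable at y" for y
      using S1_differentiable[OF S1, of "[]"] by simp
    show "\<bar>partial_deriv i ?g y\<bar> \<le> \<epsilon> ^ length is * B" for y
      unfolding comm
    proof (rule Cons.IH[OF S1_partial_deriv[OF Cons.prems(1)] _ Cons.prems(3)])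
      show "\<bar>foldr partial_deriv (rev is) (partial_deriv i f) x\<bar> \<le> B" for x
        using Cons.prems(2)[of x] by simp
    qed
  qed fact
  then show ?case by simp
qed simp

text \<open>For y at most 2 the Maclaurin bound y - y^3 / 6 is at least y - 4 y / 6. The crude 1/3
  suffices in \<open>zeta_dist_ge\<close> because pi exceeds 3.\<close>

lemma sin_ge_third:
  fixes y :: real
  assumes "0 \<le> y" "y \<le> pi / 2"
  shows "y / 3 \<le> sin y"
proof -
  have f3: "inverse (fact 3) * \<bar>y\<bar> ^ 3 = y ^ 3 / 6"
    using assms(1) by (simp add: fact_numeral)
  have "\<bar>sin y - (\<Sum>m<3. sin_coeff m * y ^ m)\<bar> \<le> y ^ 3 / 6"
    using Maclaurin_sin_bound[of y 3] unfolding f3 .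
  moreover have "(\<Sum>m<3. sin_coeff m * y ^ m) = y"
    by (simp add: numeral_3_eq_3 sin_coeff_def)
  ultimately have "\<bar>sin y - y\<bar> \<le> y ^ 3 / 6"
    by simp
  moreover have "y ^ 3 \<le> y * 4"
  proof -
    have "y \<le> 2" using assms(2) pi_less_4 by linarith
    then have "y * y \<le> 2 * 2" using assms(1) by (intro mult_mono) auto
    then have "y * (y * y) \<le> y * 4" using assms(1) by (intro mult_left_mono) auto
    then show ?thesis by (simp add: power3_eq_cube mult.assoc)
  qed
  ultimately show ?thesis by linarith
qed

section \<open>Roots of unity and their distance from 1\<close>

definition zeta :: "nat \<Rightarrow> nat \<Rightarrow> complex" where
  "zeta N g = cis (2 * pi * real g / real N)"

lemma zeta_power_eq_1: "0 < N \<Longrightarrow> zeta N g ^ N = 1"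
  unfolding zeta_def Complex.DeMoivre by (simp add: cis_multiple_2pi)

lemma zeta_mult_cnj: "zeta N g * cnj (zeta N g) = 1"
  by (simp add: zeta_def cis_cnj cis_mult)

lemma zeta_eq_power: "zeta N g = zeta N 1 ^ g"
  unfolding zeta_def Complex.DeMoivre by (simp add: mult_ac)

lemma zeta_inject: "a < N \<Longrightarrow> b < N \<Longrightarrow> zeta N a = zeta N b \<Longrightarrow> a = b"
  using inj_onD[OF bij_betw_imp_inj_on[OF Complex.bij_betw_roots_unity[of N]], of a b] by (simp add: zeta_def)

lemma zeta_orthogonality:
  assumes "a < N" "b < N"
  shows "(\<Sum>g<N. zeta N g ^ a * cnj (zeta N g) ^ b) = (if a = b then of_nat N else 0)"
proof (cases "a = b")
  case True
  have "zeta N g ^ a * cnj (zeta N g) ^ a = 1" for g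
    by (simp add: power_mult_distrib[symmetric] zeta_mult_cnj)
  then show ?thesis using True by simp
next
  case False
  define w where "w = zeta N 1 ^ a * cnj (zeta N 1) ^ b"
  have "w \<noteq> 1"
  proof
    assume "w = 1"
    then have "zeta N 1 ^ a * (cnj (zeta N 1) ^ b * zeta N 1 ^ b) = zeta N 1 ^ b"
      by (simp add: w_def mult.assoc[symmetric])
    then have "zeta N 1 ^ a = zeta N 1 ^ b"
      by (simp add: power_mult_distrib[symmetric] zeta_mult_cnj mult.commute)
    then show False
      using zeta_inject[OF assms] False zeta_eq_power[of N a] zeta_eq_power[of N b] by metis
  qed
  moreover have "w ^ N = 1"
  proof -
    have "w ^ N = (zeta N 1 ^ N) ^ a * cnj (zeta N 1 ^ N) ^ b"
      by (simp add: w_def power_mult_distrib power_mult[symmetric] mult.commute del: One_nat_def)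
    moreover have "zeta N 1 ^ N = 1"
      using zeta_power_eq_1[of N 1] assms by simp
    ultimately show ?thesis
      by (simp only: complex_cnj_one power_one mult_1)
  qed
  moreover have "zeta N g ^ a * cnj (zeta N g) ^ b = w ^ g" for g
    by (simp add: zeta_eq_power[of N g] w_def power_mult_distrib power_mult[symmetric] mult.commute)
  ultimately show ?thesis
    using False by (simp add: geometric_sum)
qed

text \<open>The distance from 1 is 2 sin y with y = pi g / N. \<open>sin_ge_third\<close> applies to
  y up to pi / 2 and to the reflected angle pi - y beyond.\<close>

lemma zeta_dist_ge:
  assumes "g < N"
  shows "real (min g (N - g)) \<le> real N * cmod (zeta N g - 1)"
proof -
  define y where "y = pi * real g / real N"
  have N: "0 < real N" using assms by simp
  have y: "0 \<le> y" "y \<le> pi"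
    using assms by (simp_all add: y_def field_simps)
  have "(cmod (cis (2 * y) - 1))\<^sup>2 = (cos (2 * y) - 1)\<^sup>2 + (sin (2 * y))\<^sup>2"
    by (simp add: cmod_power2)
  also have "\<dots> = (2 * sin y)\<^sup>2 * ((sin y)\<^sup>2 + (cos y)\<^sup>2)"
    proof -
    have "(1 - 2 * s\<^sup>2 - 1)\<^sup>2 + (2 * s * c)\<^sup>2 = (2 * s)\<^sup>2 * (s\<^sup>2 + c\<^sup>2)" for s c :: real
      by (simp add: power2_eq_square algebra_simps)
    then show ?thesis
      unfolding cos_double_sin sin_double .
  qed
  finally have "(cmod (cis (2 * y) - 1))\<^sup>2 = (2 * sin y)\<^sup>2" by simp
  then have "cmod (cis (2 * y) - 1) = 2 * sin y"
    by (rule power2_eq_imp_eq) (use sin_ge_zero[OF y] in simp_all)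
  then have d: "cmod (zeta N g - 1) = 2 * sin y"
    by (simp add: zeta_def y_def mult.assoc)
  have pi1: "1 \<le> 2 / 3 * pi" using pi_gt3 by simp
  show ?thesis
  proof (cases "y \<le> pi / 2")
    case True
    have "real g \<le> 2 / 3 * pi * real g" using pi1 mult_right_mono[of 1 "2 / 3 * pi" "real g"] by simp
    also have "\<dots> = real N * (2 / 3 * y)" using N by (simp add: y_def)
    also have "\<dots> \<le> real N * (2 * sin y)"
      using sin_ge_third[OF y(1) True] N by (intro mult_left_mono) auto
    finally show ?thesis unfolding d by (simp add: min_def)
  next
    case False
    have "real (N - g) \<le> 2 / 3 * pi * real (N - g)" using pi1 mult_right_mono[of 1 "2 / 3 * pi" "real (N - g)"] by simp
    also have "\<dots> = real N * (2 / 3 * (pi - y))" using N assms by (simp add: y_def of_nat_diff field_simps)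
    also have "\<dots> \<le> real N * (2 * sin y)"
      using sin_ge_third[of "pi - y"] False y N by (intro mult_left_mono) auto
    finally show ?thesis unfolding d by (simp add: min_def)
  qed
qed

text \<open>Telescoping: 1 / (k + 2)^2 is at most 1 / (k + 1) - 1 / (k + 2).\<close>

lemma sum_inverse_squares_le: "(\<Sum>g<n. 1 / (1 + real g)\<^sup>2) \<le> 2"
proof -
  have "(\<Sum>g<Suc k. 1 / (1 + real g)\<^sup>2) \<le> 2 - 1 / (real k + 1)" for k
  proof (induction k)
    case (Suc k)
    have "1 / (1 + real (Suc k))\<^sup>2 \<le> 1 / ((real k + 1) * (real k + 2))"
      by (rule frac_le[OF _ _ mult_pos_pos]) (auto simp: power2_eq_square algebra_simps)
    also have "\<dots> = 1 / (real k + 1) - 1 / (real (Suc k) + 1)"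
      by (simp add: field_simps)
    finally show ?case using Suc by simp
  qed simp
  from this[of "n - 1"] have "(\<Sum>g<Suc (n - 1). 1 / (1 + real g)\<^sup>2) \<le> 2"
    by (rule order_trans) simp
  then show ?thesis
    by (cases n) auto
qed

lemma sum_zeta_weight_le: "(\<Sum>g<N. 1 / (1 + real N * cmod (zeta N g - 1))\<^sup>2) \<le> 4"
proof -
  \<comment> \<open>Indices near \<open>N\<close> are as low in frequency as those near 0, so two
    series of inverse squares are needed. \<open>N - Suc g\<close> instead of \<open>N - g\<close>
    makes the reflection a bijection of the index range.\<close>
  have "(\<Sum>g<N. 1 / (1 + real N * cmod (zeta N g - 1))\<^sup>2)
      \<le> (\<Sum>g<N. 1 / (1 + real g)\<^sup>2 + 1 / (1 + real (N - Suc g))\<^sup>2)"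
  proof (rule sum_mono)
    fix g assume "g \<in> {..<N}"
    then have g: "g < N" by simp
    have le: "1 / (1 + real N * cmod (zeta N g - 1))\<^sup>2 \<le> 1 / (1 + real k)\<^sup>2" if "k \<le> min g (N - g)" for k
    proof -
      have "real k \<le> real (min g (N - g))" using that by (simp only: of_nat_le_iff)
      then have "1 + real k \<le> 1 + real N * cmod (zeta N g - 1)"
        using zeta_dist_ge[OF g] by linarith
      then have "(1 + real k)\<^sup>2 \<le> (1 + real N * cmod (zeta N g - 1))\<^sup>2"
        by (rule power_mono) simp
      moreover have "0 < (1 + real k)\<^sup>2"
        by (rule zero_less_power) linarith
      ultimately show ?thesis
        by (intro frac_le) simp_all
    qed
    show "1 / (1 + real N * cmod (zeta N g - 1))\<^sup>2 \<le> 1 / (1 + real g)\<^sup>2 + 1 / (1 + real (N - Suc g))\<^sup>2"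
    proof (cases "g \<le> N - g")
      case True
      then show ?thesis using le[of g] by (simp add: add_increasing2)
    next
      case False
      then show ?thesis using le[of "N - Suc g"] by (simp add: add_increasing)
    qed
  qed
  also have "\<dots> = (\<Sum>g<N. 1 / (1 + real g)\<^sup>2) + (\<Sum>g<N. 1 / (1 + real g)\<^sup>2)"
    unfolding sum.distrib sum.nat_diff_reindex[of "\<lambda>g. 1 / (1 + real g)\<^sup>2"] ..
  also have "\<dots> \<le> 4"
    using sum_inverse_squares_le[of N] by simp
  finally show ?thesis .
qed

section \<open>Decay of the discrete Fourier coefficients\<close>

lemma one_plus_sum_le_prod:
  fixes f :: "'a \<Rightarrow> real"
  assumes "finite I" "\<And>i. i \<in> I \<Longrightarrow> 0 \<le> f i"
  shows "1 + (\<Sum>i\<in>I. f i) \<le> (\<Prod>i\<in>I. 1 + f i)"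
  using assms
proof (induction I rule: finite_induct)
  case (insert j I)
  have s: "0 \<le> (\<Sum>i\<in>I. f i)" by (rule sum_nonneg) (use insert in auto)
  have "1 + (f j + (\<Sum>i\<in>I. f i)) \<le> (1 + f j) * (1 + (\<Sum>i\<in>I. f i))"
    using insert.prems[of j] s by (simp add: algebra_simps)
  also have "\<dots> \<le> (1 + f j) * (\<Prod>i\<in>I. 1 + f i)"
    using insert by (intro mult_left_mono) auto
  finally show ?case using insert by simp
qed simp

text \<open>Directions in which differences are taken. Of the four inverse powers gained per
  coordinate, two pay for \<open>weight\<close> and two make the sum over frequencies bounded
  uniformly in \<open>N\<close>.\<close>

definition fourfold_list :: "'a set \<Rightarrow> 'a list" where
  "fourfold_list I = concat (map (replicate 4) (SOME xs. set xs = I \<and> distinct xs))"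

lemma prod_list_fourfold:
  fixes f :: "'a \<Rightarrow> 'b::comm_monoid_mult"
  assumes "finite I"
  shows "prod_list (map f (fourfold_list I)) = (\<Prod>i\<in>I. f i ^ 4)"
proof -
  define xs where "xs = (SOME xs. set xs = I \<and> distinct xs)"
  have xs: "set xs = I \<and> distinct xs"
    unfolding xs_def by (rule someI_ex[OF finite_distinct_list[OF assms]])
  have "prod_list (map f (concat (map (replicate 4) ys))) = prod_list (map (\<lambda>i. f i ^ 4) ys)" for ys
    by (induction ys) (simp_all add: prod_list_replicate)
  then show ?thesis
    unfolding fourfold_list_def xs_def[symmetric] using xs by (simp add: prod.distinct_set_conv_list[symmetric])
qed

context torus_grid
begin

section \<open>The discrete Fourier transform on the grid\<close>

definition phase :: "('d \<Rightarrow> complex) \<Rightarrow> nat \<Rightarrow> complex" where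
  "phase z p = (\<Prod>i\<in>UNIV. z i ^ dg N p i)"

definition zk :: "('d \<Rightarrow> nat) \<Rightarrow> 'd \<Rightarrow> complex" where
  "zk k i = zeta N (k i)"

definition freqs :: "('d \<Rightarrow> nat) set" where
  "freqs = PiE UNIV (\<lambda>_. {..<N})"

definition dft :: "(nat \<Rightarrow> real) \<Rightarrow> ('d \<Rightarrow> nat) \<Rightarrow> complex" where
  "dft f k = (\<Sum>p<m. of_real (f p) * cnj (phase (zk k) p)) / of_nat m"

lemma finite_freqs: "finite freqs"
  by (simp add: freqs_def finite_PiE)

lemma m_pos: "0 < m"
  using N by (simp add: m)

lemma root_tuple_zk: "root_tuple (zk k)"
  using zeta_power_eq_1[OF N] by (simp add: root_tuple_def zk_def)

lemma Ez_phase: "Ez z = Dg m (phase z)"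
  by (simp add: Ez_def phase_def[abs_def])

lemma cmod_phase: "root_tuple z \<Longrightarrow> cmod (phase z p) = 1"
  by (simp add: phase_def prod_norm[symmetric] norm_power cmod_root_tuple)

lemma phase_orthogonality:
  assumes "p < m" "q < m"
  shows "(\<Sum>k\<in>freqs. phase (zk k) p * cnj (phase (zk k) q)) = (if p = q then of_nat m else 0)"
proof -
  have "(\<Sum>k\<in>freqs. phase (zk k) p * cnj (phase (zk k) q))
      = (\<Sum>k\<in>freqs. \<Prod>i\<in>UNIV. zeta N (k i) ^ dg N p i * cnj (zeta N (k i)) ^ dg N q i)"
    by (simp add: phase_def zk_def prod.distrib)
  also have "\<dots> = (\<Prod>i\<in>(UNIV :: 'd set). \<Sum>g<N. zeta N g ^ dg N p i * cnj (zeta N g) ^ dg N q i)"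
    unfolding freqs_def by (rule prod_sum_PiE[symmetric]) auto
  also have "\<dots> = (\<Prod>i\<in>(UNIV :: 'd set). if dg N p i = dg N q i then of_nat N else 0)"
    by (simp add: zeta_orthogonality dg_lt[OF N])
  also have "\<dots> = (if p = q then of_nat m else 0)"
  proof (cases "p = q")
    case True
    then show ?thesis by (simp add: m)
  next
    case False
    then obtain i :: 'd where "dg N p i \<noteq> dg N q i"
      using dg_inject[OF N, where 'd = 'd] assms unfolding m by blast
    then show ?thesis using False by (auto intro!: prod_zero)
  qed
  finally show ?thesis .
qed

lemma dft_inversion:
  assumes "p < m"
  shows "(\<Sum>k\<in>freqs. dft f k * phase (zk k) p) = of_real (f p)"
proof -
  have "(\<Sum>k\<in>freqs. dft f k * phase (zk k) p)
      = (\<Sum>k\<in>freqs. \<Sum>q<m. of_real (f q) / of_nat m * (phase (zk k) p * cnj (phase (zk k) q)))"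
    by (simp add: dft_def sum_divide_distrib sum_distrib_left sum_distrib_right mult_ac)
  also have "\<dots> = (\<Sum>q<m. of_real (f q) / of_nat m * (\<Sum>k\<in>freqs. phase (zk k) p * cnj (phase (zk k) q)))"
    by (subst sum.swap) (simp add: sum_distrib_left)
  also have "\<dots> = (\<Sum>q<m. if p = q then of_real (f q) else 0)"
    using m_pos by (intro sum.cong) (auto simp: phase_orthogonality assms)
  finally show ?thesis using assms by simp
qed

lemma norm_dft:
  assumes "\<And>p. p < m \<Longrightarrow> \<bar>f p\<bar> \<le> B"
  shows "cmod (dft f k) \<le> B"
proof -
  have "cmod (\<Sum>p<m. of_real (f p) * cnj (phase (zk k) p)) \<le> (\<Sum>p<m. B)"
    by (rule order_trans[OF norm_sum sum_mono])
      (use assms in \<open>simp add: norm_mult cmod_phase[OF root_tuple_zk]\<close>)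
  then show ?thesis
    using m_pos by (simp add: dft_def norm_divide divide_le_eq mult.commute)
qed

text \<open>Summation by parts: \<open>sh N i\<close> permutes the rows, so reindexing moves the
  shift onto the plane wave, where it is the factor \<open>zk k i\<close>.\<close>

lemma dft_shift: "dft (\<lambda>p. f (sh N i p) - f p) k = (zk k i - 1) * dft f k"
proof -
  let ?z = "zk k"
  have ph: "cnj (phase ?z p) = ?z i * cnj (phase ?z (sh N i p))" for p
  proof -
    have "?z i * cnj (phase ?z (sh N i p)) = (?z i * cnj (?z i)) * cnj (phase ?z p)"
      unfolding phase_def phase_shift[OF root_tuple_zk] by simp
    then show ?thesis by (simp add: root_tuple_cnj[OF root_tuple_zk])
  qed
  have "(\<Sum>p<m. of_real (f (sh N i p)) * cnj (phase ?z p))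
      = ?z i * (\<Sum>p<m. of_real (f (sh N i p)) * cnj (phase ?z (sh N i p)))"
    unfolding sum_distrib_left by (rule sum.cong[OF refl], subst ph) (rule mult.left_commute)
  also have "(\<Sum>p<m. of_real (f (sh N i p)) * cnj (phase ?z (sh N i p))) = (\<Sum>p<m. of_real (f p) * cnj (phase ?z p))"
    by (rule sum.reindex_bij_betw)
      (simp add: bij_betw_def inj_on_def sh_eq_iff sh_image[OF N] m[symmetric], use sh_image[OF N, of i] in \<open>simp add: m\<close>)
  finally show ?thesis
    by (simp add: dft_def left_diff_distrib sum_subtractf diff_divide_distrib)
qed

text \<open>At the wrap-around the two points differ by a full period in direction \<open>i\<close>;
  this is where periodicity is needed.\<close>

lemma grid_point_shift:
  fixes i :: 'd and f :: "real^'d \<Rightarrow> real"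
  assumes "coordinatewise_periodic (b - a) f"
  shows "f (grid_point a b N (sh N i p)) = f (grid_point a b N p + axis i ((b - a) / real N))"
proof -
  have g: "grid_point a b N q $ j = a + (b - a) * real (dg N q j) / real N" for q and j :: 'd
    by (simp add: grid_point_def dg_def place_def)
  have coords: "axis i c $ j = (if j = i then c else 0)" for c :: real and j
    by (simp add: axis_def)
  show ?thesis
  proof (cases "dg N p i + 1 = N")
    case True
    then have N1: "real (dg N p i) = real N - 1" by simp
    have "grid_point a b N p + axis i ((b - a) / real N) = grid_point a b N (sh N i p) + axis i (b - a)"
    proof (rule Finite_Cartesian_Product.vec_eq_iff[THEN iffD2], rule allI)
      fix j
      show "(grid_point a b N p + axis i ((b - a) / real N)) $ j = (grid_point a b N (sh N i p) + axis i (b - a)) $ j"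
        using True N by (cases "j = i") (auto simp: g coords sh_parts[OF N] dg_sh_other[OF N] N1 field_simps)
    qed
    then show ?thesis
      using assms by (simp add: coordinatewise_periodic_def)
  next
    case False
    then have lt: "dg N p i + 1 < N" using dg_lt[OF N, of p i] by simp
    have "grid_point a b N p + axis i ((b - a) / real N) = grid_point a b N (sh N i p)"
    proof (rule Finite_Cartesian_Product.vec_eq_iff[THEN iffD2], rule allI)
      fix j
      show "(grid_point a b N p + axis i ((b - a) / real N)) $ j = grid_point a b N (sh N i p) $ j"
        using lt N by (cases "j = i") (auto simp: g coords sh_parts[OF N] dg_sh_other[OF N] field_simps)
    qed
    then show ?thesis by simp
  qed
qed

lemma periodic_fdiff: "coordinatewise_periodic c f \<Longrightarrow> coordinatewise_periodic c (fdiff \<epsilon> i f)"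
  unfolding coordinatewise_periodic_def fdiff_def by (metis add.assoc add.commute)

lemma dft_iterated_fdiff:
  fixes f :: "real^'d \<Rightarrow> real"
  assumes "coordinatewise_periodic (b - a) f"
  shows "dft (\<lambda>p. foldr (fdiff ((b - a) / real N)) is f (grid_point a b N p)) k
    = prod_list (map (\<lambda>i. zk k i - 1) is) * dft (\<lambda>p. f (grid_point a b N p)) k"
proof (induction "is")
  case (Cons i "is")
  let ?g = "foldr (fdiff ((b - a) / real N)) is f"
  have "coordinatewise_periodic (b - a) ?g"
    by (induction "is") (simp_all add: assms periodic_fdiff)
  then have "dft (\<lambda>p. fdiff ((b - a) / real N) i ?g (grid_point a b N p)) k
      = dft (\<lambda>p. ?g (grid_point a b N (sh N i p)) - ?g (grid_point a b N p)) k"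
    by (simp add: fdiff_def grid_point_shift)
  also have "\<dots> = (zk k i - 1) * dft (\<lambda>p. ?g (grid_point a b N p)) k"
    by (rule dft_shift)
  finally show ?case
    by (simp add: Cons.IH mult.assoc)
qed simp

section \<open>Decay estimates and weighted sums of Fourier coefficients\<close>

definition mu1 :: "('d \<Rightarrow> nat) \<Rightarrow> 'd \<Rightarrow> real" where
  "mu1 k i = real N * cmod (zk k i - 1)"

text \<open>A difference of step (b - a) / N gains 1 / N by smoothness and is multiplication by z -
  1 on the Fourier side. Moving \<open>N\<close> across turns |z - 1| into \<open>mu1\<close> and
  leaves a bound free of \<open>N\<close>.\<close>

lemma dft_decay:
  fixes f :: "real^'d \<Rightarrow> real"
  assumes f: "symbol_class_S1 f" "coordinatewise_periodic (b - a) f" and ab: "a < b"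
    and B: "\<And>x. \<bar>foldr partial_deriv (rev is) f x\<bar> \<le> B"
  shows "cmod (dft (\<lambda>p. f (grid_point a b N p)) k) * prod_list (map (mu1 k) is) \<le> (b - a) ^ length is * B"
proof -
  let ?v = "dft (\<lambda>p. f (grid_point a b N p)) k"
  have n: "cmod (prod_list (map (\<lambda>i. zk k i - 1) is)) * real N ^ length is = prod_list (map (mu1 k) is)"
    by (induction "is") (simp_all add: norm_mult mu1_def mult_ac)
  have "cmod (prod_list (map (\<lambda>i. zk k i - 1) is) * ?v) \<le> ((b - a) / real N) ^ length is * B"
    unfolding dft_iterated_fdiff[OF f(2), symmetric]
    by (rule norm_dft, rule iterated_fdiff_bound[OF f(1) B]) (use ab in simp)
  then have "cmod (prod_list (map (\<lambda>i. zk k i - 1) is) * ?v) * real N ^ length is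
      \<le> ((b - a) / real N) ^ length is * B * real N ^ length is"
    by (rule mult_right_mono) simp
  then show ?thesis
    using N unfolding n[symmetric] by (simp add: norm_mult power_divide mult_ac)
qed

text \<open>For each frequency the decay is applied to the set of coordinates with
  \<open>mu1\<close> at least 1. That set varies with \<open>k\<close>; summing \<open>C\<close>
  over all subsets removes the dependence.\<close>

lemma weighted_dft_sum:
  fixes v :: "('d \<Rightarrow> nat) \<Rightarrow> complex"
  assumes C: "\<And>k I. cmod (v k) * (\<Prod>i\<in>I. mu1 k i ^ 4) \<le> C I"
  shows "(\<Sum>k\<in>freqs. cmod (v k) * weight (zk k)) \<le> 64 ^ CARD('d) * (\<Sum>I\<in>Pow UNIV. C I)"
proof -
  let ?S = "\<Sum>I\<in>Pow (UNIV :: 'd set). C I"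
  have mu0: "0 \<le> mu1 k i" for k i by (simp add: mu1_def)
  have C0: "0 \<le> C I" for I
    by (rule order_trans[OF _ C[of undefined I]]) (intro mult_nonneg_nonneg prod_nonneg, auto simp: mu0)
  have S0: "0 \<le> ?S" by (rule sum_nonneg) (rule C0)
  have summand: "cmod (v k) * weight (zk k) \<le> 16 ^ CARD('d) * ?S * (\<Prod>i\<in>UNIV. 1 / (1 + mu1 k i)\<^sup>2)" for k
  proof -
    define I where "I = {i. 1 \<le> mu1 k i}"
    define P where "P = (\<Prod>i\<in>UNIV. 1 + mu1 k i)"
    have P0: "0 < P" unfolding P_def by (rule prod_pos) (simp add: mu0 add_pos_nonneg)
    have "P ^ 4 = (\<Prod>i\<in>UNIV. (1 + mu1 k i) ^ 4)"
      by (simp add: P_def prod_power_distrib)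
    also have "\<dots> \<le> (\<Prod>i\<in>UNIV. 16 * (if i \<in> I then mu1 k i ^ 4 else 1))"
    proof (rule prod_mono)
      fix i :: 'd
      have "(1 + mu1 k i) ^ 4 \<le> (2 * max 1 (mu1 k i)) ^ 4"
        by (rule power_mono) (auto simp: mu0)
      also have "\<dots> = 16 * (if i \<in> I then mu1 k i ^ 4 else 1)"
        by (simp add: power_mult_distrib max_def I_def)
      finally show "0 \<le> (1 + mu1 k i) ^ 4 \<and> (1 + mu1 k i) ^ 4 \<le> 16 * (if i \<in> I then mu1 k i ^ 4 else 1)"
        by (simp add: mu0)
    qed
    also have "\<dots> = 16 ^ CARD('d) * (\<Prod>i\<in>I. mu1 k i ^ 4)"
      by (simp add: prod.distrib prod.If_cases)
    finally have "cmod (v k) * P ^ 4 \<le> 16 ^ CARD('d) * (cmod (v k) * (\<Prod>i\<in>I. mu1 k i ^ 4))"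
      using mult_left_mono[of "P ^ 4" _ "cmod (v k)"] by (simp add: mult.left_commute)
    also have "\<dots> \<le> 16 ^ CARD('d) * ?S"
      by (intro mult_left_mono order_trans[OF C] member_le_sum) (auto simp: C0)
    finally have vP: "cmod (v k) * P ^ 4 \<le> 16 ^ CARD('d) * ?S" .
    have "weight (zk k) \<le> P\<^sup>2"
      unfolding weight_def mu_def P_def mu1_def[symmetric]
      by (intro power_mono one_plus_sum_le_prod add_nonneg_nonneg sum_nonneg) (auto simp: mu0)
    then have "cmod (v k) * weight (zk k) \<le> cmod (v k) * P\<^sup>2"
      by (rule mult_left_mono) simp
    also have "\<dots> = cmod (v k) * P ^ 4 * (1 / P\<^sup>2)"
      using P0 by (simp add: power_numeral_reduce)
    also have "\<dots> \<le> 16 ^ CARD('d) * ?S * (1 / P\<^sup>2)"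
      by (rule mult_right_mono[OF vP]) simp
    also have "1 / P\<^sup>2 = (\<Prod>i\<in>UNIV. 1 / (1 + mu1 k i)\<^sup>2)"
      by (simp add: P_def prod_power_distrib prod_dividef)
    finally show ?thesis .
  qed
  have "(\<Sum>k\<in>freqs. cmod (v k) * weight (zk k))
      \<le> (\<Sum>k\<in>freqs. 16 ^ CARD('d) * ?S * (\<Prod>i\<in>UNIV. 1 / (1 + mu1 k i)\<^sup>2))"
    by (rule sum_mono) (rule summand)
  also have "\<dots> = 16 ^ CARD('d) * ?S * (\<Sum>k\<in>freqs. \<Prod>i\<in>UNIV. 1 / (1 + real N * cmod (zeta N (k i) - 1))\<^sup>2)"
    by (simp only: sum_distrib_left mu1_def zk_def)
  also have "(\<Sum>k\<in>freqs. \<Prod>i\<in>UNIV. 1 / (1 + real N * cmod (zeta N (k i) - 1))\<^sup>2)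
      = (\<Prod>i\<in>(UNIV :: 'd set). \<Sum>g<N. 1 / (1 + real N * cmod (zeta N g - 1))\<^sup>2)"
    unfolding freqs_def by (rule prod_sum_PiE[symmetric]) auto
  also have "16 ^ CARD('d) * ?S * \<dots> \<le> 16 ^ CARD('d) * ?S * (\<Prod>i\<in>(UNIV :: 'd set). 4)"
    by (intro mult_left_mono prod_mono conjI sum_zeta_weight_le sum_nonneg) (use S0 in auto)
  \<comment> \<open>Per coordinate, 16 comes from (1 + x)^4 \<le> (2 max(1, x))^4 and 4 from
    \<open>sum_zeta_weight_le\<close>.\<close>
  also have "\<dots> = 64 ^ CARD('d) * ?S"
    by (simp add: power_mult_distrib[symmetric])
  finally show ?thesis .
qed

lemma weighted_dft_bound:
  fixes f :: "real^'d \<Rightarrow> real"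
  assumes f: "symbol_class_S1 f" "coordinatewise_periodic (b - a) f" and ab: "a < b"
    and B: "\<And>I x. \<bar>foldr partial_deriv (rev (fourfold_list I)) f x\<bar> \<le> B I"
  shows "(\<Sum>k\<in>freqs. cmod (dft (\<lambda>p. f (grid_point a b N p)) k) * weight (zk k))
    \<le> 64 ^ CARD('d) * (\<Sum>I\<in>Pow UNIV. (b - a) ^ length (fourfold_list I) * B I)"
proof (rule weighted_dft_sum)
  fix k and I :: "'d set"
  show "cmod (dft (\<lambda>p. f (grid_point a b N p)) k) * (\<Prod>i\<in>I. mu1 k i ^ 4) \<le> (b - a) ^ length (fourfold_list I) * B I"
    using dft_decay[OF f ab B] by (simp add: prod_list_fourfold)
qed

lemma Dg_dft: "Dg m (\<lambda>p. of_real (f p)) = (\<Sum>k\<in>freqs. cs (dft f k) * Ez (zk k))"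
  unfolding Ez_phase cs_Dg Dg_sum by (rule Dg_cong) (simp add: dft_inversion)

text \<open>Commuting a shift past a diagonal operator leaves the diagonal of increments times the
  shift; each direction has two shifts with coefficient of modulus \<kappa> N^2 / 2.\<close>

lemma norm_br_Lt_Dg:
  assumes \<delta>: "0 \<le> \<delta>" "\<And>i p. p < m \<Longrightarrow> cmod (f (sh N (i::'d) p) - f p) \<le> \<delta>"
  shows "norm (br (Lt (\<lambda>_. 1)) (Dg m f)) \<le> real CARD('d) * \<kappa> * (real N)\<^sup>2 * \<delta>"
proof -
  have "br (Sf i) (Dg m f) = Dg m (\<lambda>p. f (sh N i p) - f p) * Sf i" for i
    by (simp add: br_def Sf_Dg Dg_diff[symmetric] left_diff_distrib)
  moreover have d: "norm (Dg m (\<lambda>p. f (sh N i p) - f p)) \<le> \<delta>" for i :: 'd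
    using \<delta> by (intro norm_Dg) auto
  ultimately have f: "norm (br (Sf i) (Dg m f)) \<le> \<delta>" for i
    by (metis norm_contraction_mult(2)[OF norm_Sf] order_trans)
  have "br (Sb i) (Dg m f) = - (Sb i * Dg m (\<lambda>p. f (sh N i p) - f p))" for i
    by (simp add: br_def Sb_Dg Dg_diff[symmetric] right_diff_distrib)
  then have b: "norm (br (Sb i) (Dg m f)) \<le> \<delta>" for i
    using order_trans[OF norm_contraction_mult(1)[OF norm_Sb] d] by simp
  have c: "br (cs c * X) Y = cs c * br X Y" for c X Y
    using br_cs[of c X 1 Y] by (simp add: cs_1)
  have "br (Lt (\<lambda>_. 1)) (Dg m f) = (\<Sum>i\<in>UNIV. cs \<gamma> * br (Sf i) (Dg m f) + cs \<gamma> * br (Sb i) (Dg m f))"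
    by (simp add: Lt_def br_sum br_simps c)
  also have "norm \<dots> \<le> (\<Sum>i\<in>(UNIV :: 'd set). cmod \<gamma> * \<delta> + cmod \<gamma> * \<delta>)"
    by (intro order_trans[OF norm_sum sum_mono] norm_triangle_mono order_trans[OF norm_cs_mult_le] mult_left_mono f b) auto
  also have "\<dots> = real CARD('d) * \<kappa> * (real N)\<^sup>2 * \<delta>"
    by (simp add: cmod_gamma mult_ac)
  finally show ?thesis .
qed

end

section \<open>Conjugation by a skew-adjoint flow\<close>

lemma skew_conj:
  assumes "skew G" "skew Z"
  shows "skew (exp (scaleR t G) * Z * exp (scaleR (- t) G))"
proof -
  have adj: "inner (app (exp (scaleR t G)) u) v = inner u (app (exp (scaleR (- t) G)) v)" for u v t
  proof -
    have "v = app (exp (scaleR t G)) (app (exp (scaleR (- t) G)) v)"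
      using exp_mult_exp_minus(1)[of "scaleR t G"] app_simps(7)[of "exp (scaleR t G)" "exp (scaleR (- t) G)" v] by simp
    then show ?thesis
      using inner_exp_skew[OF assms(1), of t u "app (exp (scaleR (- t) G)) v"] by simp
  qed
  show ?thesis
    using assms(2) adj[of t] adj[of "- t"] by (simp add: skew_def)
qed

lemma conj_lipschitz:
  assumes "skew G" "t' \<le> t"
  shows "norm (exp (scaleR t G) * Z * exp (scaleR (- t) G) - exp (scaleR t' G) * Z * exp (scaleR (- t') G))
    \<le> norm (br G Z) * (t - t')"
proof (rule norm_increment_le[where f = "\<lambda>t. exp (scaleR t G) * Z * exp (scaleR (- t) G)"
      and f' = "\<lambda>t. exp (scaleR t G) * br G Z * exp (scaleR (- t) G)", OF assms(2)])
  fix s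
  have "((\<lambda>t. exp (scaleR t G) * Z * exp (scaleR (- t) G)) has_vector_derivative
      (exp (scaleR s G) * Z) * scaleR (- 1) (G * exp (scaleR (- s) G))
      + (exp (scaleR s G) * 0 + scaleR 1 (G * exp (scaleR s G)) * Z) * exp (scaleR (- s) G)) (at s within {t'..t})"
    by (intro has_vector_derivative_mult exp_scaleR_derivative derivative_intros)
  then show "((\<lambda>t. exp (scaleR t G) * Z * exp (scaleR (- t) G)) has_vector_derivative
      exp (scaleR s G) * br G Z * exp (scaleR (- s) G)) (at s within {t'..t})"
    by (simp add: algebra_simps br_def exp_scaleR_left_commute)
  show "norm (exp (scaleR s G) * br G Z * exp (scaleR (- s) G)) \<le> norm (br G Z)"
    by (intro norm_conj_le norm_exp_scaleR_skew assms)
qed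

section \<open>The error estimate\<close>

context torus_grid
begin

text \<open>The terms \<open>2 * of_bool (p = q)\<close> of all directions add up to one scalar, and
  the shift terms form \<open>Lt\<close>. Keeping the three terms separate also covers
  \<open>N\<close> at most 2.\<close>

lemma emb_A_dis:
  assumes \<kappa>ab: "\<kappa> = 1 / (b - a)\<^sup>2"
  shows "cs \<i> * emb m (A_dis CARD('d) a b N) = cs (\<i> * of_real (real CARD('d) * \<kappa> * (real N)\<^sup>2)) * proj m + Lt (\<lambda>_. 1)"
proof -
  have c: "complex_of_real ((real N)\<^sup>2 / (2 * (b - a)\<^sup>2)) = \<i> * \<gamma>"
    unfolding \<gamma>_def by (simp add: \<kappa>ab)
  show ?thesis
    unfolding emb_def Lt_ker proj_def cs_ker ker_add
  proof (rule ker_cong)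
    fix p q assume pq: "p < m" "q < m"
    have "A_dis CARD('d) a b N $$ (p, q)
        = (\<Sum>i\<in>(UNIV :: 'd set). \<i> * \<gamma> * (2 * of_bool (p = q) - of_bool (q = sh N i p) - of_bool (p = sh N i q)))"
      using A_dis_entry[OF N, where 'd = 'd] pq unfolding m c[symmetric] by simp
    then have "\<i> * A_dis CARD('d) a b N $$ (p, q)
        = (\<Sum>i\<in>(UNIV :: 'd set). - \<gamma> * (2 * of_bool (p = q)) + \<gamma> * (of_bool (q = sh N i p) + of_bool (p = sh N i q)))"
      by (simp add: sum_distrib_left algebra_simps)
    also have "\<dots> = of_nat CARD('d) * (- \<gamma> * (2 * of_bool (p = q)))
        + (\<Sum>i\<in>(UNIV :: 'd set). \<gamma> * (of_bool (q = sh N i p) + of_bool (p = sh N i q)))"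
      by (simp only: sum.distrib sum_constant)
    also have "of_nat CARD('d) * (- \<gamma> * (2 * of_bool (p = q)))
        = \<i> * of_real (real CARD('d) * \<kappa> * (real N)\<^sup>2) * of_bool (p = q)"
      by (simp add: \<gamma>_def)
    finally show "\<i> * A_dis CARD('d) a b N $$ (p, q)
        = \<i> * of_real (real CARD('d) * \<kappa> * (real N)\<^sup>2) * of_bool (p = q)
          + (\<Sum>i\<in>(UNIV :: 'd set). \<gamma> * (1 * of_bool (q = sh N i p) + cnj 1 * of_bool (p = sh N i q)))"
      by simp
  qed
qed

lemma emb_B_dis:
  fixes V :: "real^'d \<Rightarrow> real"
  shows "emb m (B_dis a b N V) = Dg m (\<lambda>p. of_real (V (grid_point a b N p)))"
  unfolding emb_def Dg_def by (rule ker_cong) (auto simp: B_dis_def mat_diag_def m)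

lemma grid_difference_bound:
  fixes i :: 'd and V :: "real^'d \<Rightarrow> real"
  assumes V: "symbol_class_S1 V" "coordinatewise_periodic (b - a) V" and ab: "a < b"
    and K: "\<And>i x. \<bar>partial_deriv i V x\<bar> \<le> K"
  shows "cmod (of_real (V (grid_point a b N (sh N i p))) - of_real (V (grid_point a b N p))) \<le> (b - a) / real N * K"
proof -
  have "\<bar>fdiff ((b - a) / real N) i V (grid_point a b N p)\<bar> \<le> (b - a) / real N * K"
    by (rule fdiff_bound) (use S1_differentiable[OF V(1), of "[]"] K ab in auto)
  then show ?thesis
    unfolding fdiff_def grid_point_shift[OF V(2)] of_real_diff[symmetric] norm_of_real by simp
qed

text \<open>Here the two halves meet: \<open>Y t\<close> is - \<i> times the embedded Hamiltonian
  and a sum of conjugated plane waves, so one constant \<open>q\<close> serves all commutator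
  hypotheses of \<open>magnus_global_error\<close>.\<close>

lemma magnus_error_on_grid:
  fixes V :: "real^'d \<Rightarrow> real" and U :: "real \<Rightarrow> complex mat" and L M :: nat and a b :: real
  defines "H \<equiv> H_int (A_dis CARD('d) a b N) (B_dis a b N V)"
  assumes ab: "a < b" and \<kappa>ab: "\<kappa> = 1 / (b - a)\<^sup>2"
    and V: "symbol_class_S1 V" "coordinatewise_periodic (b - a) V"
    and K: "\<And>i x. \<bar>partial_deriv i V x\<bar> \<le> K"
    and Q: "(\<Sum>k\<in>freqs. cmod (dft (\<lambda>p. V (grid_point a b N p)) k) * weight (zk k)) \<le> Q"
    and q: "1 \<le> q" "Q \<le> q" "\<kappa> * Q\<^sup>2 \<le> q" "(2 * \<kappa>\<^sup>2 + \<kappa>) * Q ^ 3 \<le> q"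
    and h: "1 / real N \<le> h" "h \<le> 1" and M: "0 < M" and T: "T = real L * h"
    and U: "time_ordered_exp m H T U"
  shows "spectral_norm (U T - magnus_U2 m M H h L) \<le> T * (real CARD('d) * K / (b - a) * real N * h / real M + 45 * q ^ 3 * h ^ 4)"
    and "0 \<le> spectral_norm (H t)"
proof -
  let ?v = "dft (\<lambda>p. V (grid_point a b N p))"
  let ?Q = "\<Sum>k\<in>freqs. cmod (?v k) * weight (zk k)"
  define G where "G = cs \<i> * emb m (A_dis CARD('d) a b N)"
  define D where "D = Dg m (\<lambda>p. complex_of_real (V (grid_point a b N p)))"
  define Y where "Y = (\<lambda>t. cs (- \<i>) * emb m (H t))"
  define \<Lambda> where "\<Lambda> = real CARD('d) * K / (b - a) * real N"
  have h0: "0 \<le> h" using h(1) by (rule order_trans[rotated]) simp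
  have A: "A_dis CARD('d) a b N \<in> carrier_mat m m" and B: "B_dis a b N V \<in> carrier_mat m m"
    using A_dis_carrier[OF N] by (auto simp: m B_dis_def)
  have H: "H t \<in> carrier_mat m m" for t
    unfolding H_def by (rule H_int_carrier[OF A B])
  then show "0 \<le> spectral_norm (H t)"
    by (rule spectral_norm_bounds(2)) (rule m_pos)
  have G: "G = cs (\<i> * of_real (real CARD('d) * \<kappa> * (real N)\<^sup>2)) * proj m + Lt (\<lambda>_. 1)"
    unfolding G_def by (rule emb_A_dis[OF \<kappa>ab])
  have skP: "skew (cs (\<i> * of_real r) * proj m)" for r
    unfolding proj_def cs_ker by (rule skew_ker) auto
  have skG: "skew G"
    unfolding G by (intro skew_add skP skew_Lt)
  have embH: "emb m (H t) = exp (scaleR t G) * D * exp (scaleR (- t) G)" for t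
    unfolding H_def emb_H_int[OF A B] G_def emb_B_dis D_def ..
  have Yc: "Y t = exp (scaleR t G) * (cs (- \<i>) * D) * exp (scaleR (- t) G)" for t
    unfolding Y_def embH cs_left_commute[of "exp (scaleR t G)"] by (simp add: mult.assoc)
  have skD: "skew (cs (- \<i>) * D)"
    unfolding D_def Dg_def cs_ker by (rule skew_ker) auto
  have skY: "skew (Y t)" for t
    unfolding Yc by (rule skew_conj[OF skG skD])
  have D_sum: "D = (\<Sum>k\<in>freqs. cs (?v k) * Ez (zk k))"
    unfolding D_def by (rule Dg_dft)
  have Y_sum: "Y t = (\<Sum>k\<in>freqs. cs (- \<i> * ?v k) * Fz (zk k) t)" for t
  proof -
    have "exp (scaleR t G) * (cs c * Ez (zk k)) * exp (scaleR (- t) G) = cs c * Fz (zk k) t" for c k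
      unfolding conj_Ez[OF root_tuple_zk, of t _ k, symmetric, where r = "real CARD('d) * \<kappa> * (real N)\<^sup>2"] G
      by (simp add: cs_left_commute[of "exp _"] mult.assoc)
    then show ?thesis
      unfolding Y_def embH D_sum sum_distrib_left sum_distrib_right cs_mult mult.assoc by simp
  qed
  have Qc: "(\<Sum>k\<in>freqs. cmod (- \<i> * ?v k) * weight (zk k)) = ?Q"
    by (simp add: norm_mult)
  have Q0: "0 \<le> ?Q"
    by (intro sum_nonneg mult_nonneg_nonneg) (auto simp: weight_def)
  have Q2: "?Q\<^sup>2 \<le> Q\<^sup>2" and Q3: "?Q ^ 3 \<le> Q ^ 3"
    using Q Q0 by (auto intro: power_mono)
  have K0: "0 \<le> K"
    using K[of undefined undefined] by linarith
  have norm_cs_i: "norm (cs (- \<i>) * F) \<le> norm F" for F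
    using norm_cs_mult_le[of "- \<i>" F] by simp
  have lip: "norm (Y t - Y t') \<le> \<Lambda> * (t - t')" if "t' \<le> t" for t t'
  proof -
    have "Y t - Y t' = cs (- \<i>) * (exp (scaleR t G) * D * exp (scaleR (- t) G) - exp (scaleR t' G) * D * exp (scaleR (- t') G))"
      by (simp add: Y_def embH right_diff_distrib)
    then have "norm (Y t - Y t') \<le> norm (exp (scaleR t G) * D * exp (scaleR (- t) G) - exp (scaleR t' G) * D * exp (scaleR (- t') G))"
      using norm_cs_i by metis
    also have "\<dots> \<le> norm (br G D) * (t - t')"
      by (rule conj_lipschitz[OF skG that])
    \<comment> \<open>The scalar part of \<open>G\<close> commutes with \<open>D\<close>.\<close>
    also have "br G D = br (Lt (\<lambda>_. 1)) D"
      unfolding G br_simps D_def by (simp add: br_def mult.assoc cs_left_commute[of "Dg _ _"] proj_Dg)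
    also have "norm (br (Lt (\<lambda>_. 1)) D) \<le> real CARD('d) * \<kappa> * (real N)\<^sup>2 * ((b - a) / real N * K)"
      unfolding D_def by (rule norm_br_Lt_Dg) (use grid_difference_bound[OF V ab K] ab K0 in auto)
    \<comment> \<open>One factor \<open>N\<close> survives: N^2 from the Laplacian against
      increments of \<open>V\<close> of order 1 / N.\<close>
    also have "\<dots> = \<Lambda>"
      using ab N by (simp add: \<kappa>ab \<Lambda>_def power2_eq_square)
    finally show ?thesis
      using that by (simp add: mult_right_mono)
  qed
  have dU: "((\<lambda>s. emb m (U s)) has_vector_derivative Y t * emb m (U t)) (at t within {0..T})" if "t \<in> {0..T}" for t
    unfolding Y_def by (rule emb_time_ordered_exp[OF U H that])
  have U0: "emb m (U 0) = proj m"
    using U by (simp add: time_ordered_exp_def emb_one)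
  have "norm (emb m (U T) - magnus_product Y M h L * emb m (U 0)) \<le> T * (\<Lambda> * h / real M + 45 * q ^ 3 * h ^ 4)"
  proof (rule magnus_global_error)
    show "norm (Y t) \<le> q" for t
      unfolding Y_sum using norm_Fz_sum[of freqs zk "\<lambda>k. - \<i> * ?v k" t] Q q(2)
      by (simp add: finite_freqs root_tuple_zk norm_mult)
    show "norm (br (Y t) (Y s)) \<le> h * q" if "\<bar>t - s\<bar> \<le> h" for t s
    proof -
      have "norm (br (Y t) (Y s)) \<le> \<bar>t - s\<bar> * \<kappa> * ?Q\<^sup>2"
        unfolding Y_sum Qc[symmetric] by (rule norm_br_Fz_sum) (simp_all add: finite_freqs root_tuple_zk)
      also have "\<dots> \<le> h * (\<kappa> * Q\<^sup>2)"
        using that Q2 \<kappa> unfolding mult.assoc by (intro mult_mono) auto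
      also have "\<dots> \<le> h * q"
        by (rule mult_left_mono[OF q(3) h0])
      finally show ?thesis .
    qed
    show "norm (br (Y r) (br (Y t) (Y s))) \<le> h\<^sup>2 * q"
      if "\<bar>r - t\<bar> \<le> h" "\<bar>r - s\<bar> \<le> h" "\<bar>t - s\<bar> \<le> h" for r t s
    proof -
      have "norm (br (Y r) (br (Y t) (Y s))) \<le> h\<^sup>2 * (2 * \<kappa>\<^sup>2 + \<kappa>) * ?Q ^ 3"
        unfolding Y_sum Qc[symmetric]
        by (rule norm_br_br_Fz_sum) (use that h(1) in \<open>simp_all add: finite_freqs root_tuple_zk\<close>)
      also have "\<dots> \<le> h\<^sup>2 * ((2 * \<kappa>\<^sup>2 + \<kappa>) * Q ^ 3)"
        using Q3 \<kappa> unfolding mult.assoc by (intro mult_left_mono) auto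
      also have "\<dots> \<le> h\<^sup>2 * q"
        by (rule mult_left_mono[OF q(4)]) simp
      finally show ?thesis .
    qed
    show "0 \<le> \<Lambda>"
      using K0 ab by (simp add: \<Lambda>_def)
    show "norm (emb m (U 0)) \<le> 1"
      by (simp add: U0 norm_proj)
  qed (use h0 h M q T dU skY lip in auto)
  moreover have "emb m (U T) - magnus_product Y M h L * emb m (U 0) = emb m (U T - magnus_U2 m M H h L)"
    unfolding U0 Y_def emb_diff[OF emb_magnus_U2(2)[of H, OF H]] emb_magnus_U2(1)[of H, OF H] ..
  moreover have "U T - magnus_U2 m M H h L \<in> carrier_mat m m"
    using emb_magnus_U2(2)[of H, OF H, where M = M and h = h and j = L] by (rule minus_carrier_mat)
  ultimately show "spectral_norm (U T - magnus_U2 m M H h L) \<le> T * (real CARD('d) * K / (b - a) * real N * h / real M + 45 * q ^ 3 * h ^ 4)"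
    using spectral_norm_bounds(1)[OF _ m_pos, of "U T - magnus_U2 m M H h L"] by (simp add: \<Lambda>_def)
qed

end

theorem mainTheorem5:
  fixes a b K :: real
  assumes "a < b"
  shows "\<exists>C::real. \<forall>V :: real^'d::finite \<Rightarrow> real.
    symbol_class_S1 V \<longrightarrow> coordinatewise_periodic (b - a) V \<longrightarrow>
    (\<forall>i x. \<bar>partial_deriv i V x\<bar> \<le> K) \<longrightarrow>
    (\<exists>C\<^sub>V::real. \<forall>(N::nat) (L::nat) (M::nat) (T::real) (\<alpha>::real) (U :: real \<Rightarrow> complex mat).
      let m = N ^ CARD('d);
          H = H_int (A_dis CARD('d) a b N) (B_dis a b N V);
          \<Delta>t = T / real L
      in 0 < N \<longrightarrow> 0 < L \<longrightarrow> 0 < M \<longrightarrow>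
         1 / real N \<le> \<Delta>t \<longrightarrow> \<Delta>t \<le> 1 \<longrightarrow>
         (\<forall>t\<in>{0..T}. spectral_norm (H t) \<le> \<alpha>) \<longrightarrow>
         time_ordered_exp m H T U \<longrightarrow>
         spectral_norm (U T - magnus_U2 m M H \<Delta>t L)
           \<le> \<Delta>t ^ 4 * T * C\<^sub>V * (13 / 24 + 5 / 12 * \<Delta>t * \<alpha>)
             + C * (T * \<Delta>t / real M) * (1 + 3 * \<Delta>t * \<alpha>) * real N)"
proof -
  define \<kappa> where "\<kappa> = 1 / (b - a)\<^sup>2"
  \<comment> \<open>The Lipschitz constant of the interaction Hamiltonian divided by
    \<open>N\<close>. It sees \<open>V\<close> only through \<open>K\<close>, so it can be fixed
    before \<open>V\<close>.\<close>
  define C where "C = real CARD('d) * K / (b - a)"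
  have \<kappa>: "0 \<le> \<kappa>" by (simp add: \<kappa>_def)
  show ?thesis
  proof (rule exI[of _ C], intro allI impI)
    fix V :: "real^'d \<Rightarrow> real"
    assume V: "symbol_class_S1 V" "coordinatewise_periodic (b - a) V"
      and "\<forall>i x. \<bar>partial_deriv i V x\<bar> \<le> K"
    then have K: "\<And>i x. \<bar>partial_deriv i V x\<bar> \<le> K" by blast
    have C: "0 \<le> C"
      using K[of undefined undefined] assms by (simp add: C_def)
    have "\<forall>I. \<exists>B. \<forall>x. \<bar>foldr partial_deriv (rev (fourfold_list I)) V x\<bar> \<le> B"
      using S1_bounded[OF V(1)] by metis
    then obtain B where B: "\<And>I x. \<bar>foldr partial_deriv (rev (fourfold_list I)) V x\<bar> \<le> B I"
      by metis
    define Q where "Q = 64 ^ CARD('d) * (\<Sum>I\<in>Pow (UNIV :: 'd set). (b - a) ^ length (fourfold_list I) * B I)"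
    \<comment> \<open>A sum in place of a maximum of 1 and the commutator constants; absolute values
      avoid a discussion of the sign of \<open>Q\<close>. No grid parameter enters, so
      \<open>q\<close> precedes the choice of \<open>N\<close>.\<close>
    define q where "q = 1 + \<bar>Q\<bar> + \<kappa> * Q\<^sup>2 + (2 * \<kappa>\<^sup>2 + \<kappa>) * \<bar>Q\<bar> ^ 3"
    have n: "0 \<le> \<kappa> * Q\<^sup>2" "0 \<le> (2 * \<kappa>\<^sup>2 + \<kappa>) * \<bar>Q\<bar> ^ 3" "(2 * \<kappa>\<^sup>2 + \<kappa>) * Q ^ 3 \<le> (2 * \<kappa>\<^sup>2 + \<kappa>) * \<bar>Q\<bar> ^ 3"
      using \<kappa> abs_ge_self[of "Q ^ 3"] by (simp_all add: mult_left_mono power_abs)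
    have q: "1 \<le> q" "Q \<le> q" "\<kappa> * Q\<^sup>2 \<le> q" "(2 * \<kappa>\<^sup>2 + \<kappa>) * Q ^ 3 \<le> q"
      using n unfolding q_def by linarith+
    show "\<exists>C\<^sub>V::real. \<forall>(N::nat) (L::nat) (M::nat) (T::real) (\<alpha>::real) (U :: real \<Rightarrow> complex mat).
      let m = N ^ CARD('d);
          H = H_int (A_dis CARD('d) a b N) (B_dis a b N V);
          \<Delta>t = T / real L
      in 0 < N \<longrightarrow> 0 < L \<longrightarrow> 0 < M \<longrightarrow>
         1 / real N \<le> \<Delta>t \<longrightarrow> \<Delta>t \<le> 1 \<longrightarrow>
         (\<forall>t\<in>{0..T}. spectral_norm (H t) \<le> \<alpha>) \<longrightarrow>
         time_ordered_exp m H T U \<longrightarrow>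
         spectral_norm (U T - magnus_U2 m M H \<Delta>t L)
           \<le> \<Delta>t ^ 4 * T * C\<^sub>V * (13 / 24 + 5 / 12 * \<Delta>t * \<alpha>)
             + C * (T * \<Delta>t / real M) * (1 + 3 * \<Delta>t * \<alpha>) * real N"
      unfolding Let_def
    \<comment> \<open>24/13 cancels 13/24, so for nonnegative \<open>\<alpha>\<close> the product
      with the bracket is at least 45 q^3.\<close>
    proof (rule exI[of _ "45 * q ^ 3 * (24 / 13)"], intro allI impI)
      fix N L M :: nat and T \<alpha> :: real and U :: "real \<Rightarrow> complex mat"
      let ?m = "N ^ CARD('d)" and ?H = "H_int (A_dis CARD('d) a b N) (B_dis a b N V)"
      assume N: "0 < N" and L: "0 < L" and M: "0 < M" and h: "1 / real N \<le> T / real L" "T / real L \<le> 1"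
        and \<alpha>: "\<forall>t\<in>{0..T}. spectral_norm (?H t) \<le> \<alpha>" and U: "time_ordered_exp ?m ?H T U"
      define h where "h = T / real L"
      have T: "T = real L * h" using L by (simp add: h_def)
      have h0: "0 \<le> h"
        using h(1) unfolding h_def by (rule order_trans[rotated]) simp
      then have T0: "0 \<le> T" by (simp add: T)
      interpret torus_grid N ?m \<kappa> "TYPE('d)"
        by unfold_locales (use N \<kappa> in auto)
      note grid = magnus_error_on_grid[OF assms \<kappa>_def V K weighted_dft_bound[OF V assms B, folded Q_def]
          q h[folded h_def] M T U]
      \<comment> \<open>Time 0 lies in the interval, and the spectral norm there is
        nonnegative.\<close>
      have \<alpha>0: "0 \<le> \<alpha>"
        using order_trans[OF grid(2)[of 0] \<alpha>[rule_format, of 0]] T0 by simp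
      have e1: "45 * q ^ 3 \<le> 45 * q ^ 3 * (24 / 13) * (13 / 24 + 5 / 12 * h * \<alpha>)"
        using q(1) h0 \<alpha>0 by (simp add: algebra_simps)
      have e2: "C \<le> C * (1 + 3 * h * \<alpha>)"
        using C h0 \<alpha>0 by (simp add: algebra_simps)
      have "spectral_norm (U T - magnus_U2 ?m M ?H h L) \<le> T * (C * real N * h / real M + 45 * q ^ 3 * h ^ 4)"
        using grid(1) unfolding C_def .
      also have "\<dots> = h ^ 4 * T * (45 * q ^ 3) + C * (T * h / real M * real N)"
        by (simp add: algebra_simps)
      also have "\<dots> \<le> h ^ 4 * T * (45 * q ^ 3 * (24 / 13) * (13 / 24 + 5 / 12 * h * \<alpha>))
          + (C * (1 + 3 * h * \<alpha>)) * (T * h / real M * real N)"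
        using e1 e2 h0 T0 by (intro add_mono mult_left_mono mult_right_mono) auto
      finally show "spectral_norm (U T - magnus_U2 ?m M ?H (T / real L) L)
          \<le> (T / real L) ^ 4 * T * (45 * q ^ 3 * (24 / 13)) * (13 / 24 + 5 / 12 * (T / real L) * \<alpha>)
            + C * (T * (T / real L) / real M) * (1 + 3 * (T / real L) * \<alpha>) * real N"
        unfolding h_def[symmetric] by (simp add: mult_ac)
    qed
  qed
qed

end
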